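(* Let $G=\langle x_1,\ldots,x_n\mid x_1^2\cdots x_n^2\rangle$ be a non-orientable surface group of genus $n\ge 3$, and let $D$ be a free discrete group on $\{y_1,\ldots,y_{n-1}\}$. If $w(y_1,y_2,\ldots,y_{n-1})\in D$ is a test element of $\widehat{D}_p$ for some prime $p\ge 3$, then $t=w(x_{i_1},x_{i_2},\ldots,x_{i_{n-1}})$ is a test element of $G$ for any choice of distinct elements $x_{i_j}\in\{x_1,\ldots,x_n\}$, $1\le j\le n-1$.
   Context: An element $g$ of a group $G$ is a test element of $G$ if every endomorphism $\varphi:G\to G$ with $\varphi(g)=g$ is an automorphism; for profinite groups, endomorphisms are required to be continuous. $\widehat{D}_p$ is the pro-$p$ completion of $D$ (a free pro-$p$ group on $\{y_1,\ldots,y_{n-1}\}$), and $D$ is identified with its image in $\widehat{D}_p$. $w(g_1,\ldots,g_{n-1})$ denotes the image of $w$ under the homomorphism sending $y_i\mapsto g_i$. *)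

theory Defs
  imports "HOL-Analysis.Function_Topology" "HOL-Algebra.Product_Groups"
    "HOL-Computational_Algebra.Primes"
begin

section \<open>Free groups\<close>

text \<open>A letter \<open>(x, True)\<close> stands for the generator \<open>x\<close>, a letter \<open>(x, False)\<close> for its
  formal inverse. The elements of the free group are the freely reduced words.\<close>

type_synonym 'a letter = "'a \<times> bool"

definition inv_letter :: "'a letter \<Rightarrow> 'a letter" where
  "inv_letter a = (fst a, \<not> snd a)"

definition reduced :: "'a letter list \<Rightarrow> bool" where
  "reduced w \<longleftrightarrow> successively (\<lambda>a b. b \<noteq> inv_letter a) w"

fun cancel_Cons :: "'a letter \<Rightarrow> 'a letter list \<Rightarrow> 'a letter list" where
  "cancel_Cons a [] = [a]"
| "cancel_Cons a (b # w) = (if b = inv_letter a then w else a # b # w)"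

definition free_group :: "'a set \<Rightarrow> 'a letter list monoid" where
  "free_group X =
     \<lparr>carrier = {w \<in> lists (X \<times> UNIV). reduced w},
      monoid.mult = (\<lambda>u v. foldr cancel_Cons u v),
      one = []\<rparr>"

definition free_gen :: "'a \<Rightarrow> 'a letter list" where
  "free_gen x = [(x, True)]"

text \<open>\<open>word_eval G g w\<close> is \<open>w(g)\<close>, the value of the word \<open>w\<close> at the family \<open>g\<close>. By
  \<open>word_eval_hom\<close>, \<open>word_eval_gen\<close> and \<open>word_eval_unique\<close> below, \<open>word_eval G g\<close> is the unique
  homomorphism from the free group to \<open>G\<close> that maps each generator \<open>x\<close> to \<open>g x\<close>.\<close>

definition letter_eval :: "('b, 'm) monoid_scheme \<Rightarrow> ('a \<Rightarrow> 'b) \<Rightarrow> 'a letter \<Rightarrow> 'b" where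
  "letter_eval G g a = (if snd a then g (fst a) else inv\<^bsub>G\<^esub> g (fst a))"

definition word_eval :: "('b, 'm) monoid_scheme \<Rightarrow> ('a \<Rightarrow> 'b) \<Rightarrow> 'a letter list \<Rightarrow> 'b" where
  "word_eval G g w = foldr (\<lambda>a z. letter_eval G g a \<otimes>\<^bsub>G\<^esub> z) w \<one>\<^bsub>G\<^esub>"

lemma inv_letter_inv_letter [simp]: "inv_letter (inv_letter a) = a"
  by (simp add: inv_letter_def)

lemma inv_letter_neq [simp]: "inv_letter a \<noteq> a" "a \<noteq> inv_letter a"
  by (auto simp: inv_letter_def prod_eq_iff)

lemma reduced_Nil [simp]: "reduced []"
  by (simp add: reduced_def)

lemma reduced_Cons:
  "reduced (a # w) \<longleftrightarrow> (w = [] \<or> hd w \<noteq> inv_letter a) \<and> reduced w"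
  by (auto simp: reduced_def successively_Cons)

lemma reduced_cancel_Cons: "reduced w \<Longrightarrow> reduced (cancel_Cons a w)"
  by (cases w) (auto simp: reduced_Cons)

lemma cancel_Cons_inverse:
  "reduced w \<Longrightarrow> cancel_Cons a (cancel_Cons (inv_letter a) w) = w"
  by (cases w; cases "tl w") (auto simp: reduced_Cons)

lemma reduced_foldr_cancel_Cons: "reduced v \<Longrightarrow> reduced (foldr cancel_Cons u v)"
  by (induction u) (auto intro: reduced_cancel_Cons)

lemma foldr_cancel_Cons_cancel:
  assumes "reduced w"
  shows "foldr cancel_Cons (cancel_Cons a v) w = cancel_Cons a (foldr cancel_Cons v w)"
proof (cases v)
  case (Cons b v')
  then show ?thesis
    using cancel_Cons_inverse[OF reduced_foldr_cancel_Cons[OF assms], of a v'] by auto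
qed auto

lemma foldr_cancel_Cons_assoc:
  assumes "reduced w"
  shows "foldr cancel_Cons (foldr cancel_Cons u v) w = foldr cancel_Cons u (foldr cancel_Cons v w)"
  by (induction u) (simp_all add: foldr_cancel_Cons_cancel assms)

lemma foldr_cancel_Cons_Nil: "reduced w \<Longrightarrow> foldr cancel_Cons w [] = w"
proof (induction w)
  case (Cons a w)
  then show ?case by (cases w) (auto simp: reduced_Cons)
qed auto

lemma cancel_Cons_closed:
  "a \<in> X \<times> UNIV \<Longrightarrow> w \<in> lists (X \<times> UNIV) \<Longrightarrow> cancel_Cons a w \<in> lists (X \<times> UNIV)"
  by (cases w) auto

lemma foldr_cancel_Cons_closed:
  "u \<in> lists (X \<times> UNIV) \<Longrightarrow> w \<in> lists (X \<times> UNIV) \<Longrightarrow>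
     foldr cancel_Cons u w \<in> lists (X \<times> UNIV)"
proof (induction u)
  case (Cons a u)
  then have "a \<in> X \<times> UNIV" "foldr cancel_Cons u w \<in> lists (X \<times> UNIV)"
    by auto
  then have "cancel_Cons a (foldr cancel_Cons u w) \<in> lists (X \<times> UNIV)"
    by (rule cancel_Cons_closed)
  then show ?case by simp
qed auto

definition inv_word :: "'a letter list \<Rightarrow> 'a letter list" where
  "inv_word w = rev (map inv_letter w)"

lemma foldr_inv_word:
  "reduced v \<Longrightarrow> foldr cancel_Cons (inv_word w) (foldr cancel_Cons w v) = v"
proof (induction w arbitrary: v)
  case (Cons a w)
  have "cancel_Cons (inv_letter a) (cancel_Cons a (foldr cancel_Cons w v)) = foldr cancel_Cons w v"
    using cancel_Cons_inverse[of "foldr cancel_Cons w v" "inv_letter a"]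
      reduced_foldr_cancel_Cons[OF Cons.prems] by simp
  then show ?case using Cons by (simp add: inv_word_def)
qed (simp add: inv_word_def)

lemma group_free_group: "group (free_group X)"
proof (rule groupI)
  fix x assume x: "x \<in> carrier (free_group X)"
  define y where "y = foldr cancel_Cons (inv_word x) []"
  have "inv_word x \<in> lists (X \<times> UNIV)"
    using x by (auto simp: free_group_def inv_word_def inv_letter_def in_lists_conv_set)
  then have "y \<in> carrier (free_group X)"
    using foldr_cancel_Cons_closed[of "inv_word x" X "[]"] reduced_foldr_cancel_Cons[of "[]"]
    by (simp add: y_def free_group_def)
  moreover have "y \<otimes>\<^bsub>free_group X\<^esub> x = \<one>\<^bsub>free_group X\<^esub>"
  proof -
    have r: "reduced x" using x by (simp add: free_group_def)
    have "foldr cancel_Cons y x = foldr cancel_Cons (inv_word x) (foldr cancel_Cons [] x)"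
      unfolding y_def by (rule foldr_cancel_Cons_assoc[OF r])
    also have "\<dots> = foldr cancel_Cons (inv_word x) (foldr cancel_Cons x [])"
      by (simp add: foldr_cancel_Cons_Nil[OF r])
    also have "\<dots> = []" by (rule foldr_inv_word) simp
    finally show ?thesis by (simp add: free_group_def)
  qed
  ultimately show "\<exists>y\<in>carrier (free_group X). y \<otimes>\<^bsub>free_group X\<^esub> x = \<one>\<^bsub>free_group X\<^esub>" by blast
qed (simp_all add: free_group_def foldr_cancel_Cons_assoc reduced_foldr_cancel_Cons
      foldr_cancel_Cons_closed del: in_lists_conv_set)

lemma free_gen_closed: "x \<in> X \<Longrightarrow> free_gen x \<in> carrier (free_group X)"
  by (simp add: free_gen_def free_group_def reduced_Cons)

lemma (in group) letter_eval_closed: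
  "g \<in> X \<rightarrow> carrier G \<Longrightarrow> a \<in> X \<times> UNIV \<Longrightarrow> letter_eval G g a \<in> carrier G"
  by (auto simp: letter_eval_def)

lemma (in group) word_eval_closed:
  "g \<in> X \<rightarrow> carrier G \<Longrightarrow> w \<in> lists (X \<times> UNIV) \<Longrightarrow> word_eval G g w \<in> carrier G"
proof (induction w)
  case (Cons a w)
  then show ?case using letter_eval_closed[of g X a] by (simp add: word_eval_def)
qed (simp add: word_eval_def)

lemma (in group) word_eval_cancel_Cons:
  assumes "g \<in> X \<rightarrow> carrier G" "a \<in> X \<times> UNIV" "w \<in> lists (X \<times> UNIV)"
  shows "word_eval G g (cancel_Cons a w) = letter_eval G g a \<otimes> word_eval G g w"
proof (cases w)
  case (Cons b v)
  have v: "word_eval G g v \<in> carrier G"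
    using word_eval_closed[OF assms(1), of v] assms(3) Cons by simp
  have ga: "g (fst a) \<in> carrier G" using assms(1,2) by auto
  show ?thesis
  proof (cases "b = inv_letter a")
    case True
    have "letter_eval G g a \<otimes> (letter_eval G g b \<otimes> word_eval G g v) = word_eval G g v"
      using ga v by (cases "snd a") (simp_all add: True letter_eval_def inv_letter_def flip: m_assoc)
    then show ?thesis using True Cons by (simp add: word_eval_def)
  next
    case False
    then show ?thesis using Cons by (simp add: word_eval_def)
  qed
qed (simp add: word_eval_def)

lemma (in group) word_eval_hom:
  assumes g: "g \<in> X \<rightarrow> carrier G"
  shows "word_eval G g \<in> hom (free_group X) G"
proof (rule homI)
  fix u v assume u: "u \<in> carrier (free_group X)" and v: "v \<in> carrier (free_group X)"
  have v': "v \<in> lists (X \<times> UNIV)" using v by (simp add: free_group_def)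
  have "u \<in> lists (X \<times> UNIV)" using u by (simp add: free_group_def)
  then have "word_eval G g (foldr cancel_Cons u v) = word_eval G g u \<otimes> word_eval G g v"
  proof (induction u)
    case Nil
    then show ?case using word_eval_closed[OF g v'] by (simp add: word_eval_def)
  next
    case (Cons a u)
    then have a: "a \<in> X \<times> UNIV" and u: "u \<in> lists (X \<times> UNIV)" by simp_all
    have "word_eval G g (foldr cancel_Cons (a # u) v)
        = letter_eval G g a \<otimes> (word_eval G g u \<otimes> word_eval G g v)"
      using word_eval_cancel_Cons[OF g a foldr_cancel_Cons_closed[OF u v']] Cons.IH u by simp
    also have "\<dots> = (letter_eval G g a \<otimes> word_eval G g u) \<otimes> word_eval G g v"
      using letter_eval_closed[OF g a] word_eval_closed[OF g u] word_eval_closed[OF g v']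
      by (simp add: m_assoc)
    finally show ?case by (simp add: word_eval_def)
  qed
  then show "word_eval G g (u \<otimes>\<^bsub>free_group X\<^esub> v) = word_eval G g u \<otimes> word_eval G g v"
    by (simp add: free_group_def)
qed (use word_eval_closed[OF g] in \<open>simp add: free_group_def\<close>)

lemma (in group) word_eval_gen:
  "g x \<in> carrier G \<Longrightarrow> word_eval G g (free_gen x) = g x"
  by (simp add: word_eval_def free_gen_def letter_eval_def)

lemma (in group) word_eval_unique:
  assumes h: "h \<in> hom (free_group X) G" and gen: "\<And>x. x \<in> X \<Longrightarrow> h (free_gen x) = g x"
    and w: "w \<in> carrier (free_group X)"
  shows "h w = word_eval G g w"
proof -
  interpret F: group "free_group X" by (rule group_free_group)
  interpret H: group_hom "free_group X" G h
    by unfold_locales (rule h)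
  have letter: "h [a] = letter_eval G g a" if a: "a \<in> X \<times> UNIV" for a
  proof (cases "snd a")
    case True
    then show ?thesis using gen[of "fst a"] a
      by (cases a) (auto simp: letter_eval_def free_gen_def)
  next
    case False
    have "[a] \<otimes>\<^bsub>free_group X\<^esub> free_gen (fst a) = \<one>\<^bsub>free_group X\<^esub>"
      using False by (cases a) (simp add: free_group_def free_gen_def inv_letter_def)
    moreover have c: "[a] \<in> carrier (free_group X)" "free_gen (fst a) \<in> carrier (free_group X)"
      using a by (auto simp: free_group_def reduced_Cons free_gen_def)
    ultimately have "[a] = inv\<^bsub>free_group X\<^esub> free_gen (fst a)"
      using F.inv_equality by metis
    then have "h [a] = inv (h (free_gen (fst a)))"
      using c by (metis H.hom_inv)
    then show ?thesis using gen[of "fst a"] a False by (auto simp: letter_eval_def)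
  qed
  have "w \<in> lists (X \<times> UNIV)" "reduced w" using w by (auto simp: free_group_def)
  then show ?thesis
  proof (induction w)
    case Nil
    then show ?case using H.hom_one by (simp add: word_eval_def free_group_def)
  next
    case (Cons a w)
    then have a: "a \<in> X \<times> UNIV" and w: "w \<in> lists (X \<times> UNIV)" "reduced w"
      by (auto simp: reduced_Cons)
    have c: "[a] \<in> carrier (free_group X)" "w \<in> carrier (free_group X)"
      using a w by (auto simp: free_group_def reduced_Cons)
    have "a # w = [a] \<otimes>\<^bsub>free_group X\<^esub> w"
      using Cons.prems by (cases w) (auto simp: free_group_def reduced_Cons)
    then have "h (a # w) = h [a] \<otimes> h w"
      using c H.hom_mult by metis
    then show ?case using Cons.IH w letter[OF a] by (simp add: word_eval_def)
  qed
qed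


section \<open>Presentations\<close>

definition normal_closure :: "('a, 'm) monoid_scheme \<Rightarrow> 'a set \<Rightarrow> 'a set" where
  "normal_closure G R = \<Inter> {N. N \<lhd> G \<and> R \<subseteq> N}"

definition presented_group :: "'a set \<Rightarrow> 'a letter list set \<Rightarrow> 'a letter list set monoid" where
  "presented_group X R = free_group X Mod normal_closure (free_group X) R"

definition presented_gen :: "'a set \<Rightarrow> 'a letter list set \<Rightarrow> 'a \<Rightarrow> 'a letter list set" where
  "presented_gen X R x = normal_closure (free_group X) R #>\<^bsub>free_group X\<^esub> free_gen x"

lemma (in group) normal_closure_normal:
  assumes "R \<subseteq> carrier G"
  shows "normal_closure G R \<lhd> G"
proof (rule normal_invI)
  have G: "carrier G \<lhd> G"
    by (rule normal_invI) (auto intro: subgroup_self)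
  show "subgroup (normal_closure G R) G"
    unfolding normal_closure_def
    by (rule subgroups_Inter) (use G assms in \<open>auto intro: normal_imp_subgroup\<close>)
  show "x \<otimes> h \<otimes> inv x \<in> normal_closure G R"
    if "x \<in> carrier G" "h \<in> normal_closure G R" for x h
    using that by (auto simp: normal_closure_def normal_inv_iff)
qed

lemma group_presented_group:
  "R \<subseteq> carrier (free_group X) \<Longrightarrow> group (presented_group X R)"
  unfolding presented_group_def
  by (intro normal.factorgroup_is_group group.normal_closure_normal group_free_group)

text \<open>The word \<open>x\<^sub>1\<^sup>2\<cdots>x\<^sub>n\<^sup>2\<close>, where the generator \<open>x\<^sub>k\<close> is represented by the number \<open>k\<close>.\<close>

definition nonorientable_relator :: "nat \<Rightarrow> nat letter list" where
  "nonorientable_relator n = concat (map (\<lambda>k. [(k, True), (k, True)]) [1..<Suc n])"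

definition nonorientable_surface_group :: "nat \<Rightarrow> nat letter list set monoid" where
  "nonorientable_surface_group n = presented_group {1..n} {nonorientable_relator n}"

definition surface_gen :: "nat \<Rightarrow> nat \<Rightarrow> nat letter list set" where
  "surface_gen n k = presented_gen {1..n} {nonorientable_relator n} k"

lemma nonorientable_relator_closed:
  "nonorientable_relator n \<in> carrier (free_group {1..n})"
proof -
  have "successively (\<lambda>a b. b \<noteq> inv_letter a) w" if "\<forall>a\<in>set w. snd a" for w :: "nat letter list"
    using that
  proof (induction w)
    case (Cons a w)
    then show ?case
      by (cases w) (auto simp: inv_letter_def)
  qed auto
  then have "reduced (nonorientable_relator n)"
    by (auto simp: reduced_def nonorientable_relator_def)
  then show ?thesis
    by (auto simp: free_group_def nonorientable_relator_def)
qed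

lemma group_nonorientable_surface_group: "group (nonorientable_surface_group n)"
  unfolding nonorientable_surface_group_def
  using nonorientable_relator_closed by (intro group_presented_group) blast


section \<open>Pro-p completion\<close>

definition p_power_index_normal :: "nat \<Rightarrow> ('a, 'm) monoid_scheme \<Rightarrow> 'a set set" where
  "p_power_index_normal p G = {N. N \<lhd> G \<and> (\<exists>k. card (rcosets\<^bsub>G\<^esub> N) = p ^ k)}"

text \<open>The inverse limit of the quotients \<open>G Mod N\<close> by the normal subgroups of \<open>p\<close>-power index,
  as a subgroup of their product: if \<open>N \<subseteq> M\<close>, then the projection from \<open>G Mod N\<close> to \<open>G Mod M\<close>,
  which maps the coset of \<open>x\<close> to the coset of \<open>x\<close>, has to map \<open>f N\<close> to \<open>f M\<close>.\<close>

definition pro_p_completion :: "nat \<Rightarrow> ('a, 'm) monoid_scheme \<Rightarrow> ('a set \<Rightarrow> 'a set) monoid" where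
  "pro_p_completion p G =
     product_group (p_power_index_normal p G) (\<lambda>N. G Mod N)
       \<lparr>carrier := {f \<in> (\<Pi>\<^sub>E N\<in>p_power_index_normal p G. carrier (G Mod N)).
          \<forall>N\<in>p_power_index_normal p G. \<forall>M\<in>p_power_index_normal p G. N \<subseteq> M \<longrightarrow>
            (\<forall>x\<in>carrier G. f N = N #>\<^bsub>G\<^esub> x \<longrightarrow> f M = M #>\<^bsub>G\<^esub> x)}\<rparr>"

definition pro_p_topology :: "nat \<Rightarrow> ('a, 'm) monoid_scheme \<Rightarrow> ('a set \<Rightarrow> 'a set) topology" where
  "pro_p_topology p G =
     subtopology
       (product_topology (\<lambda>N. discrete_topology (carrier (G Mod N))) (p_power_index_normal p G))
       (carrier (pro_p_completion p G))"

definition pro_p_map :: "nat \<Rightarrow> ('a, 'm) monoid_scheme \<Rightarrow> 'a \<Rightarrow> 'a set \<Rightarrow> 'a set" where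
  "pro_p_map p G x = (\<lambda>N\<in>p_power_index_normal p G. N #>\<^bsub>G\<^esub> x)"

lemma topspace_pro_p_topology: "topspace (pro_p_topology p G) = carrier (pro_p_completion p G)"
  by (auto simp: pro_p_topology_def pro_p_completion_def)

lemma (in group) pro_p_map_hom: "pro_p_map p G \<in> hom G (pro_p_completion p G)"
proof (rule homI)
  fix x assume x: "x \<in> carrier G"
  have "M #> x = M #> y"
    if N: "N \<lhd> G" and M: "M \<lhd> G" and "N \<subseteq> M" "y \<in> carrier G" "N #> x = N #> y" for N M y
  proof -
    have sM: "subgroup M G" and sN: "subgroup N G"
      using M N by (auto intro: normal_imp_subgroup)
    have "x \<in> N #> y" using rcos_self[OF x sN] that by simp
    then have "x \<in> M #> y" using \<open>N \<subseteq> M\<close> by (auto simp: r_coset_def)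
    then show ?thesis using repr_independence[OF _ \<open>y \<in> carrier G\<close> sM] by simp
  qed
  then show "pro_p_map p G x \<in> carrier (pro_p_completion p G)"
    using x by (auto simp: pro_p_map_def pro_p_completion_def p_power_index_normal_def
        FactGroup_def RCOSETS_def)
next
  fix x y assume "x \<in> carrier G" "y \<in> carrier G"
  then show "pro_p_map p G (x \<otimes> y) = pro_p_map p G x \<otimes>\<^bsub>pro_p_completion p G\<^esub> pro_p_map p G y"
    by (auto simp: pro_p_map_def pro_p_completion_def FactGroup_def p_power_index_normal_def
        normal.rcos_sum fun_eq_iff restrict_def)
qed


section \<open>Test elements\<close>

definition test_element :: "('a, 'm) monoid_scheme \<Rightarrow> 'a \<Rightarrow> bool" where
  "test_element G g \<longleftrightarrow>
     g \<in> carrier G \<and> (\<forall>\<phi>\<in>hom G G. \<phi> g = g \<longrightarrow> \<phi> \<in> iso G G)"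

text \<open>For a topological group \<open>G\<close> with topology \<open>T\<close>, automorphisms are those of topological groups;
  for profinite groups every bijective continuous endomorphism is one, by compactness.\<close>

definition topological_test_element ::
    "('a, 'm) monoid_scheme \<Rightarrow> 'a topology \<Rightarrow> 'a \<Rightarrow> bool" where
  "topological_test_element G T g \<longleftrightarrow>
     g \<in> carrier G \<and>
     (\<forall>\<phi>\<in>hom G G. continuous_map T T \<phi> \<and> \<phi> g = g \<longrightarrow> \<phi> \<in> iso G G \<and> homeomorphic_map T T \<phi>)"

end

theory Submission
  imports Defs "HOL-Algebra.Multiplicative_Group"
begin

text \<open>Let \<open>t\<close> be fixed by an endomorphism \<open>\<phi>\<close> of the surface group \<open>G\<close>. In a finite group of odd order
  square roots exist and are unique, so for odd \<open>p\<close> the relator determines any generator by the others,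
  and the pro-\<open>p\<close> completion of \<open>G\<close> is free pro-\<open>p\<close> on any \<open>n - 1\<close> of the generators. Hence \<open>\<phi>\<close>
  extends to an endomorphism of the pro-\<open>p\<close> completion of \<open>D\<close> that fixes \<open>w\<close>, which is an
  automorphism. As \<open>G\<close> is residually \<open>p\<close>, it embeds in its completion, so \<open>\<phi>\<close> is injective.

  The group \<open>G\<close> is residually \<open>p\<close> because it is the extension of a free group by an infinite cyclic
  group that acts on periodic quotients of the free group with \<open>p\<close>-power order; free groups are
  residually \<open>p\<close> by repeated wreath products with the cyclic group of order \<open>p\<close>.

  An injective \<open>\<phi>\<close> is surjective: a subgroup of infinite index in \<open>G\<close> has trivial second homology
  modulo 2 and thus is not isomorphic to \<open>G\<close>, and a subgroup of finite index \<open>m > 1\<close> is excluded by the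
  multiplicativity of the Euler characteristic \<open>2 - n < 0\<close>.\<close>

section \<open>Homomorphisms from presented groups\<close>

text \<open>The pro-\<open>p\<close> argument gives injectivity only: an automorphism of the
  completion makes the image of \<open>\<phi>\<close> map onto every finite
  \<open>p\<close>-quotient, which does not by itself make it all of \<open>G\<close>. Surjectivity
  therefore needs an argument about subgroups of \<open>G\<close> in which \<open>p\<close> does not
  occur. Its coefficients are modulo 2, because the second homology of a non-orientable surface
  vanishes over the integers.

  For residual \<open>p\<close>-finiteness, freeness of the kernel is never established. One
  rewriting formula is evaluated in three groups: its version in a free group maps to the version in
  \<open>G\<close>, so a word with trivial rewriting and trivial shift is trivial in
  \<open>G\<close>; its version in a finite \<open>p\<close>-group, made periodic in the level,
  respects the relator and yields a finite quotient of \<open>G\<close>.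

  Homology is handled by integer labellings of the edges of a coset graph, summed along the paths of
  words: relators are 2-cells, and an identity valid for all labellings is an identity of
  chains.\<close>

lemma carrier_free_group_lists: "w \<in> carrier (free_group X) \<Longrightarrow> w \<in> lists (X \<times> UNIV)"
  by (simp add: free_group_def)

lemma (in group) free_group_hom_eqI:
  assumes "h \<in> hom (free_group X) G" "h' \<in> hom (free_group X) G"
    and "\<And>x. x \<in> X \<Longrightarrow> h (free_gen x) = h' (free_gen x)"
    and "w \<in> carrier (free_group X)"
  shows "h w = h' w"
  using word_eval_unique[OF assms(1), of "\<lambda>x. h' (free_gen x)" w]
    word_eval_unique[OF assms(2), of "\<lambda>x. h' (free_gen x)" w] assms by simp

lemma (in group) r_coset_eq_self_iff:
  "subgroup H G \<Longrightarrow> x \<in> carrier G \<Longrightarrow> H #> x = H \<longleftrightarrow> x \<in> H"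
  using coset_join1[of H x] coset_join2[of x H] subgroup.subset by metis

lemma (in group) word_eval_Nil [simp]: "word_eval G g [] = \<one>"
  by (simp add: word_eval_def)

lemma (in group) word_eval_Cons [simp]:
  "word_eval G g (a # w) = letter_eval G g a \<otimes> word_eval G g w"
  by (simp add: word_eval_def)

lemma (in group) word_eval_append:
  assumes "g \<in> X \<rightarrow> carrier G" "u \<in> lists (X \<times> UNIV)" "v \<in> lists (X \<times> UNIV)"
  shows "word_eval G g (u @ v) = word_eval G g u \<otimes> word_eval G g v"
  using assms(2)
proof (induction u)
  case (Cons a u)
  then show ?case
    using letter_eval_closed[OF assms(1), of a] word_eval_closed[OF assms(1)] assms(3)
    by (simp add: m_assoc)
qed (use word_eval_closed[OF assms(1,3)] in simp)

lemma (in group) word_eval_cong: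
  assumes "\<And>x. x \<in> X \<Longrightarrow> g x = g' x" "w \<in> lists (X \<times> UNIV)"
  shows "word_eval G g w = word_eval G g' w"
  using assms(2) by (induction w) (auto simp: letter_eval_def assms(1))

lemma (in group_hom) hom_word_eval:
  assumes g: "g \<in> X \<rightarrow> carrier G" and "w \<in> lists (X \<times> UNIV)"
  shows "h (word_eval G g w) = word_eval H (\<lambda>x. h (g x)) w"
  using assms(2)
proof (induction w)
  case (Cons a w)
  then have "word_eval G g w \<in> carrier G" "letter_eval G g a \<in> carrier G" "g (fst a) \<in> carrier G"
    using G.word_eval_closed[OF g] G.letter_eval_closed[OF g] g by (auto simp: Pi_iff)
  then show ?case using Cons by (simp add: letter_eval_def)
qed simp

lemma word_eval_Mod:
  assumes "N \<lhd> free_group X" "w \<in> carrier (free_group X)"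
  shows "word_eval (free_group X Mod N) (\<lambda>x. N #>\<^bsub>free_group X\<^esub> free_gen x) w
    = N #>\<^bsub>free_group X\<^esub> w"
  using group.word_eval_unique[OF normal.factorgroup_is_group[OF assms(1)]
      normal.r_coset_hom_Mod[OF assms(1)] refl assms(2)] by simp

locale presentation =
  fixes X :: "'a set" and R :: "'a letter list set"
  assumes relators_closed: "R \<subseteq> carrier (free_group X)"
begin

abbreviation F where "F \<equiv> free_group X"
abbreviation NC where "NC \<equiv> normal_closure F R"
abbreviation P where "P \<equiv> presented_group X R"
abbreviation gen where "gen \<equiv> presented_gen X R"

sublocale F: group F by (rule group_free_group)
sublocale N: normal NC F by (rule F.normal_closure_normal[OF relators_closed])
sublocale P: group P by (rule group_presented_group[OF relators_closed])

lemma gen_closed: "gen \<in> X \<rightarrow> carrier P"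
  by (auto simp: presented_gen_def presented_group_def carrier_FactGroup free_gen_closed)

lemma word_eval_presented:
  assumes "w \<in> carrier F"
  shows "word_eval P gen w = NC #>\<^bsub>F\<^esub> w"
  using word_eval_Mod[OF N.normal_axioms assms]
  by (simp add: presented_group_def presented_gen_def[abs_def])

lemma presented_word_cases:
  assumes "g \<in> carrier P"
  obtains w where "w \<in> carrier F" "g = word_eval P gen w"
  using assms word_eval_presented by (auto simp: presented_group_def carrier_FactGroup)

lemma word_eval_presented_eq_one_iff:
  assumes "w \<in> carrier F"
  shows "word_eval P gen w = \<one>\<^bsub>P\<^esub> \<longleftrightarrow> w \<in> NC"
proof -
  have "\<one>\<^bsub>P\<^esub> = NC" by (simp add: presented_group_def)
  then show ?thesis
    using word_eval_presented[OF assms] F.r_coset_eq_self_iff[OF N.subgroup_axioms assms] by simp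
qed

lemma presented_hom_eqI:
  assumes "group H" "h \<in> hom P H" "h' \<in> hom P H"
    and "\<And>x. x \<in> X \<Longrightarrow> h (gen x) = h' (gen x)" and "g \<in> carrier P"
  shows "h g = h' g"
proof -
  interpret h: group_hom P H h using assms by (simp add: group_hom_def group_hom_axioms_def P.is_group)
  interpret h': group_hom P H h' using assms by (simp add: group_hom_def group_hom_axioms_def P.is_group)
  obtain w where w: "w \<in> carrier F" "g = word_eval P gen w"
    using presented_word_cases[OF assms(5)] .
  show ?thesis
    using h.hom_word_eval[OF gen_closed, of w] h'.hom_word_eval[OF gen_closed, of w]
      h.H.word_eval_cong[of X "\<lambda>x. h (gen x)" "\<lambda>x. h' (gen x)" w] assms(4) w
    by (simp add: carrier_free_group_lists)
qed

text \<open>Von Dyck's theorem: the kernel of \<open>word_eval H g\<close> is normal and contains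
  \<open>R\<close>, hence it contains the normal closure.\<close>

lemma presented_hom_exists:
  assumes H: "group H" and g: "g \<in> X \<rightarrow> carrier H"
    and rel: "\<And>r. r \<in> R \<Longrightarrow> word_eval H g r = \<one>\<^bsub>H\<^esub>"
  obtains h where "h \<in> hom P H" "\<And>x. x \<in> X \<Longrightarrow> h (gen x) = g x"
    "\<And>w. w \<in> carrier F \<Longrightarrow> h (word_eval P gen w) = word_eval H g w"
proof -
  interpret H: group H by (rule H)
  interpret e: group_hom F H "word_eval H g"
    by unfold_locales (rule H.word_eval_hom[OF g])
  have "R \<subseteq> kernel F H (word_eval H g)"
    using rel relators_closed by (auto simp: kernel_def)
  then have N: "NC \<subseteq> kernel F H (word_eval H g)"
    using e.normal_kernel by (auto simp: normal_closure_def)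
  have eq: "word_eval H g u = word_eval H g v"
    if "u \<in> carrier F" "v \<in> carrier F" "NC #>\<^bsub>F\<^esub> u = NC #>\<^bsub>F\<^esub> v" for u v
  proof -
    have "u \<in> NC #>\<^bsub>F\<^esub> v"
      using F.rcos_self[OF that(1) N.subgroup_axioms] that(3) by simp
    then obtain k where k: "k \<in> NC" "u = k \<otimes>\<^bsub>F\<^esub> v" by (auto simp: r_coset_def)
    then show ?thesis using N that(2) by (auto simp: kernel_def)
  qed
  obtain h where h: "h \<in> hom (F Mod NC) H"
    and hw: "\<And>w. w \<in> carrier F \<Longrightarrow> h (NC #>\<^bsub>F\<^esub> w) = word_eval H g w"
    using FactGroup_universal[OF e.homh N.normal_axioms eq] by metis
  show thesis
  proof
    show "h \<in> hom P H" using h by (simp add: presented_group_def)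
    show "h (gen x) = g x" if "x \<in> X" for x
      using hw[OF free_gen_closed[OF that]] H.word_eval_gen[of g x] g that
      by (auto simp: presented_gen_def)
    show "h (word_eval P gen w) = word_eval H g w" if "w \<in> carrier F" for w
      using hw[OF that] word_eval_presented[OF that] by simp
  qed
qed

end


section \<open>Finite p-groups\<close>

lemma (in group_hom) card_rcosets_kernel:
  "card (rcosets (kernel G H h)) = card (h ` carrier G)"
proof -
  let ?f = "\<lambda>X. the_elem (h ` X)"
  have "?f (kernel G H h #> x) = h x" if "x \<in> carrier G" for x
  proof -
    have "h y = h x" if "y \<in> kernel G H h #> x" for y
      using that \<open>x \<in> carrier G\<close> by (auto simp: kernel_def r_coset_def)
    moreover have "x \<in> kernel G H h #> x"
      using G.rcos_self[OF that subgroup_kernel] .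
    ultimately have "h ` (kernel G H h #> x) = {h x}" by blast
    then show ?thesis by simp
  qed
  then have "?f ` carrier (G Mod kernel G H h) = h ` carrier G"
    unfolding carrier_FactGroup image_image by (rule image_cong[OF refl])
  then have "card (carrier (G Mod kernel G H h)) = card (h ` carrier G)"
    using card_image[OF FactGroup_inj_on] by simp
  then show ?thesis by (simp add: FactGroup_def)
qed

text \<open>The source of all finite \<open>p\<close>-quotients below. The image of \<open>h\<close>
  may be a proper subgroup of \<open>H\<close>, but by Lagrange its order is again a power of
  \<open>p\<close>.\<close>

lemma (in group_hom) kernel_p_power_index:
  assumes "prime p" "order H = p ^ k"
  shows "kernel G H h \<in> p_power_index_normal p G"
proof -
  have "subgroup (h ` carrier G) H" by (rule img_is_subgroup)
  then have "card (h ` carrier G) dvd p ^ k"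
    using H.lagrange assms(2) by (metis dvd_triv_right)
  then obtain j where "card (h ` carrier G) = p ^ j"
    using divides_primepow_nat[OF assms(1)] by blast
  then show ?thesis
    using normal_kernel card_rcosets_kernel by (auto simp: p_power_index_normal_def)
qed

lemma p_power_index_normalD:
  assumes "N \<in> p_power_index_normal p G"
  shows "N \<lhd> G" "group (G Mod N)" "\<exists>k. order (G Mod N) = p ^ k"
  using assms normal.factorgroup_is_group
  by (auto simp: p_power_index_normal_def order_def FactGroup_def)

lemma (in group) p_power_index_normal_carrier: "carrier G \<in> p_power_index_normal p G"
proof -
  have "carrier G \<lhd> G" by (rule normal_invI) (auto intro: subgroup_self)
  moreover have "rcosets (carrier G) = {carrier G}"
    using coset_join2[OF _ subgroup_self] one_closed by (auto simp: RCOSETS_def)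
  ultimately show ?thesis
    by (auto simp: p_power_index_normal_def intro: exI[of _ 0])
qed

lemma (in group) p_power_index_normal_Int:
  assumes p: "prime p" and N: "N \<in> p_power_index_normal p G" and M: "M \<in> p_power_index_normal p G"
  shows "N \<inter> M \<in> p_power_index_normal p G"
proof -
  let ?H = "(G Mod N) \<times>\<times> (G Mod M)" and ?h = "\<lambda>x. (N #> x, M #> x)"
  note D = p_power_index_normalD[OF N] p_power_index_normalD[OF M]
  have "?h \<in> hom G ?H"
    using normal.r_coset_hom_Mod[OF D(1)] normal.r_coset_hom_Mod[OF D(4)]
    by (auto simp: hom_def)
  then interpret h: group_hom G ?H ?h
    using D DirProd_group is_group by (simp add: group_hom_def group_hom_axioms_def)
  obtain k l where "order (G Mod N) = p ^ k" "order (G Mod M) = p ^ l"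
    using D by blast
  then have "order ?H = p ^ (k + l)"
    by (simp add: order_def power_add card_cartesian_product)
  then have "kernel G ?H ?h \<in> p_power_index_normal p G"
    by (rule h.kernel_p_power_index[OF p])
  moreover have "kernel G ?H ?h = N \<inter> M"
  proof -
    have s: "subgroup N G" "subgroup M G" using D normal_imp_subgroup by blast+
    have "kernel G ?H ?h = {x \<in> carrier G. x \<in> N \<and> x \<in> M}"
      unfolding kernel_def
      by (rule Collect_cong) (use s in \<open>simp add: r_coset_eq_self_iff cong: conj_cong\<close>)
    then show ?thesis using subgroup.subset[OF s(1)] by blast
  qed
  ultimately show ?thesis by simp
qed

lemma (in group) p_power_index_normal_Inter:
  assumes "prime p" "finite I" "\<And>i. i \<in> I \<Longrightarrow> M i \<in> p_power_index_normal p G"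
  shows "\<exists>N\<in>p_power_index_normal p G. \<forall>i\<in>I. N \<subseteq> M i"
  using assms(2,3)
proof (induction I)
  case empty
  then show ?case using p_power_index_normal_carrier by blast
next
  case (insert i I)
  then obtain N where N: "N \<in> p_power_index_normal p G" "\<forall>i\<in>I. N \<subseteq> M i" by auto
  show ?case
  proof (rule bexI)
    show "\<forall>j\<in>insert i I. M i \<inter> N \<subseteq> M j" using N(2) by auto
    show "M i \<inter> N \<in> p_power_index_normal p G"
      by (rule p_power_index_normal_Int[OF assms(1)]) (use insert.prems N in auto)
  qed
qed


section \<open>Wreath products\<close>

text \<open>An element \<open>u\<close> met at the vertex \<open>x\<close> contributes
  \<open>fst u x\<close> and moves on to \<open>x\<close> times \<open>snd u\<close>. So the first
  component of a word collects the labels along its path in the Cayley graph of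
  \<open>P\<close>.\<close>

definition wreath :: "('a, 'm) monoid_scheme \<Rightarrow> ('b, 'n) monoid_scheme \<Rightarrow> (('b \<Rightarrow> 'a) \<times> 'b) monoid" where
  "wreath A P =
     \<lparr>carrier = (carrier P \<rightarrow>\<^sub>E carrier A) \<times> carrier P,
      monoid.mult = (\<lambda>u v. (\<lambda>x\<in>carrier P. fst u x \<otimes>\<^bsub>A\<^esub> fst v (x \<otimes>\<^bsub>P\<^esub> snd u), snd u \<otimes>\<^bsub>P\<^esub> snd v)),
      one = (\<lambda>x\<in>carrier P. \<one>\<^bsub>A\<^esub>, \<one>\<^bsub>P\<^esub>)\<rparr>"

locale wreath_product = A: group A + P: group P
  for A :: "('a, 'm) monoid_scheme" and P :: "('b, 'n) monoid_scheme"
begin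

abbreviation W where "W \<equiv> wreath A P"

lemma carrier_wreath: "carrier W = (carrier P \<rightarrow>\<^sub>E carrier A) \<times> carrier P"
  by (simp add: wreath_def)

lemma fst_closed: "u \<in> carrier W \<Longrightarrow> x \<in> carrier P \<Longrightarrow> fst u x \<in> carrier A"
  by (auto simp: carrier_wreath)

lemma snd_closed: "u \<in> carrier W \<Longrightarrow> snd u \<in> carrier P"
  by (auto simp: carrier_wreath)

lemma fst_mult_wreath:
  "x \<in> carrier P \<Longrightarrow> fst (u \<otimes>\<^bsub>W\<^esub> v) x = fst u x \<otimes>\<^bsub>A\<^esub> fst v (x \<otimes>\<^bsub>P\<^esub> snd u)"
  by (simp add: wreath_def)

lemma snd_mult_wreath: "snd (u \<otimes>\<^bsub>W\<^esub> v) = snd u \<otimes>\<^bsub>P\<^esub> snd v"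
  by (simp add: wreath_def)

lemma fst_one_wreath: "x \<in> carrier P \<Longrightarrow> fst \<one>\<^bsub>W\<^esub> x = \<one>\<^bsub>A\<^esub>"
  by (simp add: wreath_def)

lemma snd_one_wreath: "snd \<one>\<^bsub>W\<^esub> = \<one>\<^bsub>P\<^esub>"
  by (simp add: wreath_def)

lemma wreath_eqI:
  assumes "u \<in> carrier W" "v \<in> carrier W" "\<And>x. x \<in> carrier P \<Longrightarrow> fst u x = fst v x" "snd u = snd v"
  shows "u = v"
proof (rule prod_eqI)
  show "fst u = fst v"
    by (rule PiE_ext[of _ "carrier P" "\<lambda>_. carrier A"])
      (use assms in \<open>auto simp: carrier_wreath\<close>)
qed (rule assms(4))

lemma mult_wreath_closed: "u \<in> carrier W \<Longrightarrow> v \<in> carrier W \<Longrightarrow> u \<otimes>\<^bsub>W\<^esub> v \<in> carrier W"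
  by (auto simp: wreath_def PiE_iff)

sublocale W: group W
proof (rule groupI)
  show "\<one>\<^bsub>W\<^esub> \<in> carrier W" by (auto simp: wreath_def)
  show "u \<otimes>\<^bsub>W\<^esub> v \<otimes>\<^bsub>W\<^esub> z = u \<otimes>\<^bsub>W\<^esub> (v \<otimes>\<^bsub>W\<^esub> z)"
    if "u \<in> carrier W" "v \<in> carrier W" "z \<in> carrier W" for u v z
    by (rule wreath_eqI)
      (use that in \<open>simp_all add: mult_wreath_closed fst_mult_wreath snd_mult_wreath
        fst_closed snd_closed A.m_assoc P.m_assoc\<close>)
  show "\<one>\<^bsub>W\<^esub> \<otimes>\<^bsub>W\<^esub> u = u" if "u \<in> carrier W" for u
    by (rule wreath_eqI)
      (use that \<open>\<one>\<^bsub>W\<^esub> \<in> carrier W\<close> in \<open>simp_all add: mult_wreath_closed fst_mult_wreath snd_mult_wreath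
        fst_one_wreath snd_one_wreath fst_closed snd_closed\<close>)
  show "\<exists>v\<in>carrier W. v \<otimes>\<^bsub>W\<^esub> u = \<one>\<^bsub>W\<^esub>" if u: "u \<in> carrier W" for u
  proof
    let ?v = "(\<lambda>x\<in>carrier P. inv\<^bsub>A\<^esub> fst u (x \<otimes>\<^bsub>P\<^esub> inv\<^bsub>P\<^esub> snd u), inv\<^bsub>P\<^esub> snd u)"
    show v: "?v \<in> carrier W"
      using u fst_closed[OF u] snd_closed[OF u] by (simp add: carrier_wreath)
    show "?v \<otimes>\<^bsub>W\<^esub> u = \<one>\<^bsub>W\<^esub>"
      by (rule wreath_eqI)
        (use u v \<open>\<one>\<^bsub>W\<^esub> \<in> carrier W\<close> in \<open>simp_all add: mult_wreath_closed fst_mult_wreath snd_mult_wreath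
          fst_one_wreath snd_one_wreath fst_closed snd_closed\<close>)
  qed
qed (rule mult_wreath_closed)

lemma snd_inv_wreath:
  assumes "u \<in> carrier W"
  shows "snd (inv\<^bsub>W\<^esub> u) = inv\<^bsub>P\<^esub> snd u"
proof -
  have "snd (inv\<^bsub>W\<^esub> u) \<otimes>\<^bsub>P\<^esub> snd u = \<one>\<^bsub>P\<^esub>"
    using W.l_inv[OF assms] snd_mult_wreath snd_one_wreath by metis
  then show ?thesis
    using P.inv_equality snd_closed[OF assms] snd_closed[OF W.inv_closed[OF assms]] by metis
qed

lemma fst_inv_wreath:
  assumes "u \<in> carrier W" "x \<in> carrier P"
  shows "fst (inv\<^bsub>W\<^esub> u) x = inv\<^bsub>A\<^esub> fst u (x \<otimes>\<^bsub>P\<^esub> inv\<^bsub>P\<^esub> snd u)"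
proof -
  have "fst (inv\<^bsub>W\<^esub> u) x \<otimes>\<^bsub>A\<^esub> fst u (x \<otimes>\<^bsub>P\<^esub> inv\<^bsub>P\<^esub> snd u) = \<one>\<^bsub>A\<^esub>"
    using W.l_inv[OF assms(1)] fst_mult_wreath[OF assms(2), of "inv\<^bsub>W\<^esub> u" u]
      fst_one_wreath[OF assms(2)] snd_inv_wreath[OF assms(1)] by simp
  then show ?thesis
    using A.inv_equality fst_closed assms W.inv_closed snd_closed P.m_closed P.inv_closed by metis
qed

lemma order_wreath: "finite (carrier P) \<Longrightarrow> order W = order A ^ order P * order P"
  by (simp add: order_def carrier_wreath card_cartesian_product card_PiE)

lemma order_wreath_p_power:
  assumes "prime p" "order A = p ^ k" "order P = p ^ l"
  shows "\<exists>m. order W = p ^ m"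
proof -
  have "order P \<noteq> 0" using assms by simp
  then have "finite (carrier P)" using P.order_gt_0_iff_finite by blast
  then have "order W = p ^ (k * p ^ l + l)"
    by (simp add: order_wreath assms(2,3) power_mult power_add)
  then show ?thesis by blast
qed

lemma snd_hom: "snd \<in> hom W P"
  by (simp add: hom_def snd_closed snd_mult_wreath)

lemma snd_word_eval_wreath:
  assumes "a \<in> X \<rightarrow> carrier W" "w \<in> lists (X \<times> UNIV)"
  shows "snd (word_eval W a w) = word_eval P (\<lambda>c. snd (a c)) w"
proof -
  interpret group_hom W P snd
    by unfold_locales (rule snd_hom)
  show ?thesis by (rule hom_word_eval[OF assms])
qed

lemma fst_word_eval_wreath_Cons:
  "x \<in> carrier P \<Longrightarrow> fst (word_eval W a (l # w)) x
    = fst (letter_eval W a l) x \<otimes>\<^bsub>A\<^esub> fst (word_eval W a w) (x \<otimes>\<^bsub>P\<^esub> snd (letter_eval W a l))"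
  by (simp add: fst_mult_wreath)

lemma fst_word_eval_wreath_eq_one:
  assumes "a \<in> X \<rightarrow> carrier W" "w \<in> lists (X \<times> UNIV)" "x \<in> carrier P"
    and trivial: "\<And>u l v. w = u @ l # v \<Longrightarrow>
      fst (letter_eval W a l) (x \<otimes>\<^bsub>P\<^esub> word_eval P (\<lambda>c. snd (a c)) u) = \<one>\<^bsub>A\<^esub>"
  shows "fst (word_eval W a w) x = \<one>\<^bsub>A\<^esub>"
  using assms(2,3) trivial
proof (induction w arbitrary: x rule: list.induct)
  case Nil
  then show ?case by (simp add: fst_one_wreath)
next
  case (Cons l w)
  have l: "l \<in> X \<times> UNIV" and w: "w \<in> lists (X \<times> UNIV)" using Cons.prems by simp_all
  have snd_l: "snd (letter_eval W a l) = letter_eval P (\<lambda>c. snd (a c)) l"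
    using snd_word_eval_wreath[OF assms(1), of "[l]"] l W.letter_eval_closed[OF assms(1) l]
      P.letter_eval_closed[of "\<lambda>c. snd (a c)" X l] snd_closed assms(1)
    by (auto simp: Pi_iff)
  have lP: "letter_eval P (\<lambda>c. snd (a c)) l \<in> carrier P"
    using snd_closed[OF W.letter_eval_closed[OF assms(1) l]] snd_l by simp
  have "fst (letter_eval W a l) x = \<one>\<^bsub>A\<^esub>"
    using Cons.prems(3)[of "[]" l w] Cons.prems(2) by simp
  moreover have "fst (word_eval W a w) (x \<otimes>\<^bsub>P\<^esub> letter_eval P (\<lambda>c. snd (a c)) l) = \<one>\<^bsub>A\<^esub>"
  proof (rule Cons.IH[OF w])
    fix u l' v assume eq: "w = u @ l' # v"
    then have "u \<in> lists (X \<times> UNIV)" using w by simp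
    then have "word_eval P (\<lambda>c. snd (a c)) u \<in> carrier P"
      using P.word_eval_closed[of "\<lambda>c. snd (a c)" X u] snd_closed assms(1) by (auto simp: Pi_iff)
    then show "fst (letter_eval W a l') (x \<otimes>\<^bsub>P\<^esub> letter_eval P (\<lambda>c. snd (a c)) l
        \<otimes>\<^bsub>P\<^esub> word_eval P (\<lambda>c. snd (a c)) u) = \<one>\<^bsub>A\<^esub>"
      using Cons.prems(3)[of "l # u" l' v] eq Cons.prems(2) lP by (simp add: P.m_assoc)
  qed (use lP Cons.prems in simp)
  ultimately show ?case
    using fst_word_eval_wreath_Cons[OF Cons.prems(2), of a l w] snd_l by simp
qed

end


section \<open>Free groups are residually p\<close>

lemma reduced_append: "reduced (u @ v) \<Longrightarrow> reduced u \<and> reduced v"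
  by (auto simp: reduced_def successively_append_iff)

text \<open>By induction the proper factors of \<open>u\<close> are non-trivial in some finite \<open>p\<close>-group quotient \<open>P\<close>.
  Then the path of \<open>u\<close> in the Cayley graph of \<open>P\<close> traverses its first edge exactly once, so \<open>u\<close>
  is detected by the flow through this edge, which is a homomorphism to the wreath product.\<close>

theorem free_group_residually_p:
  assumes p: "prime p" and "u \<in> carrier (free_group X)" "u \<noteq> []"
  shows "\<exists>N\<in>p_power_index_normal p (free_group X). u \<notin> N"
  using assms(2,3)
proof (induction "length u" arbitrary: u rule: less_induct)
  case less
  let ?F = "free_group X"
  interpret F: group ?F by (rule group_free_group)
  have uX: "u \<in> lists (X \<times> UNIV)" and ur: "reduced u"
    using less.prems by (auto simp: free_group_def)
  \<comment> \<open>A factor of \<open>u\<close> that is trivial in a quotient means that the path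
    of \<open>u\<close> returns to an earlier vertex there. Excluding \<open>u\<close> itself makes
    every factor shorter, as the induction hypothesis requires.\<close>
  define V where "V = {v. v \<noteq> [] \<and> (\<exists>s t. u = s @ v @ t \<and> s @ t \<noteq> [])}"
  have VI: "v \<in> V" if "u = s @ v @ t" "v \<noteq> []" "s @ t \<noteq> []" for s v t
    using that by (auto simp: V_def)
  have Vc: "v \<in> carrier ?F" if v: "v \<in> V" for v
  proof -
    obtain s t where u: "u = s @ v @ t" using v by (auto simp: V_def)
    then have "reduced v" using ur reduced_append by blast
    then show ?thesis using u uX by (simp add: free_group_def)
  qed
  have "finite {v. set v \<subseteq> set u \<and> length v \<le> length u}"
    by (rule finite_lists_length_le) simp
  then have "finite V"
    by (rule finite_subset[rotated]) (auto simp: V_def)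
  moreover have "\<exists>M\<in>p_power_index_normal p ?F. v \<notin> M" if "v \<in> V" for v
    using that less.hyps[of v] Vc[OF that] by (auto simp: V_def)
  then obtain M where M: "M v \<in> p_power_index_normal p ?F" "v \<notin> M v" if "v \<in> V" for v
    by metis
  ultimately obtain N where N: "N \<in> p_power_index_normal p ?F" "\<forall>v\<in>V. N \<subseteq> M v"
    using F.p_power_index_normal_Inter[OF p, of V M] by blast
  note ND = p_power_index_normalD[OF N(1)]
  interpret N: normal N ?F by (rule ND)
  let ?P = "?F Mod N" and ?A = "integer_mod_group p"
  interpret P: group ?P by (rule ND)
  interpret wreath_product ?A ?P 
    by (simp add: wreath_product_def P.is_group)
  define q where "q = (\<lambda>x. N #>\<^bsub>?F\<^esub> free_gen x)"
  have q: "q \<in> X \<rightarrow> carrier ?P"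
    by (auto simp: q_def carrier_FactGroup free_gen_closed)
  have qV: "word_eval ?P q v \<noteq> \<one>\<^bsub>?P\<^esub>" if "v \<in> V" for v
  proof
    assume "word_eval ?P q v = \<one>\<^bsub>?P\<^esub>"
    then have "N #>\<^bsub>?F\<^esub> v = N"
      using word_eval_Mod[OF ND(1) Vc[OF that]] by (simp add: q_def)
    then have "v \<in> N" using F.rcos_self[OF Vc[OF that] N.subgroup_axioms] by simp
    then show False using N(2) M(2) that by blast
  qed
  note [simp del] = mult_FactGroup one_FactGroup
  obtain b s u' where u: "u = (b, s) # u'" using less.prems by (cases u) auto
  have b: "b \<in> X" using uX u by auto
  have p1: "p > 1" using p prime_gt_1_nat by blast
  \<comment> \<open>Only the edge from the identity to \<open>q b\<close> carries a label. It is met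
    forwards at the identity and backwards at \<open>q b\<close>, which are the two exceptions in
    \<open>le\<close>.\<close>
  define a where "a = (\<lambda>c. (\<lambda>x\<in>carrier ?P. if c = b \<and> x = \<one>\<^bsub>?P\<^esub> then 1 else 0 :: int, q c))"
  have a: "a \<in> X \<rightarrow> carrier W"
    using q p1 by (auto simp: a_def carrier_wreath carrier_integer_mod_group)
  have sa: "(\<lambda>c. snd (a c)) = q" by (simp add: a_def)
  have le: "fst (letter_eval W a l) x = \<one>\<^bsub>?A\<^esub>"
    if "x \<in> carrier ?P" "l \<in> X \<times> UNIV"
      "l = (b, True) \<Longrightarrow> x \<noteq> \<one>\<^bsub>?P\<^esub>" "l = (b, False) \<Longrightarrow> x \<noteq> q b" for x l
  proof (cases l)
    case (Pair c r)
    then have c: "c \<in> X" "a c \<in> carrier W" "q c \<in> carrier ?P" using that a q by auto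
    have "x \<otimes>\<^bsub>?P\<^esub> inv\<^bsub>?P\<^esub> q c = \<one>\<^bsub>?P\<^esub> \<Longrightarrow> x = q c"
      using c that(1) by (metis P.inv_inv P.inv_equality P.inv_closed)
    moreover have "x \<otimes>\<^bsub>?P\<^esub> inv\<^bsub>?P\<^esub> q c \<in> carrier ?P" using c that by simp
    ultimately show ?thesis
      using Pair c that fst_inv_wreath[of "a c" x]
      by (cases r; cases "c = b")
        (auto simp: letter_eval_def a_def carrier_integer_mod_group)
  qed
  have u'X: "u' \<in> lists (X \<times> UNIV)" using uX u by simp
  have P_eval: "word_eval ?P q v \<in> carrier ?P" if "v \<in> lists (X \<times> UNIV)" for v
    using P.word_eval_closed[OF q that] .
  have rest: "fst (word_eval W a u') x = \<one>\<^bsub>?A\<^esub>"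
    if x: "x \<in> carrier ?P"
      and "\<And>v r t. u' = v @ (b, r) # t \<Longrightarrow> (if r then x \<otimes>\<^bsub>?P\<^esub> word_eval ?P q v \<noteq> \<one>\<^bsub>?P\<^esub>
        else x \<otimes>\<^bsub>?P\<^esub> word_eval ?P q v \<noteq> q b)" for x
  proof (rule fst_word_eval_wreath_eq_one[OF a u'X x], unfold sa)
    fix v l t assume eq: "u' = v @ l # t"
    then have "v \<in> lists (X \<times> UNIV)" "l \<in> X \<times> UNIV" using u'X by auto
    then show "fst (letter_eval W a l) (x \<otimes>\<^bsub>?P\<^esub> word_eval ?P q v) = \<one>\<^bsub>?A\<^esub>"
      using that(2)[of v True t] that(2)[of v False t] eq x P_eval by (intro le) auto
  qed
  have qb: "q b \<in> carrier ?P" using q b by auto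
  have "word_eval W a u \<noteq> \<one>\<^bsub>W\<^esub>"
  proof (cases s)
    case True
    \<comment> \<open>After its first letter the path stands at \<open>q b\<close>. Crossing the
      edge again forwards would make \<open>(b, True) # v\<close> trivial in the quotient; crossing
      it backwards would make \<open>v\<close> trivial, and \<open>v\<close> is nonempty because
      \<open>u\<close> is reduced.\<close>
    have "fst (word_eval W a u') (q b) = \<one>\<^bsub>?A\<^esub>"
    proof (rule rest[OF qb])
      fix v r t assume eq: "u' = v @ (b, r) # t"
      then have vX: "v \<in> lists (X \<times> UNIV)" using u'X by auto
      have bv: "q b \<otimes>\<^bsub>?P\<^esub> word_eval ?P q v = word_eval ?P q ((b, True) # v)"
        by (simp add: letter_eval_def)
      show "if r then q b \<otimes>\<^bsub>?P\<^esub> word_eval ?P q v \<noteq> \<one>\<^bsub>?P\<^esub> else q b \<otimes>\<^bsub>?P\<^esub> word_eval ?P q v \<noteq> q b"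
      proof (cases r)
        case r: True
        have "(b, True) # v \<in> V"
          by (rule VI[of "[]" _ "(b, r) # t"]) (use u eq True in simp_all)
        then show ?thesis using qV r by (simp add: bv del: P.word_eval_Cons)
      next
        case r: False
        have "v \<in> V"
        proof -
          have "v \<noteq> []" using ur u eq True r by (auto simp: reduced_Cons inv_letter_def)
          then show ?thesis
            by (intro VI[of "[(b, s)]" _ "(b, r) # t"]) (use u eq in simp_all)
        qed
        then have "word_eval ?P q v \<noteq> \<one>\<^bsub>?P\<^esub>" by (rule qV)
        then show ?thesis using r qb P_eval[OF vX] P.r_cancel_one[OF qb] by auto
      qed
    qed
    then have "fst (word_eval W a u) \<one>\<^bsub>?P\<^esub> = 1"
      using fst_word_eval_wreath_Cons[of "\<one>\<^bsub>?P\<^esub>" a "(b, s)" u'] u True qb p1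
      by (simp add: letter_eval_def a_def)
    then show ?thesis using fst_one_wreath[of "\<one>\<^bsub>?P\<^esub>"] by auto
  next
    case False
    \<comment> \<open>Now the path starts at \<open>q b\<close>, crosses the edge backwards and
      continues from the identity; a second crossing would make \<open>v\<close> or
      \<open>v @ [(b, False)]\<close> trivial.\<close>
    have "fst (word_eval W a u') \<one>\<^bsub>?P\<^esub> = \<one>\<^bsub>?A\<^esub>"
    proof (rule rest[OF P.one_closed])
      fix v r t assume eq: "u' = v @ (b, r) # t"
      then have vX: "v \<in> lists (X \<times> UNIV)" using u'X by auto
      note wv = P_eval[OF vX]
      show "if r then \<one>\<^bsub>?P\<^esub> \<otimes>\<^bsub>?P\<^esub> word_eval ?P q v \<noteq> \<one>\<^bsub>?P\<^esub>
        else \<one>\<^bsub>?P\<^esub> \<otimes>\<^bsub>?P\<^esub> word_eval ?P q v \<noteq> q b"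
      proof (cases r)
        case r: True
        have "v \<noteq> []" using ur u eq False r by (auto simp: reduced_Cons inv_letter_def)
        then have "v \<in> V"
          by (intro VI[of "[(b, s)]" _ "(b, r) # t"]) (use u eq in simp_all)
        then show ?thesis using qV wv r by auto
      next
        case r: False
        have "v @ [(b, False)] \<in> V"
          by (rule VI[of "[(b, s)]" _ t]) (use u eq r in simp_all)
        then have "word_eval ?P q (v @ [(b, False)]) \<noteq> \<one>\<^bsub>?P\<^esub>" by (rule qV)
        moreover have "word_eval ?P q (v @ [(b, False)]) = word_eval ?P q v \<otimes>\<^bsub>?P\<^esub> inv\<^bsub>?P\<^esub> q b"
          using P.word_eval_append[OF q vX, of "[(b, False)]"] b qb wv by (simp add: letter_eval_def)
        ultimately show ?thesis using r qb wv by (auto)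
      qed
    qed
    moreover have ab: "a b \<in> carrier W" using a b by auto
    then have "fst (inv\<^bsub>W\<^esub> a b) (q b) = (- 1) mod int p" "snd (inv\<^bsub>W\<^esub> a b) = inv\<^bsub>?P\<^esub> q b"
      using fst_inv_wreath[OF ab qb] snd_inv_wreath[OF ab] qb p1
      by (simp_all add: a_def carrier_integer_mod_group)
    ultimately have "fst (word_eval W a u) (q b) = (- 1) mod int p"
      using fst_word_eval_wreath_Cons[OF qb, of a "(b, s)" u'] u False qb
      by (simp add: letter_eval_def)
    moreover have "(- 1) mod int p \<noteq> 0" using p1 by (auto simp: zmod_zminus1_eq_if)
    ultimately show ?thesis using fst_one_wreath[OF qb] by auto
  qed
  then have "u \<notin> kernel ?F W (word_eval W a)" by (simp add: kernel_def)
  moreover have "kernel ?F W (word_eval W a) \<in> p_power_index_normal p ?F"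
  proof -
    interpret h: group_hom ?F W "word_eval W a"
      by unfold_locales (rule W.word_eval_hom[OF a])
    have "order ?A = p ^ 1" using p1 by (simp add: order_def carrier_integer_mod_group)
    then show ?thesis
      using h.kernel_p_power_index[OF p] order_wreath_p_power[OF p] ND(3) by blast
  qed
  ultimately show ?case by blast
qed


section \<open>Non-orientable surface groups are residually p\<close>

lemma (in group) inv_cancel_left [simp]:
  "x \<in> carrier G \<Longrightarrow> y \<in> carrier G \<Longrightarrow> inv x \<otimes> (x \<otimes> y) = y"
  "x \<in> carrier G \<Longrightarrow> y \<in> carrier G \<Longrightarrow> x \<otimes> (inv x \<otimes> y) = y"
  by (simp_all flip: m_assoc)

section \<open>Square words and rewriting by levels\<close>

definition squares :: "nat list \<Rightarrow> nat letter list" where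
  "squares l = concat (map (\<lambda>k. [(k, True), (k, True)]) l)"

lemma squares_Nil [simp]: "squares [] = []"
  by (simp add: squares_def)

lemma squares_Cons [simp]: "squares (k # l) = (k, True) # (k, True) # squares l"
  by (simp add: squares_def)

lemma nonorientable_relator_squares:
  assumes "n \<ge> 3"
  shows "nonorientable_relator n = squares (1 # 2 # 3 # [4..<Suc n])"
proof -
  have "[1..<Suc n] = 1 # 2 # 3 # [4..<Suc n]"
    using assms by (simp add: upt_conv_Cons numeral_eq_Suc)
  then show ?thesis by (simp add: nonorientable_relator_def squares_def)
qed

lemma squares_in_lists: "set l \<subseteq> X \<Longrightarrow> squares l \<in> lists (X \<times> UNIV)"
  by (induction l) auto

text \<open>Words are read from left to right with a current level \<open>e\<close>: reading the generator \<open>k\<close>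
  contributes \<open>b k e\<close> and moves to the level \<open>e + s k\<close>. This is the rewriting process for the
  kernel of the homomorphism to the integers given by \<open>s\<close>.\<close>

fun walk :: "('b, 'm) monoid_scheme \<Rightarrow> ('a \<Rightarrow> int \<Rightarrow> 'b) \<Rightarrow> ('a \<Rightarrow> int) \<Rightarrow> 'a letter list \<Rightarrow> int \<Rightarrow> 'b" where
  "walk H b s [] e = \<one>\<^bsub>H\<^esub>"
| "walk H b s ((k, r) # w) e =
    (if r then b k e \<otimes>\<^bsub>H\<^esub> walk H b s w (e + s k)
     else inv\<^bsub>H\<^esub> b k (e - s k) \<otimes>\<^bsub>H\<^esub> walk H b s w (e - s k))"

fun shift :: "('a \<Rightarrow> int) \<Rightarrow> 'a letter list \<Rightarrow> int" where
  "shift s [] = 0"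
| "shift s ((k, r) # w) = (if r then s k else - s k) + shift s w"

lemma (in group) walk_closed:
  assumes "\<And>k e. k \<in> X \<Longrightarrow> b k e \<in> carrier G" "w \<in> lists (X \<times> UNIV)"
  shows "walk G b s w e \<in> carrier G"
  using assms(2) by (induction w arbitrary: e rule: list.induct) (auto simp: assms(1))

lemma (in group_hom) hom_walk:
  assumes "\<And>k e. k \<in> X \<Longrightarrow> b k e \<in> carrier G" "w \<in> lists (X \<times> UNIV)"
  shows "h (walk G b s w e) = walk H (\<lambda>k e. h (b k e)) s w e"
  using assms(2)
proof (induction w arbitrary: e rule: list.induct)
  case (Cons l w)
  obtain k r where l: "l = (k, r)" by force
  have k: "k \<in> X" and w: "w \<in> lists (X \<times> UNIV)" using Cons.prems l by auto
  then show ?case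
    using Cons.IH[OF w] assms(1)[OF k] G.walk_closed[of X b w, OF assms(1) w] by (simp add: l)
qed simp

text \<open>The powers of \<open>y\<close> between consecutive letters cancel, whichever way a
  letter is read; only the initial and the final power survive.\<close>

lemma (in group) walk_conjugate:
  assumes y: "y \<in> carrier G" and x: "\<And>k. k \<in> X \<Longrightarrow> x k \<in> carrier G"
    and b: "\<And>k e. k \<in> X \<Longrightarrow> b k e = y [^] e \<otimes> x k \<otimes> y [^] (- (e + s k))"
    and w: "w \<in> lists (X \<times> UNIV)"
  shows "walk G b s w e = y [^] e \<otimes> word_eval G x w \<otimes> y [^] (- (e + shift s w))"
  using w
proof (induction w arbitrary: e rule: list.induct)
  case Nil
  then show ?case using y by (simp flip: int_pow_mult)
next
  case (Cons l w)
  obtain k r where l: "l = (k, r)" by force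
  have k: "k \<in> X" and w: "w \<in> lists (X \<times> UNIV)" using Cons.prems l by auto
  have c: "x k \<in> carrier G" "word_eval G x w \<in> carrier G"
    using x k word_eval_closed[of x X w] w by auto
  have cancel: "y [^] (- i) \<otimes> (y [^] i \<otimes> u) = u" if "u \<in> carrier G" for i :: int and u
    using y that by (simp add: int_pow_neg)
  show ?case
  proof (cases r)
    case True
    then show ?thesis
      using Cons.IH[OF w, of "e + s k"] c y k
      by (simp add: l b letter_eval_def m_assoc cancel add.assoc del: minus_add_distrib)
  next
    case False
    have "inv b k (e - s k) = y [^] e \<otimes> inv x k \<otimes> y [^] (- (e - s k))"
      using c y k by (simp add: b inv_mult_group m_assoc flip: int_pow_neg)
    then show ?thesis
      using False Cons.IH[OF w, of "e - s k"] c y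
      by (simp add: l letter_eval_def m_assoc cancel diff_conv_add_uminus add.assoc
          del: minus_add_distrib minus_diff_eq add_uminus_conv_diff)
  qed
qed

text \<open>When the labels have period \<open>M\<close> in the level, the walk becomes the first
  component of a homomorphism into the wreath product of \<open>A\<close> with a cyclic group of
  order \<open>M\<close>, and the shift modulo \<open>M\<close> the second. For finite
  \<open>A\<close> the target is finite.\<close>

locale walk_mod =
  fixes A :: "('b, 'm) monoid_scheme" and M :: nat and X :: "'a set"
    and b :: "'a \<Rightarrow> int \<Rightarrow> 'b" and s :: "'a \<Rightarrow> int"
  assumes group_A: "group A" and M: "M > 0"
    and b_closed: "\<And>k e. k \<in> X \<Longrightarrow> b k e \<in> carrier A"
    and b_mod: "\<And>k e. k \<in> X \<Longrightarrow> b k (e mod int M) = b k e"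
begin

abbreviation C where "C \<equiv> integer_mod_group M"

sublocale wreath_product A C
  using group_A by (simp add: wreath_product_def)

definition step where
  "step k = (\<lambda>e\<in>carrier C. b k e, s k mod int M)"

lemma step_closed: "step \<in> X \<rightarrow> carrier W"
  using M by (auto simp: step_def carrier_wreath b_closed carrier_integer_mod_group)

lemma mod_closed: "e mod int M \<in> carrier C"
  using M by (simp add: carrier_integer_mod_group)

lemma letter_eval_step:
  assumes "k \<in> X"
  shows "snd (letter_eval W step (k, r)) = (if r then s k else - s k) mod int M"
    and "fst (letter_eval W step (k, r)) (e mod int M) = (if r then b k e else inv\<^bsub>A\<^esub> b k (e - s k))"
proof -
  have sk: "step k \<in> carrier W" using step_closed assms by auto
  have "(e mod int M + - (s k mod int M) mod int M) mod int M = (e - s k) mod int M"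
    by (simp add: mod_simps)
  then have "b k (e mod int M + - (s k mod int M) mod int M) = b k (e - s k)"
    using b_mod[OF assms] by metis
  then show "fst (letter_eval W step (k, r)) (e mod int M) = (if r then b k e else inv\<^bsub>A\<^esub> b k (e - s k))"
    using fst_inv_wreath[OF sk mod_closed] mod_closed b_mod[OF assms] 
    by (auto simp: letter_eval_def step_def)
  show "snd (letter_eval W step (k, r)) = (if r then s k else - s k) mod int M"
    using snd_inv_wreath[OF sk] mod_closed by (auto simp: letter_eval_def step_def mod_simps)
qed

lemma snd_word_eval_step:
  assumes "w \<in> lists (X \<times> UNIV)"
  shows "snd (word_eval W step w) = shift s w mod int M"
  using assms
proof (induction w rule: list.induct)
  case (Cons l w)
  obtain k r where l: "l = (k, r)" by force
  then show ?case using Cons letter_eval_step(1)[of k r]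
    by (auto simp: snd_mult_wreath mod_simps)
qed (simp add: snd_one_wreath)

lemma fst_word_eval_step:
  assumes "w \<in> lists (X \<times> UNIV)"
  shows "fst (word_eval W step w) (e mod int M) = walk A b s w e"
  using assms
proof (induction w arbitrary: e rule: list.induct)
  case Nil
  then show ?case using mod_closed fst_one_wreath by simp
next
  case (Cons l w)
  obtain k r where l: "l = (k, r)" by force
  have k: "k \<in> X" and w: "w \<in> lists (X \<times> UNIV)" using Cons.prems l by auto
  show ?case
    using fst_word_eval_wreath_Cons[OF mod_closed, of step l w e] letter_eval_step[OF k, of r] l
      Cons.IH[OF w, of "e + s k"] Cons.IH[OF w, of "e - s k"]
    by (auto simp: mod_simps)
qed

end

text \<open>In terms of \<open>x = x\<^sub>1 x\<^sub>2\<^sup>2 x\<^sub>3\<close>, \<open>y = x\<^sub>3\<^sup>-\<^sup>1 x\<^sub>2\<^sup>-\<^sup>1\<close> and \<open>z = y x\<^sub>1 x\<^sub>2\<^sup>2 x\<^sub>3\<^sup>2\<close> the relator is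
  \<open>[x, y] z\<^sup>2 x\<^sub>4\<^sup>2 \<cdots> x\<^sub>n\<^sup>2\<close>. The kernel of the homomorphism to the integers that maps \<open>y\<close> to \<open>1\<close>
  and \<open>x\<close>, \<open>z\<close>, \<open>x\<^sub>4\<close>, \<dots>, \<open>x\<^sub>n\<close> to \<open>0\<close> is free on \<open>x\<close> and the conjugates
  \<open>z\<^sub>j\<^sub>e = y\<^sup>e z\<^sub>j y\<^sup>-\<^sup>e\<close>, where \<open>z\<^sub>3 = z\<close> and \<open>z\<^sub>j = x\<^sub>j\<close> for \<open>j \<ge> 4\<close>. With
  \<open>v\<^sub>e = z\<^sub>3\<^sub>e\<^sup>2 \<cdots> z\<^sub>n\<^sub>e\<^sup>2\<close>, the conjugates \<open>X\<^sub>e\<close> of \<open>x\<close> satisfy \<open>X\<^bsub>e+1\<^esub> = v\<^sub>e X\<^sub>e\<close>. The functions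
  \<open>level_shift\<close> and \<open>level_gen\<close> express \<open>x\<^sub>1\<close>, \dots, \<open>x\<^sub>n\<close> in these terms.\<close>

definition level_shift :: "nat \<Rightarrow> int" where
  "level_shift k = (if k = 1 then 1 else if k = 3 then - 1 else 0)"

locale levels = group H for H (structure) +
  fixes n :: nat and c :: "nat \<times> int \<Rightarrow> 'a"
  assumes n3: "n \<ge> 3" and c_closed: "c i \<in> carrier H"
begin

definition level_square :: "int \<Rightarrow> 'a" where
  "level_square e = word_eval H (\<lambda>j. c (j, e)) (squares [3..<Suc n])"

lemma level_square_closed [simp]: "level_square e \<in> carrier H"
  unfolding level_square_def
  by (rule word_eval_closed[of _ UNIV]) (auto simp: c_closed intro: squares_in_lists)

lemma level_square_eq:
  "level_square e = c (3, e) \<otimes> (c (3, e) \<otimes> word_eval H (\<lambda>j. c (j, e)) (squares [4..<Suc n]))"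
proof -
  have "[3..<Suc n] = 3 # [4..<Suc n]"
    using n3 by (simp add: upt_conv_Cons numeral_eq_Suc)
  then show ?thesis by (simp add: level_square_def letter_eval_def)
qed

primrec level_pos :: "nat \<Rightarrow> 'a" where
  "level_pos 0 = c (0, 0)"
| "level_pos (Suc m) = level_square (int m) \<otimes> level_pos m"

primrec level_neg :: "nat \<Rightarrow> 'a" where
  "level_neg 0 = c (0, 0)"
| "level_neg (Suc m) = inv level_square (- int m - 1) \<otimes> level_neg m"

definition level_x :: "int \<Rightarrow> 'a" where
  "level_x e = (if e \<ge> 0 then level_pos (nat e) else level_neg (nat (- e)))"

lemma level_pos_closed: "level_pos m \<in> carrier H"
  by (induction m) (auto simp: c_closed)

lemma level_neg_closed: "level_neg m \<in> carrier H"
  by (induction m) (auto simp: c_closed)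

lemma level_x_closed [simp]: "level_x e \<in> carrier H"
  by (simp add: level_x_def level_pos_closed level_neg_closed)

lemma level_x_0: "level_x 0 = c (0, 0)"
  by (simp add: level_x_def)

lemma level_x_Suc: "level_x (e + 1) = level_square e \<otimes> level_x e"
proof (cases "e \<ge> 0")
  case True
  then have "nat (e + 1) = Suc (nat e)" by simp
  then show ?thesis using True by (simp add: level_x_def)
next
  case False
  define m where "m = nat (- e - 1)"
  then have e: "e = - int m - 1" using False by simp
  then have "nat (- e) = Suc m" by simp
  then have "level_x e = inv level_square e \<otimes> level_neg m"
    using False e by (simp add: level_x_def)
  then have "level_square e \<otimes> level_x e = level_neg m" by (simp add: level_neg_closed)
  moreover have "level_x (e + 1) = level_neg m"
    using e by (cases m) (simp_all add: level_x_def nat_add_distrib)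
  ultimately show ?thesis by simp
qed

definition level_gen :: "nat \<Rightarrow> int \<Rightarrow> 'a" where
  "level_gen k e =
    (if k = 1 then inv level_square e \<otimes> c (3, e)
     else if k = 2 then inv c (3, e - 1) \<otimes> level_x e
     else if k = 3 then inv level_x e \<otimes> c (3, e - 1)
     else c (k, e))"

lemma level_gen_closed: "level_gen k e \<in> carrier H"
  by (simp add: level_gen_def c_closed)

text \<open>The first six letters are read at the levels \<open>e\<close>, \<open>e + 1\<close>,
  \<open>e + 2\<close>, \<open>e + 2\<close>, \<open>e + 2\<close>, \<open>e + 1\<close>, and the
  tail at \<open>e\<close>. The recursion from \<open>level_x (e + 1)\<close> to
  \<open>level_x (e + 2)\<close> cancels \<open>level_square (e + 1)\<close>, and
  \<open>inv level_square e\<close> times \<open>level_square e\<close> remains.\<close>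

lemma walk_relator: "walk H level_gen level_shift (nonorientable_relator n) e = \<one>"
proof -
  let ?r = "word_eval H (\<lambda>j. c (j, e)) (squares [4..<Suc n])"
  have "walk H level_gen level_shift (squares l) e = word_eval H (\<lambda>j. c (j, e)) (squares l)"
    if "\<forall>k\<in>set l. k \<ge> 4" for l
    using that
    by (induction l) (auto simp: level_gen_def level_shift_def letter_eval_def)
  then have r: "walk H level_gen level_shift (squares [4..<Suc n]) e = ?r" by simp
  have rc: "?r \<in> carrier H"
    by (rule word_eval_closed[of _ UNIV]) (auto simp: c_closed intro: squares_in_lists)
  have x2: "level_x (e + 2) = level_square (e + 1) \<otimes> level_x (e + 1)"
    using level_x_Suc[of "e + 1"] by (simp add: add.assoc)
  have "walk H level_gen level_shift (nonorientable_relator n) e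
    = inv level_square e \<otimes> (c (3, e) \<otimes> (c (3, e) \<otimes> ?r))"
    using r rc
    by (simp add: nonorientable_relator_squares[OF n3] level_gen_def level_shift_def
        m_assoc inv_mult_group c_closed add.assoc add.commute[of 1 e] x2 del: upt_Suc)
  then show ?thesis using rc by (simp add: level_square_eq c_closed)
qed

end

section \<open>Periodic families of level generators\<close>

lemma periodic_int:
  fixes f :: "int \<Rightarrow> 'a"
  assumes "\<And>e. f (e + m) = f e"
  shows "f (e + i * m) = f e" and "f (e mod m) = f e"
proof -
  show shift: "f (e + i * m) = f e" for i e
  proof (induction i rule: int_induct[of _ 0])
    case (step1 i)
    then show ?case using assms[of "e + i * m"] by (simp add: algebra_simps)
  next
    case (step2 i)
    then show ?case using assms[of "e + (i - 1) * m"] by (simp add: algebra_simps)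
  qed simp
  show "f (e mod m) = f e"
    using shift[of "e mod m" "e div m"] by simp
qed

context levels
begin

lemma level_x_unique:
  assumes "X 0 = c (0, 0)" "\<And>e. X (e + 1) = level_square e \<otimes> X e" "\<And>e. X e \<in> carrier H"
  shows "X e = level_x e"
proof (induction e rule: int_induct[of _ 0])
  case base
  then show ?case by (simp add: assms level_x_0)
next
  case (step1 i)
  then show ?case by (simp add: assms(2) level_x_Suc)
next
  case (step2 i)
  have "level_square (i - 1) \<otimes> X (i - 1) = level_square (i - 1) \<otimes> level_x (i - 1)"
    using assms(2)[of "i - 1"] level_x_Suc[of "i - 1"] step2 by simp
  then show ?case by (simp add: assms(3))
qed

context
  fixes m :: int
  assumes periodic: "\<And>i e. c (i, e + m) = c (i, e)"
begin

lemma level_square_periodic: "level_square (e + m) = level_square e"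
  by (simp add: level_square_def periodic)

text \<open>The recursion multiplies on the left, so solutions may be multiplied by constants on the
  right. Translation by \<open>m\<close> thus amounts to a fixed right factor \<open>D\<close>,
  which disappears only after \<open>order H\<close> repetitions.\<close>

lemma level_x_periodic: "level_x (e + m * int (order H)) = level_x e"
proof -
  define D where "D = inv c (0, 0) \<otimes> level_x m"
  have D: "D \<in> carrier H" by (simp add: D_def c_closed)
  have *: "level_x (e + m) = level_x e \<otimes> D" for e
  proof -
    have "level_x (e + m) \<otimes> inv D = level_x e"
    proof (rule level_x_unique[where X = "\<lambda>e. level_x (e + m) \<otimes> inv D"])
      show "level_x (0 + m) \<otimes> inv D = c (0, 0)"
        by (simp add: D_def inv_mult_group c_closed)
      show "level_x (e + 1 + m) \<otimes> inv D = level_square e \<otimes> (level_x (e + m) \<otimes> inv D)" for e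
        using level_x_Suc[of "e + m"] level_square_periodic D by (simp add: m_assoc algebra_simps)
    qed (simp add: D)
    then show ?thesis using D by (simp add: inv_solve_right' flip: \<open>_ = level_x e\<close>) (simp add: m_assoc)
  qed
  have "level_x (e + m * int r) = level_x e \<otimes> D [^] r" for r
  proof (induction r)
    case (Suc r)
    have "level_x (e + m * int (Suc r)) = level_x (e + m * int r + m)"
      by (simp add: algebra_simps)
    then show ?case using Suc *[of "e + m * int r"] D by (simp add: m_assoc)
  qed simp
  then show ?thesis using D pow_order_eq_1[OF D] by simp
qed

lemma level_gen_periodic: "level_gen k (e + m * int (order H)) = level_gen k e"
proof -
  have c: "c (i, e + m * int (order H)) = c (i, e)" for i e
    using periodic_int(1)[of "\<lambda>e. c (i, e)" m e "int (order H)"] periodic by (simp add: mult.commute)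
  then have "level_square (e + m * int (order H)) = level_square e"
    by (simp add: level_square_def)
  moreover have "c (3, e + m * int (order H) - 1) = c (3, e - 1)"
    using c[of 3 "e - 1"] by (simp add: algebra_simps)
  ultimately show ?thesis by (simp add: level_gen_def c level_x_periodic)
qed

end

end

text \<open>Naturality, which transfers the formulas from the free group to \<open>G\<close> and to
  the finite quotient.\<close>

lemma level_gen_hom:
  assumes "group_hom H H' f" "levels H n c"
  shows "f (levels.level_gen H n c k e) = levels.level_gen H' n (\<lambda>i. f (c i)) k e"
proof -
  interpret f: group_hom H H' f by (rule assms)
  interpret H: levels H n c by (rule assms)
  interpret H': levels H' n "\<lambda>i. f (c i)"
    by unfold_locales (use H.n3 H.c_closed in auto)
  have sq: "f (H.level_square e) = H'.level_square e" for e
    using f.hom_word_eval[of "\<lambda>j. c (j, e)" UNIV "squares [3..<Suc n]"] H.c_closed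
      squares_in_lists[of "[3..<Suc n]" UNIV]
    by (simp add: H.level_square_def H'.level_square_def)
  have "f (H.level_x e) = H'.level_x e" for e
    by (rule H'.level_x_unique) (simp_all add: H.level_x_0 H.level_x_Suc sq)
  then show ?thesis
    by (simp add: H.level_gen_def H'.level_gen_def sq H.c_closed)
qed

section \<open>The surface group and its finite p-quotients\<close>

locale surface_group =
  fixes n :: nat
  assumes n3: "n \<ge> 3"
begin

abbreviation G where "G \<equiv> nonorientable_surface_group n"
abbreviation x where "x \<equiv> surface_gen n"
abbreviation relator where "relator \<equiv> nonorientable_relator n"

sublocale presentation "{1..n}" "{nonorientable_relator n}"
  rewrites "presented_group {1..n} {nonorientable_relator n} = nonorientable_surface_group n"
    and "presented_gen {1..n} {nonorientable_relator n} = surface_gen n"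
  by unfold_locales
    (use nonorientable_relator_closed in
      \<open>simp_all add: nonorientable_surface_group_def surface_gen_def[abs_def]\<close>)

lemma x_closed: "k \<in> {1..n} \<Longrightarrow> x k \<in> carrier G"
  using gen_closed by auto

lemma relator_eq_one: "word_eval G x relator = \<one>\<^bsub>G\<^esub>"
  using word_eval_presented_eq_one_iff[OF nonorientable_relator_closed]
  by (auto simp: normal_closure_def)

text \<open>The homomorphism from \<open>K\<close> to \<open>G\<close> that sends the generator
  \<open>(j, e)\<close> to the conjugate of \<open>z j\<close> by the \<open>e\<close>-th power of
  \<open>y\<close> takes the walk to \<open>word_eval G x w\<close> times a power of
  \<open>y\<close> given by the shift.\<close>

lemma walk_in_surface_group:
  assumes w: "w \<in> lists ({1..n} \<times> UNIV)"
  defines "K \<equiv> free_group (UNIV :: (nat \<times> int) set)"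
  assumes "walk K (levels.level_gen K n free_gen) level_shift w 0 = \<one>\<^bsub>K\<^esub>" "shift level_shift w = 0"
  shows "word_eval G x w = \<one>\<^bsub>G\<^esub>"
proof -
  interpret K: group K unfolding K_def by (rule group_free_group)
  interpret K: levels K n free_gen
    by unfold_locales (simp_all add: K_def n3 free_gen_closed)
  define A B C where "A = x 1" and "B = x 2" and "C = x 3"
  have ABC [simp]: "A \<in> carrier G" "B \<in> carrier G" "C \<in> carrier G"
    using n3 x_closed by (auto simp: A_def B_def C_def)
  define V where "V = word_eval G x (squares [4..<Suc n])"
  have sq4: "squares [4..<Suc n] \<in> lists ({4..n} \<times> UNIV)" by (rule squares_in_lists) auto
  have Vc: "V \<in> carrier G"
    unfolding V_def by (rule P.word_eval_closed[OF _ sq4]) (auto intro: x_closed)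
  have "A \<otimes>\<^bsub>G\<^esub> (A \<otimes>\<^bsub>G\<^esub> (B \<otimes>\<^bsub>G\<^esub> (B \<otimes>\<^bsub>G\<^esub> (C \<otimes>\<^bsub>G\<^esub> (C \<otimes>\<^bsub>G\<^esub> V))))) = \<one>\<^bsub>G\<^esub>"
    using relator_eq_one
    by (simp add: nonorientable_relator_squares[OF n3] letter_eval_def A_def B_def C_def V_def
        del: upt_Suc)
  then have "(A \<otimes>\<^bsub>G\<^esub> A \<otimes>\<^bsub>G\<^esub> B \<otimes>\<^bsub>G\<^esub> B \<otimes>\<^bsub>G\<^esub> C \<otimes>\<^bsub>G\<^esub> C) \<otimes>\<^bsub>G\<^esub> V = \<one>\<^bsub>G\<^esub>"
    using Vc by (simp add: P.m_assoc)
  then have "inv\<^bsub>G\<^esub> V = A \<otimes>\<^bsub>G\<^esub> A \<otimes>\<^bsub>G\<^esub> B \<otimes>\<^bsub>G\<^esub> B \<otimes>\<^bsub>G\<^esub> C \<otimes>\<^bsub>G\<^esub> C"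
    using Vc by (intro P.inv_equality) simp_all
  then have "V = inv\<^bsub>G\<^esub> (A \<otimes>\<^bsub>G\<^esub> A \<otimes>\<^bsub>G\<^esub> B \<otimes>\<^bsub>G\<^esub> B \<otimes>\<^bsub>G\<^esub> C \<otimes>\<^bsub>G\<^esub> C)"
    using Vc P.inv_inv by metis
  then have V: "V = inv\<^bsub>G\<^esub> C \<otimes>\<^bsub>G\<^esub> (inv\<^bsub>G\<^esub> C \<otimes>\<^bsub>G\<^esub> (inv\<^bsub>G\<^esub> B \<otimes>\<^bsub>G\<^esub> (inv\<^bsub>G\<^esub> B \<otimes>\<^bsub>G\<^esub> (inv\<^bsub>G\<^esub> A \<otimes>\<^bsub>G\<^esub> inv\<^bsub>G\<^esub> A))))"
    by (simp add: P.inv_mult_group P.m_assoc)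
  define y where "y = inv\<^bsub>G\<^esub> C \<otimes>\<^bsub>G\<^esub> inv\<^bsub>G\<^esub> B"
  define X where "X = A \<otimes>\<^bsub>G\<^esub> (B \<otimes>\<^bsub>G\<^esub> (B \<otimes>\<^bsub>G\<^esub> C))"
  define Z where "Z = y \<otimes>\<^bsub>G\<^esub> (X \<otimes>\<^bsub>G\<^esub> C)"
  define z where "z j = (if j = 0 then X else if j = 3 then Z else if j \<in> {4..n} then x j else \<one>\<^bsub>G\<^esub>)" for j
  have yXZ [simp]: "y \<in> carrier G" "X \<in> carrier G" "Z \<in> carrier G" by (simp_all add: y_def X_def Z_def)
  have zc [simp]: "z j \<in> carrier G" for j using x_closed[of j] by (auto simp: z_def)
  define cj where "cj e u = y [^]\<^bsub>G\<^esub> (e::int) \<otimes>\<^bsub>G\<^esub> u \<otimes>\<^bsub>G\<^esub> y [^]\<^bsub>G\<^esub> (- e)" for e u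
  have cj_hom: "group_hom G G (cj e)" for e
    by unfold_locales
      (auto simp: hom_def cj_def P.m_assoc P.int_pow_neg)
  have cj_c: "cj e u \<in> carrier G" if "u \<in> carrier G" for e u
    using that by (simp add: cj_def)
  define c where "c = (\<lambda>(j, e). cj e (z j))"
  interpret L: levels G n c
    by unfold_locales (auto simp: c_def n3 intro: cj_c)
  define v where "v = Z \<otimes>\<^bsub>G\<^esub> (Z \<otimes>\<^bsub>G\<^esub> V)"
  have vc: "v \<in> carrier G" using Vc by (simp add: v_def)
  have cZ: "c (3, e) = cj e Z" for e by (simp add: c_def z_def)
  have sq: "L.level_square e = cj e v" for e
  proof -
    interpret h: group_hom G G "cj e" by (rule cj_hom)
    have Vz: "word_eval G z (squares [4..<Suc n]) = V"
      unfolding V_def by (rule P.word_eval_cong[OF _ sq4]) (simp add: z_def)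
    have "word_eval G (\<lambda>j. c (j, e)) (squares [4..<Suc n]) = cj e V"
      using h.hom_word_eval[OF _ sq4, of z] unfolding Vz by (simp add: c_def)
    then show ?thesis
      unfolding L.level_square_eq using Vc by (simp add: v_def cZ)
  qed
  \<comment> \<open>The relator in the new generators: \<open>v\<close> is the commutator of
    \<open>y\<close> and \<open>X\<close>. Conjugated by the \<open>e\<close>-th power of
    \<open>y\<close>, this is the recursion for \<open>level_x\<close>.\<close>
  have rel: "y \<otimes>\<^bsub>G\<^esub> X = v \<otimes>\<^bsub>G\<^esub> (X \<otimes>\<^bsub>G\<^esub> y)"
    by (simp add: v_def Z_def V y_def X_def P.m_assoc P.inv_mult_group)
  have pow_Suc: "y [^]\<^bsub>G\<^esub> (e + 1) = y [^]\<^bsub>G\<^esub> e \<otimes>\<^bsub>G\<^esub> y" for e :: int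
    by (simp add: P.int_pow_mult)
  have pow_Suc': "y [^]\<^bsub>G\<^esub> (- e) = y \<otimes>\<^bsub>G\<^esub> y [^]\<^bsub>G\<^esub> (- (e + 1))" for e :: int
    using P.int_pow_mult[of y 1 "- (e + 1)"] by (simp add: algebra_simps)
  have lx: "L.level_x e = cj e X" for e
  proof (rule L.level_x_unique[symmetric])
    show "cj 0 X = c (0, 0)" by (simp add: c_def z_def)
    show "cj (e + 1) X = L.level_square e \<otimes>\<^bsub>G\<^esub> cj e X" for e
    proof -
      interpret h: group_hom G G "cj e" by (rule cj_hom)
      have "cj (e + 1) X = y [^]\<^bsub>G\<^esub> e \<otimes>\<^bsub>G\<^esub> ((y \<otimes>\<^bsub>G\<^esub> X) \<otimes>\<^bsub>G\<^esub> y [^]\<^bsub>G\<^esub> (- (e + 1)))"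
        unfolding cj_def pow_Suc[of e] by (simp add: P.m_assoc)
      also have "\<dots> = y [^]\<^bsub>G\<^esub> e \<otimes>\<^bsub>G\<^esub> (v \<otimes>\<^bsub>G\<^esub> (X \<otimes>\<^bsub>G\<^esub> (y \<otimes>\<^bsub>G\<^esub> y [^]\<^bsub>G\<^esub> (- (e + 1)))))"
        unfolding rel using vc by (simp add: P.m_assoc)
      also have "\<dots> = cj e (v \<otimes>\<^bsub>G\<^esub> X)"
        unfolding pow_Suc'[of e, symmetric] using vc by (simp add: cj_def P.m_assoc)
      finally show ?thesis using vc by (simp add: sq)
    qed
  qed (simp add: cj_c)
  have c3: "c (3, e - 1) = cj e (inv\<^bsub>G\<^esub> y \<otimes>\<^bsub>G\<^esub> Z \<otimes>\<^bsub>G\<^esub> y)" for e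
  proof -
    have "y [^]\<^bsub>G\<^esub> (e - 1) = y [^]\<^bsub>G\<^esub> e \<otimes>\<^bsub>G\<^esub> inv\<^bsub>G\<^esub> y"
      using pow_Suc[of "e - 1"] by (simp add: P.inv_solve_right)
    moreover have "y [^]\<^bsub>G\<^esub> (- (e - 1)) = y \<otimes>\<^bsub>G\<^esub> y [^]\<^bsub>G\<^esub> (- e)"
      using pow_Suc'[of "e - 1"] by simp
    ultimately show ?thesis by (simp add: c_def z_def cj_def P.m_assoc del: minus_diff_eq)
  qed
  have gen: "L.level_gen k e = y [^]\<^bsub>G\<^esub> e \<otimes>\<^bsub>G\<^esub> x k \<otimes>\<^bsub>G\<^esub> y [^]\<^bsub>G\<^esub> (- (e + level_shift k))"
    if k: "k \<in> {1..n}" for k e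
  proof -
    interpret h: group_hom G G "cj e" by (rule cj_hom)
    consider "k = 1" | "k = 2" | "k = 3" | "k \<ge> 4" using k by force
    then show ?thesis
    proof cases
      case 1
      have "L.level_gen k e = cj e (inv\<^bsub>G\<^esub> v \<otimes>\<^bsub>G\<^esub> Z)"
        using 1 vc by (simp add: L.level_gen_def sq cZ)
      also have "inv\<^bsub>G\<^esub> v \<otimes>\<^bsub>G\<^esub> Z = A \<otimes>\<^bsub>G\<^esub> inv\<^bsub>G\<^esub> y"
        by (simp add: v_def Z_def V y_def X_def P.m_assoc P.inv_mult_group)
      also have "cj e (A \<otimes>\<^bsub>G\<^esub> inv\<^bsub>G\<^esub> y) = y [^]\<^bsub>G\<^esub> e \<otimes>\<^bsub>G\<^esub> A \<otimes>\<^bsub>G\<^esub> y [^]\<^bsub>G\<^esub> (- (e + 1))"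
        unfolding cj_def pow_Suc'[of e] by (simp add: P.m_assoc)
      finally show ?thesis using 1 by (simp add: A_def level_shift_def)
    next
      case 2
      have "L.level_gen k e = cj e (inv\<^bsub>G\<^esub> (inv\<^bsub>G\<^esub> y \<otimes>\<^bsub>G\<^esub> Z \<otimes>\<^bsub>G\<^esub> y) \<otimes>\<^bsub>G\<^esub> X)"
        using 2 by (simp add: L.level_gen_def c3 lx)
      also have "inv\<^bsub>G\<^esub> (inv\<^bsub>G\<^esub> y \<otimes>\<^bsub>G\<^esub> Z \<otimes>\<^bsub>G\<^esub> y) \<otimes>\<^bsub>G\<^esub> X = B"
        by (simp add: Z_def y_def X_def P.m_assoc P.inv_mult_group)
      finally show ?thesis using 2 by (simp add: B_def level_shift_def cj_def)
    next
      case 3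
      have "L.level_gen k e = cj e (inv\<^bsub>G\<^esub> X \<otimes>\<^bsub>G\<^esub> (inv\<^bsub>G\<^esub> y \<otimes>\<^bsub>G\<^esub> Z \<otimes>\<^bsub>G\<^esub> y))"
        using 3 by (simp add: L.level_gen_def c3 lx)
      also have "inv\<^bsub>G\<^esub> X \<otimes>\<^bsub>G\<^esub> (inv\<^bsub>G\<^esub> y \<otimes>\<^bsub>G\<^esub> Z \<otimes>\<^bsub>G\<^esub> y) = C \<otimes>\<^bsub>G\<^esub> y"
        by (simp add: Z_def y_def X_def P.m_assoc P.inv_mult_group)
      also have "cj e (C \<otimes>\<^bsub>G\<^esub> y) = y [^]\<^bsub>G\<^esub> e \<otimes>\<^bsub>G\<^esub> C \<otimes>\<^bsub>G\<^esub> y [^]\<^bsub>G\<^esub> (- (e - 1))"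
        using pow_Suc'[of "e - 1"] by (simp add: cj_def P.m_assoc)
      finally show ?thesis using 3 by (simp add: C_def level_shift_def)
    next
      case 4
      then have "L.level_gen k e = c (k, e)" by (simp add: L.level_gen_def)
      then show ?thesis using k 4
        by (simp add: c_def z_def cj_def level_shift_def)
    qed
  qed
  have "group_hom K G (word_eval G c)"
    by (simp add: group_hom_def group_hom_axioms_def K.is_group P.is_group)
      (simp add: K_def P.word_eval_hom L.c_closed)
  then interpret psi: group_hom K G "word_eval G c" .
  have "(\<lambda>i. word_eval G c (free_gen i)) = c"
    by (rule ext) (simp add: P.word_eval_gen L.c_closed)
  then have psi_gen: "word_eval G c (K.level_gen k e) = L.level_gen k e" for k e
    using level_gen_hom[OF psi.group_hom_axioms K.levels_axioms, of k e] by simp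
  have "\<one>\<^bsub>G\<^esub> = word_eval G c (walk K K.level_gen level_shift w 0)"
    by (simp only: assms(3) psi.hom_one)
  also have "\<dots> = walk G L.level_gen level_shift w 0"
    using psi.hom_walk[of UNIV K.level_gen w] K.level_gen_closed w by (simp add: psi_gen in_lists_conv_set)
  also have "\<dots> = y [^]\<^bsub>G\<^esub> (0::int) \<otimes>\<^bsub>G\<^esub> word_eval G x w \<otimes>\<^bsub>G\<^esub> y [^]\<^bsub>G\<^esub> (- (0 + shift level_shift w))"
    by (rule P.walk_conjugate[OF _ x_closed gen w]) simp_all
  also have "\<dots> = word_eval G x w"
    using P.word_eval_closed[OF gen_closed w] by (simp add: assms(4))
  finally show ?thesis by simp
qed

theorem residually_p:
  assumes p: "prime p" and g: "g \<in> carrier G" "g \<noteq> \<one>\<^bsub>G\<^esub>"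
  shows "\<exists>M\<in>p_power_index_normal p G. g \<notin> M"
proof -
  obtain w where w: "w \<in> carrier F" "g = word_eval G x w"
    using presented_word_cases[OF g(1)] .
  have wl: "w \<in> lists ({1..n} \<times> UNIV)" using w(1) by (rule carrier_free_group_lists)
  define K where "K = free_group (UNIV :: (nat \<times> int) set)"
  interpret K: group K unfolding K_def by (rule group_free_group)
  interpret K: levels K n free_gen
    by unfold_locales (simp_all add: K_def n3 free_gen_closed)
  define t where "t = walk K K.level_gen level_shift w 0"
  have t: "t \<in> carrier K"
    unfolding t_def by (rule K.walk_closed[OF K.level_gen_closed wl])
  have nontrivial: "t \<noteq> \<one>\<^bsub>K\<^esub> \<or> shift level_shift w \<noteq> 0"
    using walk_in_surface_group[OF wl] g(2) w(2) by (auto simp: t_def K_def)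
  \<comment> \<open>If \<open>t\<close> is trivial, any \<open>N\<close> will do, since
    \<open>w\<close> is then detected by its shift.\<close>
  have "\<exists>N\<in>p_power_index_normal p K. t \<noteq> \<one>\<^bsub>K\<^esub> \<longrightarrow> t \<notin> N"
    using free_group_residually_p[OF p, of t UNIV] t K.p_power_index_normal_carrier
    by (cases "t = \<one>\<^bsub>K\<^esub>") (auto simp: K_def free_group_def)
  then obtain N where N: "N \<in> p_power_index_normal p K" "t \<noteq> \<one>\<^bsub>K\<^esub> \<Longrightarrow> t \<notin> N" by blast
  note ND = p_power_index_normalD[OF N(1)]
  define Q where "Q = K Mod N"
  interpret Q: group Q unfolding Q_def by (rule ND(2))
  obtain l where l: "order Q = p ^ l" using ND(3) by (auto simp: Q_def)
  define q where "q i = N #>\<^bsub>K\<^esub> free_gen i" for i :: "nat \<times> int"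
  have q: "q i \<in> carrier Q" for i
    by (auto simp: q_def Q_def carrier_FactGroup K_def free_gen_closed)

  define L where "L = (\<Sum>a\<leftarrow>t. nat \<bar>snd (fst a)\<bar>)"
  have L: "\<bar>snd (fst a)\<bar> \<le> int L" if "a \<in> set t" for a
    using member_le_sum_list[of "nat \<bar>snd (fst a)\<bar>" "map (\<lambda>a. nat \<bar>snd (fst a)\<bar>) t"] that
    by (auto simp: L_def)
  \<comment> \<open>A window of \<open>p ^ k\<close> levels has to contain all levels from
    \<open>- L\<close> to \<open>L\<close>, and \<open>p ^ k\<close> has to exceed the shift. As
    \<open>k < p ^ k\<close>, the required bound itself can serve as the exponent.\<close>
  define k where "k = 2 * L + nat \<bar>shift level_shift w\<bar>"
  have p1: "p > 1" using p prime_gt_1_nat by blast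
  have k: "k < p ^ k" using less_exp[of k] power_mono[of 2 p k] p1 by linarith
  define m where "m = int (p ^ k)"
  have m: "2 * int L < m" "\<bar>shift level_shift w\<bar> < m" "m > 0"
  proof -
    have "int k < m" using k by (simp add: m_def flip: of_nat_power)
    moreover have "int k = 2 * int L + \<bar>shift level_shift w\<bar>" by (simp add: k_def)
    ultimately show "2 * int L < m" "\<bar>shift level_shift w\<bar> < m" "m > 0" by linarith+
  qed
  \<comment> \<open>Levels are reduced to representatives from \<open>- L\<close> to
    \<open>m - L - 1\<close>, so the family is periodic and still agrees with \<open>q\<close> on
    the levels that occur in \<open>t\<close>.\<close>
  define q' where "q' = (\<lambda>(j, e). q (j, (e + int L) mod m - int L))"
  interpret L: levels Q n q'
    by unfold_locales (auto simp: q'_def q n3)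
  have q'_periodic: "q' (j, e + m) = q' (j, e)" for j e
    by (simp add: q'_def add.assoc add.left_commute[of m])
      (metis add.assoc add.commute mod_add_self2)
  \<comment> \<open>The factor \<open>order Q\<close> is due to \<open>level_x\<close>, whose period
    can exceed that of \<open>q'\<close>.\<close>
  define M where "M = p ^ k * order Q"
  have M: "M = p ^ (k + l)" by (simp add: M_def l power_add)
  have gen_periodic: "L.level_gen j (e mod int M) = L.level_gen j e" for j e
    using periodic_int(2)[of "L.level_gen j" "m * int (order Q)" e]
      L.level_gen_periodic[OF q'_periodic] by (simp add: M_def m_def)
  interpret wm: walk_mod Q M "{1..n}" L.level_gen level_shift
    by unfold_locales (use Q.is_group L.level_gen_closed gen_periodic p1 in \<open>simp_all add: M\<close>)

  have "word_eval wm.W wm.step relator = \<one>\<^bsub>wm.W\<^esub>"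
  proof (rule wm.wreath_eqI)
    have R: "relator \<in> lists ({1..n} \<times> UNIV)"
      using nonorientable_relator_closed by (rule carrier_free_group_lists)
    then show "word_eval wm.W wm.step relator \<in> carrier wm.W"
      by (rule wm.W.word_eval_closed[OF wm.step_closed])
    show "fst (word_eval wm.W wm.step relator) e = fst \<one>\<^bsub>wm.W\<^esub> e" if "e \<in> carrier wm.C" for e
      using wm.fst_word_eval_step[OF R, of e] L.walk_relator[of e] wm.fst_one_wreath[OF that] that p1
      by (simp add: carrier_integer_mod_group M)
    have "shift level_shift (squares l) = 2 * (\<Sum>j\<leftarrow>l. level_shift j)" for l
      by (induction l) auto
    moreover have "(\<Sum>j\<leftarrow>[4..<Suc n]. level_shift j) = 0"
    proof -
      have "map level_shift [4..<Suc n] = map (\<lambda>_. 0) [4..<Suc n]"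
        by (rule map_cong) (auto simp: level_shift_def)
      then show ?thesis by (simp only: sum_list_0)
    qed
    ultimately have "shift level_shift relator = 0"
      by (simp add: nonorientable_relator_squares[OF n3] level_shift_def del: upt_Suc)
    then show "snd (word_eval wm.W wm.step relator) = snd \<one>\<^bsub>wm.W\<^esub>"
      using wm.snd_word_eval_step[OF R] wm.snd_one_wreath by simp
  qed simp
  then have "word_eval wm.W wm.step r = \<one>\<^bsub>wm.W\<^esub>" if "r \<in> {relator}" for r
    using that by simp
  from presented_hom_exists[OF wm.W.is_group wm.step_closed this]
  obtain h where h: "h \<in> hom G wm.W"
    "\<And>w. w \<in> carrier F \<Longrightarrow> h (word_eval G x w) = word_eval wm.W wm.step w"
    by metis
  interpret h: group_hom G wm.W h
    by unfold_locales (rule h)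
  have "h g \<noteq> \<one>\<^bsub>wm.W\<^esub>"
  proof
    assume "h g = \<one>\<^bsub>wm.W\<^esub>"
    then have one: "word_eval wm.W wm.step w = \<one>\<^bsub>wm.W\<^esub>" using h(2)[OF w(1)] w(2) by simp
    then have "shift level_shift w mod int M = 0"
      using wm.snd_word_eval_step[OF wl] wm.snd_one_wreath by simp
    moreover have "m \<le> int M" using p1 by (simp add: m_def M)
    ultimately have sh: "shift level_shift w = 0"
      using m(2) zdvd_imp_le[of "int M" "\<bar>shift level_shift w\<bar>"] by auto
    have "walk Q L.level_gen level_shift w 0 = \<one>\<^bsub>Q\<^esub>"
      using wm.fst_word_eval_step[OF wl, of 0] one wm.fst_one_wreath wm.mod_closed[of 0] by simp
    moreover have "walk Q L.level_gen level_shift w 0 = word_eval Q q' t"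
    proof -
      have "group_hom K Q (word_eval Q q')"
        by (simp add: group_hom_def group_hom_axioms_def K.is_group Q.is_group)
          (simp add: K_def Q.word_eval_hom L.c_closed)
      then interpret f: group_hom K Q "word_eval Q q'" .
      have "(\<lambda>i. word_eval Q q' (free_gen i)) = q'"
        by (rule ext) (simp add: Q.word_eval_gen L.c_closed)
      then have "word_eval Q q' (K.level_gen k e) = L.level_gen k e" for k e
        using level_gen_hom[OF f.group_hom_axioms K.levels_axioms, of k e] by simp
      then show ?thesis
        using f.hom_walk[of UNIV K.level_gen w] K.level_gen_closed wl
        by (simp add: t_def in_lists_conv_set)
    qed
    moreover have "word_eval Q q' t = word_eval Q q t"
    proof (rule Q.word_eval_cong[where X = "fst ` set t"])
      fix i assume "i \<in> fst ` set t"
      then have "\<bar>snd i\<bar> \<le> int L" using L by auto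
      then have "(snd i + int L) mod m = snd i + int L"
        using m by (intro mod_pos_pos_trivial) auto
      then show "q' i = q i" by (simp add: q'_def case_prod_beta)
    qed (auto simp: in_lists_conv_set intro!: rev_image_eqI)
    moreover have "word_eval Q q t = N #>\<^bsub>K\<^esub> t"
      using word_eval_Mod[of N UNIV t] ND(1) t by (simp add: Q_def q_def[abs_def] K_def)
    ultimately have "N #>\<^bsub>K\<^esub> t = N" by (simp add: Q_def)
    then have "t \<in> N" using K.rcos_self[OF t] ND(1) normal_imp_subgroup by metis
    then show False using N(2) nontrivial sh K.one_closed subgroup.one_closed by blast
  qed
  then have "g \<notin> kernel G wm.W h" by (simp add: kernel_def)
  moreover have "order wm.C = p ^ (k + l)" using p1 by (simp add: order_def carrier_integer_mod_group M nat_power_eq)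
  then have "kernel G wm.W h \<in> p_power_index_normal p G"
    using h.kernel_p_power_index[OF p] wm.order_wreath_p_power[OF p l] by blast
  ultimately show ?thesis by blast
qed

end


section \<open>Detection by the pro-p completion\<close>

declare One_nat_def [simp del]

text \<open>By Lagrange \<open>a [^] (2 * r) = a [^] (order G + 1) = a\<close>, so raising to the
  power \<open>r\<close> inverts squaring.\<close>

lemma (in group) odd_order_square_root:
  assumes "odd (order G)" "a \<in> carrier G"
  defines "r \<equiv> (order G + 1) div 2"
  shows "(a \<otimes> a) [^] r = a" and "a [^] r \<otimes> a [^] r = a"
proof -
  have r: "r + r = Suc (order G)" using assms(1) by (auto simp: r_def elim!: oddE)
  have "a [^] r \<otimes> a [^] r = a [^] Suc (order G)"
    using assms(2) by (simp add: nat_pow_mult r del: nat_pow_Suc)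
  then show "a [^] r \<otimes> a [^] r = a" using assms(2) by (simp add: pow_order_eq_1)
  then show "(a \<otimes> a) [^] r = a" using assms(2) by (simp add: pow_mult_distrib)
qed

lemma nonorientable_relator_split:
  assumes "m \<in> {1..n}"
  shows "nonorientable_relator n = squares [1..<m] @ (m, True) # (m, True) # squares [Suc m..<Suc n]"
proof -
  have "[1..<Suc n] = [1..<m] @ [m..<Suc n]"
    using upt_add_eq_append[of 1 m "Suc n - m"] assms by simp
  also have "[m..<Suc n] = m # [Suc m..<Suc n]"
    using assms by (simp add: upt_conv_Cons)
  finally show ?thesis by (simp add: nonorientable_relator_def squares_def)
qed

context surface_group
begin

context
  fixes H :: "('b, 'm) monoid_scheme" (structure) and m :: nat
  assumes H: "group H" "odd (order H)" and m: "m \<in> {1..n}"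
begin

interpretation H: group H by (rule H)

text \<open>The relator expresses the square of the \<open>m\<close>-th value by the other values,
  and square roots are unique. So a homomorphism from \<open>G\<close> to \<open>H\<close> amounts
  to a free choice of the other values.\<close>

lemma relator_eq_one_iff:
  assumes g: "g \<in> {1..n} \<rightarrow> carrier H"
  shows "word_eval H g relator = \<one> \<longleftrightarrow>
    g m = (inv word_eval H g (squares [1..<m]) \<otimes> inv word_eval H g (squares [Suc m..<Suc n]))
      [^] ((order H + 1) div 2)"
proof -
  let ?l = "word_eval H g (squares [1..<m])" and ?r = "word_eval H g (squares [Suc m..<Suc n])"
  let ?c = "inv ?l \<otimes> inv ?r"
  note [simp del] = upt_Suc
  have l: "squares [1..<m] \<in> lists ({1..n} \<times> UNIV)"
    and r: "squares [Suc m..<Suc n] \<in> lists ({1..n} \<times> UNIV)"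
    using m by (auto intro!: squares_in_lists)
  have c [simp]: "?l \<in> carrier H" "?r \<in> carrier H" "g m \<in> carrier H"
    using H.word_eval_closed[OF g l] H.word_eval_closed[OF g r] g m by auto
  have "word_eval H g relator = ?l \<otimes> (g m \<otimes> (g m \<otimes> ?r))"
    unfolding nonorientable_relator_split[OF m]
    using H.word_eval_append[OF g l, of "(m, True) # (m, True) # squares [Suc m..<Suc n]"] r m
    by (simp add: letter_eval_def del: upt_Suc)
  also have "\<dots> = \<one> \<longleftrightarrow> g m \<otimes> g m = ?c"
  proof
    assume "?l \<otimes> (g m \<otimes> (g m \<otimes> ?r)) = \<one>"
    then have "g m \<otimes> (g m \<otimes> ?r) = inv ?l"
      using H.inv_equality[of ?l "g m \<otimes> (g m \<otimes> ?r)"] H.inv_inv[of "g m \<otimes> (g m \<otimes> ?r)"] by simp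
    then show "g m \<otimes> g m = ?c" by (simp add: H.inv_solve_right H.m_assoc)
  next
    assume "g m \<otimes> g m = ?c"
    then have "g m \<otimes> (g m \<otimes> ?r) = ?c \<otimes> ?r" by (simp flip: H.m_assoc)
    then show "?l \<otimes> (g m \<otimes> (g m \<otimes> ?r)) = \<one>" by (simp add: H.m_assoc)
  qed
  also have "\<dots> \<longleftrightarrow> g m = ?c [^] ((order H + 1) div 2)"
    using H.odd_order_square_root[OF H(2), of "g m"] H.odd_order_square_root[OF H(2), of ?c]
    by (metis c H.inv_closed H.m_closed)
  finally show ?thesis .
qed

lemma word_eval_squares_cong:
  assumes "\<And>k. k \<in> {1..n} - {m} \<Longrightarrow> g k = g' k"
  shows "word_eval H g (squares [1..<m]) = word_eval H g' (squares [1..<m])"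
    and "word_eval H g (squares [Suc m..<Suc n]) = word_eval H g' (squares [Suc m..<Suc n])"
  by (rule H.word_eval_cong[OF assms squares_in_lists]; use m in \<open>auto simp del: upt_Suc\<close>)+

lemma odd_hom_eqI:
  assumes h: "h \<in> hom G H" "h' \<in> hom G H"
    and eq: "\<And>k. k \<in> {1..n} - {m} \<Longrightarrow> h (x k) = h' (x k)" and g: "g \<in> carrier G"
  shows "h g = h' g"
proof (rule presented_hom_eqI[OF H(1) h _ g])
  have hx: "(\<lambda>k. f (x k)) \<in> {1..n} \<rightarrow> carrier H" "word_eval H (\<lambda>k. f (x k)) relator = \<one>"
    if "f \<in> hom G H" for f
  proof -
    interpret f: group_hom G H f by unfold_locales (rule that)
    show "(\<lambda>k. f (x k)) \<in> {1..n} \<rightarrow> carrier H" using x_closed by auto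
    show "word_eval H (\<lambda>k. f (x k)) relator = \<one>"
      using f.hom_word_eval[OF gen_closed carrier_free_group_lists[OF nonorientable_relator_closed]]
        relator_eq_one by simp
  qed
  have "h (x m) = h' (x m)"
    using relator_eq_one_iff[OF hx(1)[OF h(1)]] relator_eq_one_iff[OF hx(1)[OF h(2)]]
      hx(2)[OF h(1)] hx(2)[OF h(2)] word_eval_squares_cong[of "\<lambda>k. h (x k)" "\<lambda>k. h' (x k)", OF eq]
    by simp
  then show "h (x k) = h' (x k)" if "k \<in> {1..n}" for k
    using eq[of k] that by (cases "k = m") auto
qed

lemma odd_hom_exists:
  assumes a: "\<And>k. k \<in> {1..n} - {m} \<Longrightarrow> a k \<in> carrier H"
  shows "\<exists>h\<in>hom G H. \<forall>k\<in>{1..n} - {m}. h (x k) = a k"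
proof -
  define c where "c = (inv word_eval H a (squares [1..<m]) \<otimes> inv word_eval H a (squares [Suc m..<Suc n]))
      [^] ((order H + 1) div 2)"
  define g where "g = a(m := c)"
  have s: "squares [1..<m] \<in> lists (({1..n} - {m}) \<times> UNIV)"
    "squares [Suc m..<Suc n] \<in> lists (({1..n} - {m}) \<times> UNIV)"
    using m by (auto intro!: squares_in_lists)
  have a': "a \<in> {1..n} - {m} \<rightarrow> carrier H" using a by auto
  have "c \<in> carrier H"
    using H.word_eval_closed[OF a' s(1)] H.word_eval_closed[OF a' s(2)] by (simp add: c_def)
  then have g: "g \<in> {1..n} \<rightarrow> carrier H" using a by (auto simp: g_def)
  have "word_eval H g relator = \<one>"
    using relator_eq_one_iff[OF g] word_eval_squares_cong[of g a] by (simp add: g_def c_def)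
  then have "word_eval H g r = \<one>" if "r \<in> {relator}" for r using that by simp
  from presented_hom_exists[OF H(1) g this]
  obtain h where h: "h \<in> hom G H" "\<And>k. k \<in> {1..n} \<Longrightarrow> h (x k) = g k" by metis
  then have "h (x k) = a k" if "k \<in> {1..n} - {m}" for k using that by (simp add: g_def)
  then show ?thesis using h(1) by blast
qed

end

end

section \<open>The surface group inside the pro-p completion of a free group\<close>

locale surface_group_subfamily = surface_group +
  fixes p :: nat and i :: "nat \<Rightarrow> nat"
  assumes p: "prime p" "p \<ge> 3"
    and i: "i ` {1..n - 1} \<subseteq> {1..n}" "inj_on i {1..n - 1}"
begin

abbreviation J where "J \<equiv> {1..n - 1}"
abbreviation D where "D \<equiv> free_group J"
abbreviation NN where "NN \<equiv> p_power_index_normal p D"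

sublocale D: group D by (rule group_free_group)

lemma ex_missing: "\<exists>m\<in>{1..n}. i ` J = {1..n} - {m}"
proof -
  have "card ({1..n} - i ` J) = 1"
    using card_Diff_subset[OF _ i(1)] card_image[OF i(2)] n3 by simp
  then obtain m where "{1..n} - i ` J = {m}" by (rule card_1_singletonE)
  then show ?thesis using i(1) by (intro bexI[of _ m]) auto
qed

lemma odd_p_power: "odd (p ^ k)"
  using p primes_dvd_imp_eq[of 2 p] by auto

lemma i_closed: "j \<in> J \<Longrightarrow> x (i j) \<in> carrier G"
  using i(1) x_closed by blast

lemma p_hom_eqI:
  assumes "group H" "order H = p ^ k" "h \<in> hom G H" "h' \<in> hom G H"
    and eq: "\<And>j. j \<in> J \<Longrightarrow> h (x (i j)) = h' (x (i j))" and "g \<in> carrier G"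
  shows "h g = h' g"
proof -
  obtain m where m: "m \<in> {1..n}" "i ` J = {1..n} - {m}" using ex_missing by blast
  have "odd (order H)" using odd_p_power assms(2) by simp
  then show ?thesis
    using odd_hom_eqI[OF assms(1) _ m(1) assms(3,4) _ assms(6)] eq m(2) by (metis imageE)
qed

text \<open>For a homomorphism \<open>h\<close> to a finite \<open>p\<close>-group, the choice is
  unique on \<open>carrier G\<close> by \<open>p_hom_eqI\<close>.\<close>

definition lift :: "('b, 'm) monoid_scheme \<Rightarrow> (nat letter list \<Rightarrow> 'b) \<Rightarrow> nat letter list set \<Rightarrow> 'b" where
  "lift H h = (SOME l. l \<in> hom G H \<and> (\<forall>j\<in>J. l (x (i j)) = h (free_gen j)))"

lemma lift:
  assumes "group H" "order H = p ^ k" "h \<in> hom D H"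
  shows "lift H h \<in> hom G H" "\<And>j. j \<in> J \<Longrightarrow> lift H h (x (i j)) = h (free_gen j)"
proof -
  obtain m where m: "m \<in> {1..n}" "i ` J = {1..n} - {m}" using ex_missing by blast
  define a where "a k = h (free_gen (the_inv_into J i k))" for k
  have inv: "the_inv_into J i (i j) = j" if "j \<in> J" for j
    using the_inv_into_f_f[OF i(2) that] .
  have "a k \<in> carrier H" if k: "k \<in> {1..n} - {m}" for k
  proof -
    obtain j where "j \<in> J" "k = i j" using k m(2) by blast
    then show ?thesis using hom_in_carrier[OF assms(3) free_gen_closed] inv by (simp add: a_def)
  qed
  then obtain l where "l \<in> hom G H" "\<forall>k\<in>{1..n} - {m}. l (x k) = a k"
    using odd_hom_exists[OF assms(1) _ m(1), of a] odd_p_power assms(2) by auto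
  then have "l \<in> hom G H \<and> (\<forall>j\<in>J. l (x (i j)) = h (free_gen j))"
    using inv by (simp add: a_def flip: m(2))
  from someI[of "\<lambda>l. l \<in> hom G H \<and> (\<forall>j\<in>J. l (x (i j)) = h (free_gen j))", OF this]
  have *: "lift H h \<in> hom G H \<and> (\<forall>j\<in>J. lift H h (x (i j)) = h (free_gen j))"
    unfolding lift_def .
  from * show "lift H h \<in> hom G H" by blast
  from * show "lift H h (x (i j)) = h (free_gen j)" if "j \<in> J" for j using that by blast
qed

lemma lift_word_eval:
  assumes "group H" "order H = p ^ k" "h \<in> hom D H" "v \<in> carrier D"
  shows "lift H h (word_eval G (\<lambda>j. x (i j)) v) = h v"
proof -
  interpret l: group_hom G H "lift H h"
    using assms lift by (simp add: group_hom_def group_hom_axioms_def P.is_group)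
  have "(\<lambda>j. x (i j)) \<in> J \<rightarrow> carrier G" using i_closed by auto
  then have "lift H h (word_eval G (\<lambda>j. x (i j)) v) = word_eval H (\<lambda>j. lift H h (x (i j))) v"
    using carrier_free_group_lists[OF assms(4)] by (rule l.hom_word_eval)
  also have "\<dots> = h v"
    using l.H.word_eval_unique[OF assms(3) _ assms(4), of "\<lambda>j. lift H h (x (i j))"]
      lift(2)[OF assms(1-3)] by simp
  finally show ?thesis .
qed

definition quot :: "nat letter list set \<Rightarrow> nat letter list \<Rightarrow> nat letter list set" where
  "quot N v = N #>\<^bsub>D\<^esub> v"

lemma quot_hom: "N \<in> NN \<Longrightarrow> quot N \<in> hom D (D Mod N)"
  unfolding quot_def[abs_def] by (rule normal.r_coset_hom_Mod[OF p_power_index_normalD(1)])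

lemma quot_cases:
  assumes "z \<in> carrier (D Mod N)"
  obtains v where "v \<in> carrier D" "z = quot N v"
  using assms by (auto simp: carrier_FactGroup quot_def)

text \<open>The maps \<open>lift_quot N\<close> are the components of the homomorphism from the surface group to the
  pro-\<open>p\<close> completion of \<open>D\<close> that maps each \<open>x (i j)\<close> to the generator \<open>j\<close>.\<close>

definition lift_quot :: "nat letter list set \<Rightarrow> nat letter list set \<Rightarrow> nat letter list set" where
  "lift_quot N = lift (D Mod N) (quot N)"

lemma lift_quot_hom: "N \<in> NN \<Longrightarrow> lift_quot N \<in> hom G (D Mod N)"
  using lift(1) p_power_index_normalD[of N p D] quot_hom unfolding lift_quot_def by blast

lemma lift_quot_gen: "N \<in> NN \<Longrightarrow> j \<in> J \<Longrightarrow> lift_quot N (x (i j)) = quot N (free_gen j)"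
  using lift(2) p_power_index_normalD[of N p D] quot_hom unfolding lift_quot_def by blast

lemma hom_lift_quot:
  assumes N: "N \<in> NN" and H: "group H" "order H = p ^ k"
    and q: "q \<in> hom (D Mod N) H" and h: "h \<in> hom G H"
    and eq: "\<And>j. j \<in> J \<Longrightarrow> q (quot N (free_gen j)) = h (x (i j))" and g: "g \<in> carrier G"
  shows "q (lift_quot N g) = h g"
proof -
  have "q \<circ> lift_quot N \<in> hom G H"
    using hom_compose[OF lift_quot_hom[OF N] q] .
  from p_hom_eqI[OF H this h _ g] show ?thesis
    using eq lift_quot_gen[OF N] by simp
qed

lemma quot_factor:
  assumes N: "N \<in> NN" and H: "group H" and h: "h \<in> hom D H" and sub: "N \<subseteq> kernel D H h"
  obtains q where "q \<in> hom (D Mod N) H" "\<And>v. v \<in> carrier D \<Longrightarrow> q (quot N v) = h v"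
proof -
  interpret h: group_hom D H h using H h by (simp add: group_hom_def group_hom_axioms_def D.is_group)
  show thesis
    using h.FactGroup_universal_kernel[OF p_power_index_normalD(1)[OF N] sub] that
    by (auto simp: quot_def)
qed

lemma kernel_quot: "N \<in> NN \<Longrightarrow> kernel D (D Mod N) (quot N) = N"
  using D.r_coset_eq_self_iff[of N] normal_imp_subgroup[OF p_power_index_normalD(1)[of N p D]]
    subgroup.subset[of N D]
  by (auto simp: kernel_def quot_def)

text \<open>Compatibility with the transition maps, which places \<open>embed\<close> in the inverse
  limit.\<close>

lemma projection:
  assumes "N \<in> NN" "M \<in> NN" "N \<subseteq> M"
  shows "\<exists>q\<in>hom (D Mod N) (D Mod M).
    (\<forall>v\<in>carrier D. q (quot N v) = quot M v) \<and> (\<forall>g\<in>carrier G. q (lift_quot N g) = lift_quot M g)"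
proof -
  note M = p_power_index_normalD[OF assms(2)]
  obtain k where k: "order (D Mod M) = p ^ k" using M(3) by blast
  obtain q where q: "q \<in> hom (D Mod N) (D Mod M)" "\<And>v. v \<in> carrier D \<Longrightarrow> q (quot N v) = quot M v"
    using quot_factor[OF assms(1) M(2) quot_hom[OF assms(2)]] kernel_quot[OF assms(2)] assms(3) by metis
  have "q (lift_quot N g) = lift_quot M g" if "g \<in> carrier G" for g
    by (rule hom_lift_quot[OF assms(1) M(2) k q(1) lift_quot_hom[OF assms(2)] _ that])
      (simp add: q(2) lift_quot_gen[OF assms(2)] free_gen_closed)
  with q show ?thesis by blast
qed

lemma pro_p_carrier_iff:
  "f \<in> carrier (pro_p_completion p D) \<longleftrightarrow>
    f \<in> (\<Pi>\<^sub>E N\<in>NN. carrier (D Mod N)) \<and>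
    (\<forall>N\<in>NN. \<forall>M\<in>NN. N \<subseteq> M \<longrightarrow> (\<forall>v\<in>carrier D. f N = quot N v \<longrightarrow> f M = quot M v))"
  by (simp add: pro_p_completion_def quot_def)

lemma pro_p_mult:
  "N \<in> NN \<Longrightarrow> (f \<otimes>\<^bsub>pro_p_completion p D\<^esub> f') N = f N \<otimes>\<^bsub>D Mod N\<^esub> f' N"
  by (simp add: pro_p_completion_def)

lemma pro_p_cases:
  assumes "f \<in> carrier (pro_p_completion p D)" "N \<in> NN"
  obtains v where "v \<in> carrier D" "f N = quot N v"
proof -
  have "f \<in> (\<Pi>\<^sub>E N\<in>NN. carrier (D Mod N))" using assms(1) unfolding pro_p_carrier_iff by blast
  then have "f N \<in> carrier (D Mod N)" using assms(2) by (rule PiE_mem)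
  then show thesis using that by (rule quot_cases)
qed

definition embed :: "nat letter list set \<Rightarrow> nat letter list set \<Rightarrow> nat letter list set" where
  "embed g = (\<lambda>N\<in>NN. lift_quot N g)"

lemma embed_closed:
  assumes g: "g \<in> carrier G"
  shows "embed g \<in> carrier (pro_p_completion p D)"
  unfolding pro_p_carrier_iff
proof (intro conjI ballI impI)
  have "lift_quot N g \<in> carrier (D Mod N)" if "N \<in> NN" for N
    using hom_in_carrier[OF lift_quot_hom[OF that] g] .
  then show "embed g \<in> (\<Pi>\<^sub>E N\<in>NN. carrier (D Mod N))" by (simp add: embed_def)
  fix N M v assume N: "N \<in> NN" and M: "M \<in> NN" and NM: "N \<subseteq> M" and v: "v \<in> carrier D" "embed g N = quot N v"
  obtain q where q: "\<forall>v\<in>carrier D. q (quot N v) = quot M v"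
    "\<forall>g\<in>carrier G. q (lift_quot N g) = lift_quot M g"
    using projection[OF N M NM] by blast
  have "lift_quot N g = quot N v" using N v by (simp add: embed_def)
  then have "lift_quot M g = quot M v" using q v(1) g by metis
  then show "embed g M = quot M v" using M by (simp add: embed_def)
qed

lemma embed_word_eval:
  assumes "v \<in> carrier D"
  shows "embed (word_eval G (\<lambda>j. x (i j)) v) = pro_p_map p D v"
proof -
  have "lift_quot N (word_eval G (\<lambda>j. x (i j)) v) = quot N v" if "N \<in> NN" for N
    using lift_word_eval[OF _ _ quot_hom[OF that] assms] p_power_index_normalD[OF that]
    by (auto simp: lift_quot_def)
  then show ?thesis
    unfolding embed_def pro_p_map_def quot_def by (rule restrict_ext)
qed

text \<open>A quotient \<open>G Mod M\<close> that detects \<open>g\<close> is pulled back to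
  \<open>D\<close> along the chosen generators. The kernel \<open>?K\<close> of this map indexes a
  coordinate of the completion, and by uniqueness \<open>q\<close> after \<open>lift_quot ?K\<close>
  is the projection to \<open>G Mod M\<close>; so this coordinate already detects
  \<open>g\<close>.\<close>

lemma embed_eq_imp_one:
  assumes g: "g \<in> carrier G" and eq: "embed g = embed \<one>\<^bsub>G\<^esub>"
  shows "g = \<one>\<^bsub>G\<^esub>"
proof (rule ccontr)
  assume "g \<noteq> \<one>\<^bsub>G\<^esub>"
  then obtain M where M: "M \<in> p_power_index_normal p G" "g \<notin> M"
    using residually_p[OF p(1) g] by blast
  note MD = p_power_index_normalD[OF M(1)]
  interpret M: normal M G by (rule MD)
  interpret H: group "G Mod M" by (rule MD)
  obtain k where k: "order (G Mod M) = p ^ k" using MD(3) by blast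
  define h where "h = word_eval (G Mod M) (\<lambda>j. M #>\<^bsub>G\<^esub> x (i j))"
  have c: "(\<lambda>j. M #>\<^bsub>G\<^esub> x (i j)) \<in> J \<rightarrow> carrier (G Mod M)"
    using i_closed by (auto simp: carrier_FactGroup)
  have h: "h \<in> hom D (G Mod M)" unfolding h_def by (rule H.word_eval_hom[OF c])
  interpret h: group_hom D "G Mod M" h by unfold_locales (rule h)
  let ?K = "kernel D (G Mod M) h"
  have K: "?K \<in> NN" by (rule h.kernel_p_power_index[OF p(1) k])
  from quot_factor[OF K MD(2) h subset_refl]
  obtain q where q: "q \<in> hom (D Mod ?K) (G Mod M)" "\<And>v. v \<in> carrier D \<Longrightarrow> q (quot ?K v) = h v"
    by metis
  have "q (lift_quot ?K g) = M #>\<^bsub>G\<^esub> g" if "g \<in> carrier G" for g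
  proof (rule hom_lift_quot[OF K MD(2) k q(1) M.r_coset_hom_Mod _ that])
    show "q (quot ?K (free_gen j)) = M #>\<^bsub>G\<^esub> x (i j)" if "j \<in> J" for j
      using q(2)[OF free_gen_closed[OF that]] H.word_eval_gen[of "\<lambda>j. M #>\<^bsub>G\<^esub> x (i j)" j, OF funcset_mem[OF c that]]
      by (simp add: h_def)
  qed
  moreover have "lift_quot ?K g = lift_quot ?K \<one>\<^bsub>G\<^esub>"
    using fun_cong[OF eq, of ?K] K by (simp add: embed_def)
  ultimately have "M #>\<^bsub>G\<^esub> g = M #>\<^bsub>G\<^esub> \<one>\<^bsub>G\<^esub>"
    using g P.one_closed by metis
  then show False
    using M(2) P.rcos_self[OF g M.subgroup_axioms] P.coset_mult_one[OF M.subset] by simp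
qed

section \<open>Extension of an endomorphism to the pro-p completion\<close>

context
  fixes phi :: "nat letter list set \<Rightarrow> nat letter list set"
  assumes phi: "phi \<in> hom G G"
begin

definition comp_hom where
  "comp_hom N = word_eval (D Mod N) (\<lambda>j. lift_quot N (phi (x (i j))))"

abbreviation comp_ker where "comp_ker N \<equiv> kernel D (D Mod N) (comp_hom N)"

lemma comp_hom:
  assumes N: "N \<in> NN"
  shows "comp_hom N \<in> hom D (D Mod N)" "comp_ker N \<in> NN"
    "\<And>j. j \<in> J \<Longrightarrow> comp_hom N (free_gen j) = lift_quot N (phi (x (i j)))"
proof -
  note ND = p_power_index_normalD[OF N]
  interpret H: group "D Mod N" by (rule ND)
  have c: "(\<lambda>j. lift_quot N (phi (x (i j)))) \<in> J \<rightarrow> carrier (D Mod N)"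
    using hom_in_carrier[OF lift_quot_hom[OF N] hom_in_carrier[OF phi i_closed]] by auto
  show h: "comp_hom N \<in> hom D (D Mod N)"
    unfolding comp_hom_def by (rule H.word_eval_hom[OF c])
  interpret h: group_hom D "D Mod N" "comp_hom N" by unfold_locales (rule h)
  show "comp_ker N \<in> NN" using h.kernel_p_power_index[OF p(1)] ND(3) by blast
  show "comp_hom N (free_gen j) = lift_quot N (phi (x (i j)))" if "j \<in> J" for j
    unfolding comp_hom_def by (rule H.word_eval_gen) (use c that in auto)
qed

lemma comp_factor:
  assumes N: "N \<in> NN"
  shows "\<exists>q\<in>hom (D Mod comp_ker N) (D Mod N). \<forall>v\<in>carrier D. q (quot (comp_ker N) v) = comp_hom N v"
  using quot_factor[OF comp_hom(2)[OF N] p_power_index_normalD(2)[OF N] comp_hom(1)[OF N] subset_refl]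
  by metis

text \<open>Coordinate \<open>N\<close> of the value depends only on coordinate
  \<open>comp_ker N\<close> of the argument. Hence the chosen representative does not matter, and
  the map is continuous.\<close>

definition comp_end where
  "comp_end f = (\<lambda>N\<in>NN. comp_hom N (SOME v. v \<in> carrier D \<and> f (comp_ker N) = quot (comp_ker N) v))"

lemma comp_end_eq:
  assumes N: "N \<in> NN" and v: "v \<in> carrier D" "f (comp_ker N) = quot (comp_ker N) v"
  shows "comp_end f N = comp_hom N v"
proof -
  define u where "u = (SOME v. v \<in> carrier D \<and> f (comp_ker N) = quot (comp_ker N) v)"
  have u: "u \<in> carrier D" "f (comp_ker N) = quot (comp_ker N) u"
    using someI[of "\<lambda>v. v \<in> carrier D \<and> f (comp_ker N) = quot (comp_ker N) v" v] v
    by (simp_all add: u_def)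
  obtain q where q: "\<forall>v\<in>carrier D. q (quot (comp_ker N) v) = comp_hom N v"
    using comp_factor[OF N] by blast
  have "comp_hom N u = q (f (comp_ker N))" using q u(1) by (simp add: u(2))
  also have "\<dots> = comp_hom N v" using q v(1) by (simp add: v(2))
  finally show ?thesis using N by (simp add: comp_end_def u_def)
qed

lemma comp_end_closed:
  assumes f: "f \<in> carrier (pro_p_completion p D)"
  shows "comp_end f \<in> carrier (pro_p_completion p D)"
  unfolding pro_p_carrier_iff
proof (intro conjI ballI impI)
  have "comp_end f N \<in> carrier (D Mod N)" if N: "N \<in> NN" for N
  proof -
    obtain v where v: "v \<in> carrier D" "f (comp_ker N) = quot (comp_ker N) v"
      using pro_p_cases[OF f comp_hom(2)[OF N]] .
    then show ?thesis
      using comp_end_eq[of N v f, OF N v] hom_in_carrier[OF comp_hom(1)[OF N] v(1)] by simp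
  qed
  then show "comp_end f \<in> (\<Pi>\<^sub>E N\<in>NN. carrier (D Mod N))" by (auto simp: comp_end_def)
  fix N M u assume N: "N \<in> NN" and M: "M \<in> NN" and NM: "N \<subseteq> M" and u: "u \<in> carrier D" "comp_end f N = quot N u"
  obtain q where q: "q \<in> hom (D Mod N) (D Mod M)"
    "\<forall>v\<in>carrier D. q (quot N v) = quot M v"
    "\<forall>g\<in>carrier G. q (lift_quot N g) = lift_quot M g"
    using projection[OF N M NM] by blast
  have qh: "q (comp_hom N v) = comp_hom M v" if "v \<in> carrier D" for v
  proof -
    have "(q \<circ> comp_hom N) v = comp_hom M v"
      by (rule group.free_group_hom_eqI[OF p_power_index_normalD(2)[OF M]
            hom_compose[OF comp_hom(1)[OF N] q(1)] comp_hom(1)[OF M] _ that])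
        (simp add: comp_hom(3) N M q(3) hom_in_carrier[OF phi i_closed])
    then show ?thesis by simp
  qed
  interpret q: group_hom "D Mod N" "D Mod M" q
    using q(1) p_power_index_normalD[OF N] p_power_index_normalD[OF M]
    by (simp add: group_hom_def group_hom_axioms_def)
  have "comp_ker N \<subseteq> comp_ker M"
  proof
    fix v assume "v \<in> comp_ker N"
    then have v: "v \<in> carrier D" "comp_hom N v = \<one>\<^bsub>D Mod N\<^esub>"
      unfolding kernel_def by blast+
    then have "comp_hom M v = \<one>\<^bsub>D Mod M\<^esub>" using qh[of v] q.hom_one by metis
    with v(1) show "v \<in> comp_ker M" unfolding kernel_def by blast
  qed
  moreover obtain v where v: "v \<in> carrier D" "f (comp_ker N) = quot (comp_ker N) v"
    using pro_p_cases[OF f comp_hom(2)[OF N]] .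
  ultimately have "f (comp_ker M) = quot (comp_ker M) v"
    using f comp_hom(2)[OF N] comp_hom(2)[OF M] unfolding pro_p_carrier_iff by blast
  then have "comp_end f M = q (comp_end f N)"
    using comp_end_eq[of N v f, OF N v] comp_end_eq[of M v f, OF M v(1)] qh[OF v(1)] by simp
  then show "comp_end f M = quot M u" using u q(2) by simp
qed

lemma comp_end_hom: "comp_end \<in> hom (pro_p_completion p D) (pro_p_completion p D)"
proof (rule homI)
  fix f f' assume f: "f \<in> carrier (pro_p_completion p D)" "f' \<in> carrier (pro_p_completion p D)"
  show "comp_end (f \<otimes>\<^bsub>pro_p_completion p D\<^esub> f') = comp_end f \<otimes>\<^bsub>pro_p_completion p D\<^esub> comp_end f'"
  proof (rule extensionalityI[of _ NN])
    fix N assume N: "N \<in> NN"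
    note K = comp_hom(2)[OF N]
    obtain v v' where v: "v \<in> carrier D" "f (comp_ker N) = quot (comp_ker N) v"
      "v' \<in> carrier D" "f' (comp_ker N) = quot (comp_ker N) v'"
      using pro_p_cases[OF f(1) K] pro_p_cases[OF f(2) K] by metis
    have ff': "(f \<otimes>\<^bsub>pro_p_completion p D\<^esub> f') (comp_ker N) = quot (comp_ker N) (v \<otimes>\<^bsub>D\<^esub> v')"
      using pro_p_mult[OF K] v hom_mult[OF quot_hom[OF K] v(1,3)] by simp
    then show "comp_end (f \<otimes>\<^bsub>pro_p_completion p D\<^esub> f') N = (comp_end f \<otimes>\<^bsub>pro_p_completion p D\<^esub> comp_end f') N"
      using comp_end_eq[of N "v \<otimes>\<^bsub>D\<^esub> v'" "f \<otimes>\<^bsub>pro_p_completion p D\<^esub> f'", OF N _ ff']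
        v pro_p_mult[OF N] comp_end_eq[of N v f, OF N v(1,2)] comp_end_eq[of N v' f', OF N v(3,4)] hom_mult[OF comp_hom(1)[OF N] v(1,3)]
      by simp
  qed (auto simp: comp_end_def pro_p_completion_def)
qed (rule comp_end_closed)

lemma comp_end_continuous:
  "continuous_map (pro_p_topology p D) (pro_p_topology p D) comp_end"
proof -
  let ?T = "pro_p_topology p D"
  let ?X = "\<lambda>N. discrete_topology (carrier (D Mod N))"
  have coord: "continuous_map ?T (?X N) (\<lambda>f. comp_end f N)" if N: "N \<in> NN" for N
  proof -
    note K = comp_hom(2)[OF N]
    obtain q where q: "q \<in> hom (D Mod comp_ker N) (D Mod N)"
      "\<forall>v\<in>carrier D. q (quot (comp_ker N) v) = comp_hom N v"
      using comp_factor[OF N] by blast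
    have "continuous_map ?T (?X (comp_ker N)) (\<lambda>f. f (comp_ker N))"
      unfolding pro_p_topology_def
      by (intro continuous_map_from_subtopology continuous_map_product_projection K)
    moreover have "continuous_map (?X (comp_ker N)) (?X N) q"
      using q(1) by (auto simp: hom_def)
    ultimately have "continuous_map ?T (?X N) (q \<circ> (\<lambda>f. f (comp_ker N)))"
      by (rule continuous_map_compose)
    moreover have "comp_end f N = (q \<circ> (\<lambda>f. f (comp_ker N))) f" if "f \<in> topspace ?T" for f
    proof -
      have "f \<in> carrier (pro_p_completion p D)" using that by (simp add: topspace_pro_p_topology)
      then obtain v where v: "v \<in> carrier D" "f (comp_ker N) = quot (comp_ker N) v"
        using K by (rule pro_p_cases)
      then show ?thesis using comp_end_eq[of N v f, OF N v] q(2) by simp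
    qed
    ultimately show ?thesis by (metis (no_types, lifting) continuous_map_eq)
  qed
  have "continuous_map ?T (product_topology ?X NN) comp_end"
    unfolding continuous_map_componentwise using coord by (auto simp: comp_end_def)
  then show ?thesis
    using comp_end_closed
    by (subst (2) pro_p_topology_def)
      (auto simp: continuous_map_in_subtopology topspace_pro_p_topology)
qed

text \<open>At each \<open>N\<close> both sides are homomorphisms from \<open>G\<close> to a finite
  \<open>p\<close>-group, so by \<open>hom_lift_quot\<close> they need to be compared only at the
  chosen generators, where \<open>comp_hom\<close> is prescribed.\<close>

lemma comp_end_embed:
  assumes g: "g \<in> carrier G"
  shows "comp_end (embed g) = embed (phi g)"
proof (rule extensionalityI[of _ NN])
  fix N assume N: "N \<in> NN"
  note K = comp_hom(2)[OF N] and ND = p_power_index_normalD[OF N]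
  obtain k where k: "order (D Mod N) = p ^ k" using ND(3) by blast
  obtain q where q: "q \<in> hom (D Mod comp_ker N) (D Mod N)"
    "\<forall>v\<in>carrier D. q (quot (comp_ker N) v) = comp_hom N v"
    using comp_factor[OF N] by blast
  obtain v where v: "v \<in> carrier D" "embed g (comp_ker N) = quot (comp_ker N) v"
    using pro_p_cases[OF embed_closed[OF g] K] .
  have "q (lift_quot (comp_ker N) g) = (lift_quot N \<circ> phi) g"
    by (rule hom_lift_quot[OF K ND(2) k q(1) hom_compose[OF phi lift_quot_hom[OF N]] _ g])
      (simp add: q(2) comp_hom(3)[OF N] free_gen_closed)
  then show "comp_end (embed g) N = embed (phi g) N"
    using comp_end_eq[of N v "embed g", OF N v] v q(2) N K by (simp add: embed_def)
qed (auto simp: comp_end_def embed_def)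

end

lemma injective_if_test_element:
  assumes w: "w \<in> carrier D"
    and test: "topological_test_element (pro_p_completion p D) (pro_p_topology p D) (pro_p_map p D w)"
    and phi: "phi \<in> hom G G"
    and fix_t: "phi (word_eval G (\<lambda>j. x (i j)) w) = word_eval G (\<lambda>j. x (i j)) w"
    and g: "g \<in> carrier G" "phi g = \<one>\<^bsub>G\<^esub>"
  shows "g = \<one>\<^bsub>G\<^esub>"
proof -
  interpret phi: group_hom G G phi by unfold_locales (rule phi)
  have t: "word_eval G (\<lambda>j. x (i j)) w \<in> carrier G"
    by (rule P.word_eval_closed[OF _ carrier_free_group_lists[OF w]]) (use i_closed in auto)
  have "comp_end phi (pro_p_map p D w) = pro_p_map p D w"
    using comp_end_embed[OF phi t] fix_t embed_word_eval[OF w] by simp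
  then have "comp_end phi \<in> iso (pro_p_completion p D) (pro_p_completion p D)"
    using test comp_end_hom[OF phi] comp_end_continuous[OF phi]
    by (auto simp: topological_test_element_def)
  then have "inj_on (comp_end phi) (carrier (pro_p_completion p D))"
    by (auto simp: iso_def bij_betw_def)
  moreover have "comp_end phi (embed g) = comp_end phi (embed \<one>\<^bsub>G\<^esub>)"
    using comp_end_embed[OF phi g(1)] comp_end_embed[OF phi P.one_closed] g(2) by simp
  ultimately have "embed g = embed \<one>\<^bsub>G\<^esub>"
    using embed_closed g(1) P.one_closed by (auto dest: inj_onD)
  then show ?thesis by (rule embed_eq_imp_one[OF g(1)])
qed

end


section \<open>Injective endomorphisms of surface groups are surjective\<close>

lemma (in group) word_eval_in_subgroup:
  assumes "subgroup T G" "\<And>k. k \<in> Y \<Longrightarrow> g k \<in> T" "w \<in> lists (Y \<times> UNIV)"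
  shows "word_eval G g w \<in> T"
  using assms(3)
proof (induction w rule: list.induct)
  case Nil
  then show ?case using subgroup.one_closed[OF assms(1)] by simp
next
  case (Cons l w)
  then have "letter_eval G g l \<in> T"
    using assms(2) subgroup.m_inv_closed[OF assms(1)] by (auto simp: letter_eval_def)
  then show ?case using Cons subgroup.m_closed[OF assms(1)] by simp
qed

section \<open>Labelled paths in the coset graph\<close>

context surface_group
begin

abbreviation val :: "nat letter list \<Rightarrow> nat letter list set" where
  "val \<equiv> word_eval G x"

abbreviation act :: "nat letter list set set \<Rightarrow> nat letter list set \<Rightarrow> nat letter list set set" (infixl "\<cdot>" 70) where
  "s \<cdot> g \<equiv> s #>\<^bsub>G\<^esub> g"

text \<open>\<open>E s k\<close> is the label of the edge from \<open>s\<close> to \<open>s \<cdot> x k\<close> in the coset graph.\<close>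

fun path_sum :: "(nat letter list set set \<Rightarrow> nat \<Rightarrow> int) \<Rightarrow> nat letter list \<Rightarrow> nat letter list set set \<Rightarrow> int" where
  "path_sum E [] s = 0"
| "path_sum E ((k, r) # w) s =
    (if r then E s k + path_sum E w (s \<cdot> x k)
     else - E (s \<cdot> inv\<^bsub>G\<^esub> x k) k + path_sum E w (s \<cdot> inv\<^bsub>G\<^esub> x k))"

lemma val_hom: "val \<in> hom F G"
  by (rule P.word_eval_hom[OF gen_closed])

sublocale val: group_hom F G val
  by unfold_locales (rule val_hom)

lemma val_closed: "w \<in> lists ({1..n} \<times> UNIV) \<Longrightarrow> val w \<in> carrier G"
  by (rule P.word_eval_closed[OF gen_closed])

lemma act_act:
  "s \<subseteq> carrier G \<Longrightarrow> g \<in> carrier G \<Longrightarrow> h \<in> carrier G \<Longrightarrow> s \<cdot> g \<cdot> h = s \<cdot> (g \<otimes>\<^bsub>G\<^esub> h)"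
  by (rule P.coset_mult_assoc)

lemma act_one: "s \<subseteq> carrier G \<Longrightarrow> s \<cdot> \<one>\<^bsub>G\<^esub> = s"
  by (rule P.coset_mult_one)

lemma act_closed: "s \<subseteq> carrier G \<Longrightarrow> g \<in> carrier G \<Longrightarrow> s \<cdot> g \<subseteq> carrier G"
  by (rule P.r_coset_subset_G)

lemma path_sum_cancel_Cons:
  assumes "w \<in> lists ({1..n} \<times> UNIV)" "a \<in> {1..n} \<times> UNIV" "s \<subseteq> carrier G"
  shows "path_sum E (cancel_Cons a w) s = path_sum E (a # w) s"
proof (cases w)
  case (Cons b v)
  obtain k r where a: "a = (k, r)" by force
  have "x k \<in> carrier G" using x_closed assms(2) a by auto
  then show ?thesis
    using Cons a assms(3) by (cases r) (auto simp: inv_letter_def act_act act_one)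
qed simp

lemma path_sum_foldr_cancel_Cons:
  assumes "u \<in> lists ({1..n} \<times> UNIV)" "v \<in> lists ({1..n} \<times> UNIV)" "s \<subseteq> carrier G"
  shows "path_sum E (foldr cancel_Cons u v) s = path_sum E u s + path_sum E v (s \<cdot> val u)"
  using assms(1,3)
proof (induction u arbitrary: s rule: list.induct)
  case Nil
  then show ?case by (simp add: act_one)
next
  case (Cons a u)
  obtain k r where a: "a = (k, r)" by force
  have u: "u \<in> lists ({1..n} \<times> UNIV)" and xk: "x k \<in> carrier G" and aX: "a \<in> {1..n} \<times> UNIV"
    using Cons.prems(1) x_closed a by auto
  have "path_sum E (foldr cancel_Cons (a # u) v) s = path_sum E (a # foldr cancel_Cons u v) s"
    using path_sum_cancel_Cons[OF foldr_cancel_Cons_closed[OF u assms(2)] aX Cons.prems(2)] by simp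
  then show ?case
    using Cons.IH[OF u] Cons.prems(2) xk val_closed[OF u]
    by (cases r) (simp_all add: a act_act act_closed letter_eval_def)
qed

lemma path_sum_mult:
  assumes "u \<in> carrier F" "v \<in> carrier F" "s \<subseteq> carrier G"
  shows "path_sum E (u \<otimes>\<^bsub>F\<^esub> v) s = path_sum E u s + path_sum E v (s \<cdot> val u)"
  using path_sum_foldr_cancel_Cons[of u v s E] carrier_free_group_lists assms
  by (simp add: free_group_def)

lemma path_sum_one: "path_sum E \<one>\<^bsub>F\<^esub> s = 0"
  by (simp add: free_group_def)

lemma path_sum_inv:
  assumes "u \<in> carrier F" "s \<subseteq> carrier G"
  shows "path_sum E (inv\<^bsub>F\<^esub> u) s = - path_sum E u (s \<cdot> inv\<^bsub>G\<^esub> val u)"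
  using path_sum_mult[of "inv\<^bsub>F\<^esub> u" u s E] assms path_sum_one by simp

lemma path_sum_append:
  assumes "u \<in> lists ({1..n} \<times> UNIV)" "s \<subseteq> carrier G"
  shows "path_sum E (u @ v) s = path_sum E u s + path_sum E v (s \<cdot> val u)"
  using assms
proof (induction u arbitrary: s rule: list.induct)
  case Nil
  then show ?case by (simp add: act_one)
next
  case (Cons a u)
  obtain k r where a: "a = (k, r)" by force
  have u: "u \<in> lists ({1..n} \<times> UNIV)" and xk: "x k \<in> carrier G"
    using Cons.prems(1) x_closed a by auto
  then show ?case
    using Cons.IH[OF u] Cons.prems(2) val_closed[OF u]
    by (cases r) (simp_all add: a act_act act_closed letter_eval_def)
qed

lemma path_sum_diff: "path_sum (\<lambda>s k. E s k - E' s k) w s = path_sum E w s - path_sum E' w s"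
  by (induction E w s rule: path_sum.induct) auto

lemma path_sum_not_in:
  assumes "\<forall>l\<in>set w. fst l \<noteq> j"
  shows "path_sum (\<lambda>s k. if s = a \<and> k = j then 1 else 0) w s = 0"
  using assms
  by (induction "\<lambda>s k. if s = a \<and> k = j then 1 else 0 :: int" w s rule: path_sum.induct) auto

text \<open>The relator contains the letter \<open>j\<close> just twice, once after
  \<open>squares [1..<j]\<close> and once after a further \<open>x j\<close>. Each edge is thus met
  twice by the relator cells, as in a closed surface.\<close>

lemma path_sum_edge_relator:
  assumes j: "j \<in> {1..n}" and s: "s \<subseteq> carrier G"
  shows "path_sum (\<lambda>s k. if s = a \<and> k = j then 1 else 0) relator s
    = (if s \<cdot> val (squares [1..<j]) = a then 1 else 0)
      + (if s \<cdot> val (squares [1..<j]) \<cdot> x j = a then 1 else 0)"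
proof -
  let ?E = "\<lambda>s k. if s = a \<and> k = j then 1 else 0 :: int"
  have l: "squares [1..<j] \<in> lists ({1..n} \<times> UNIV)"
    using j by (intro squares_in_lists) auto
  have "fst l \<in> set ks" if "l \<in> set (squares ks)" for l ks
    using that by (auto simp: squares_def)
  then have "path_sum ?E (squares [1..<j]) t = 0" "path_sum ?E (squares [Suc j..<Suc n]) t = 0" for t
    by (intro path_sum_not_in; fastforce)+
  then show ?thesis
    unfolding nonorientable_relator_split[OF j]
    using path_sum_append[OF l s] by simp
qed

end

section \<open>Endomorphisms and the cosets of the image\<close>

locale surface_group_endomorphism = surface_group +
  fixes phi :: "nat letter list set \<Rightarrow> nat letter list set"
  assumes phi_hom: "phi \<in> hom G G"
begin

sublocale phi: group_hom G G phi
  by unfold_locales (rule phi_hom)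

abbreviation H where "H \<equiv> phi ` carrier G"
abbreviation X where "X \<equiv> rcosets\<^bsub>G\<^esub> H"

sublocale H: subgroup H G by (rule phi.img_is_subgroup)

lemma H_in_X: "H \<in> X"
  by (rule H.subgroup_in_rcosets[OF P.is_group])

lemma X_subset: "s \<in> X \<Longrightarrow> s \<subseteq> carrier G"
  using H.subset P.r_coset_subset_G by (auto simp: RCOSETS_def)

lemma act_X: "s \<in> X \<Longrightarrow> g \<in> carrier G \<Longrightarrow> s \<cdot> g \<in> X"
  using act_act[OF H.subset] by (auto simp: RCOSETS_def)

lemma X_cases:
  assumes "s \<in> X"
  obtains g where "g \<in> carrier G" "s = H \<cdot> g"
  using assms by (auto simp: RCOSETS_def)

lemma H_act: "h \<in> H \<Longrightarrow> H \<cdot> h = H"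
  using P.r_coset_eq_self_iff[OF H.subgroup_axioms] H.subset by blast

text \<open>The loop of \<open>w\<close> at \<open>s\<close> bounds a combination of relator cells,
  listed in \<open>ds\<close> with coefficients; that \<open>ds\<close> is independent of
  \<open>E\<close> makes this an identity of chains. The words with this property form a normal
  subgroup containing the relator. Conjugation moves the base point, so all \<open>s\<close> are
  treated at once.\<close>

lemma path_sum_normal_closure:
  assumes w: "w \<in> NC" and s: "s \<in> X"
  shows "\<exists>ds. set ds \<subseteq> X \<times> UNIV \<and>
    (\<forall>E. path_sum E w s = (\<Sum>(t, c)\<leftarrow>ds. c * path_sum E relator t))"
proof -
  let ?P = "\<lambda>w s ds. set ds \<subseteq> X \<times> UNIV \<and>
    (\<forall>E. path_sum E w s = (\<Sum>(t, c)\<leftarrow>ds. c * path_sum E relator t))"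
  define M where "M = {w \<in> carrier F. val w = \<one>\<^bsub>G\<^esub> \<and> (\<forall>s\<in>X. \<exists>ds. ?P w s ds)}"
  have P_mult: "?P (u \<otimes>\<^bsub>F\<^esub> v) s (ds @ ds')"
    if "u \<in> carrier F" "v \<in> carrier F" "s \<in> X" "?P u s ds" "?P v (s \<cdot> val u) ds'" for u v s ds ds'
    using that path_sum_mult[OF that(1,2) X_subset[OF that(3)]] by simp
  have P_inv: "?P (inv\<^bsub>F\<^esub> u) s (map (\<lambda>(t, c). (t, - c)) ds)"
    if "u \<in> carrier F" "s \<in> X" "?P u (s \<cdot> inv\<^bsub>G\<^esub> val u) ds" for u s and ds :: "(_ \<times> int) list"
  proof -
    have "(\<Sum>(t, c)\<leftarrow>map (\<lambda>(t, c). (t, - c)) ds. c * path_sum E relator t)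
        = - (\<Sum>(t, c)\<leftarrow>ds. c * path_sum E relator t)" for E
      by (induction ds) auto
    moreover have "set (map (\<lambda>(t, c). (t, - c)) ds) \<subseteq> X \<times> UNIV" using that(3) by auto
    ultimately show ?thesis
      using path_sum_inv[OF that(1) X_subset[OF that(2)]] that(3) by simp
  qed
  have s1: "s \<cdot> \<one>\<^bsub>G\<^esub> = s" if "s \<in> X" for s using act_one[OF X_subset[OF that]] .
  have "subgroup M F"
  proof (rule F.subgroupI)
    show "M \<subseteq> carrier F" by (auto simp: M_def)
    have "?P \<one>\<^bsub>F\<^esub> s []" for s by (simp add: path_sum_one)
    then have "\<one>\<^bsub>F\<^esub> \<in> M" unfolding M_def using val.hom_one by blast
    then show "M \<noteq> {}" by blast
    show "inv\<^bsub>F\<^esub> u \<in> M" if u: "u \<in> M" for u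
    proof -
      have c: "u \<in> carrier F" "val u = \<one>\<^bsub>G\<^esub>" using u by (auto simp: M_def)
      have "\<exists>ds. ?P (inv\<^bsub>F\<^esub> u) s ds" if s: "s \<in> X" for s
      proof -
        obtain ds where "?P u s ds" using u s unfolding M_def by blast
        then show ?thesis using P_inv[OF c(1) s] c(2) s1[OF s] by (metis P.inv_one)
      qed
      then show ?thesis using c by (auto simp: M_def)
    qed
    show "u \<otimes>\<^bsub>F\<^esub> v \<in> M" if uv: "u \<in> M" "v \<in> M" for u v
    proof -
      have c: "u \<in> carrier F" "val u = \<one>\<^bsub>G\<^esub>" "v \<in> carrier F" "val v = \<one>\<^bsub>G\<^esub>" using uv by (auto simp: M_def)
      have "\<exists>ds. ?P (u \<otimes>\<^bsub>F\<^esub> v) s ds" if s: "s \<in> X" for s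
      proof -
        obtain ds ds' where "?P u s ds" "?P v s ds'" using uv s unfolding M_def by blast
        then show ?thesis using P_mult[OF c(1,3) s] c(2) s1[OF s] by metis
      qed
      then show ?thesis using c by (auto simp: M_def)
    qed
  qed
  moreover have "v \<otimes>\<^bsub>F\<^esub> u \<otimes>\<^bsub>F\<^esub> inv\<^bsub>F\<^esub> v \<in> M" if v: "v \<in> carrier F" and u: "u \<in> M" for u v
  proof -
    have c: "u \<in> carrier F" "val u = \<one>\<^bsub>G\<^esub>" using u by (auto simp: M_def)
    have "\<exists>ds. ?P (v \<otimes>\<^bsub>F\<^esub> u \<otimes>\<^bsub>F\<^esub> inv\<^bsub>F\<^esub> v) s ds" if s: "s \<in> X" for s
    proof -
      have sv: "s \<cdot> val v \<in> X" using act_X[OF s] v by simp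
      then obtain ds where ds: "?P u (s \<cdot> val v) ds" using u unfolding M_def by blast
      have "path_sum E (v \<otimes>\<^bsub>F\<^esub> u \<otimes>\<^bsub>F\<^esub> inv\<^bsub>F\<^esub> v) s = path_sum E u (s \<cdot> val v)" for E
        using path_sum_mult[of "v \<otimes>\<^bsub>F\<^esub> u" "inv\<^bsub>F\<^esub> v" s E] path_sum_mult[of v u s E]
          path_sum_inv[of v "s \<cdot> val v" E] X_subset[OF s] X_subset[OF sv] v c s1[OF s]
        by (simp add: act_act)
      then show ?thesis using ds by auto
    qed
    then show ?thesis using c v by (auto simp: M_def)
  qed
  ultimately have "M \<lhd> F" by (rule F.normal_invI)
  moreover have "relator \<in> M"
  proof -
    have "?P relator s [(s, 1)]" if "s \<in> X" for s using that by simp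
    then show ?thesis
      unfolding M_def using nonorientable_relator_closed relator_eq_one by blast
  qed
  ultimately have "NC \<subseteq> M" by (auto simp: normal_closure_def)
  then show ?thesis using w s by (auto simp: M_def)
qed

definition image_word :: "nat \<Rightarrow> nat letter list" where
  "image_word k = (SOME w. w \<in> carrier F \<and> val w = phi (x k))"

lemma image_word:
  assumes "k \<in> {1..n}"
  shows "image_word k \<in> carrier F" "val (image_word k) = phi (x k)"
proof -
  have "phi (x k) \<in> carrier G" using x_closed[OF assms] by simp
  then obtain w where "w \<in> carrier F \<and> val w = phi (x k)" using presented_word_cases by metis
  then have "image_word k \<in> carrier F \<and> val (image_word k) = phi (x k)"
    unfolding image_word_def by (rule someI)
  then show "image_word k \<in> carrier F" "val (image_word k) = phi (x k)" by auto
qed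

abbreviation subst :: "nat letter list \<Rightarrow> nat letter list" where
  "subst \<equiv> word_eval F image_word"

lemma subst_closed: "v \<in> lists ({1..n} \<times> UNIV) \<Longrightarrow> subst v \<in> carrier F"
  by (rule F.word_eval_closed) (use image_word in auto)

lemma val_subst:
  assumes "v \<in> lists ({1..n} \<times> UNIV)"
  shows "val (subst v) = phi (val v)"
proof -
  have "image_word \<in> {1..n} \<rightarrow> carrier F" using image_word by auto
  then have "val (subst v) = word_eval G (\<lambda>k. val (image_word k)) v"
    using assms by (rule val.hom_word_eval)
  also have "\<dots> = word_eval G (\<lambda>k. phi (x k)) v"
    by (rule P.word_eval_cong[OF _ assms]) (use image_word in auto)
  also have "\<dots> = phi (val v)"
    using phi.hom_word_eval[OF gen_closed assms] by simp
  finally show ?thesis .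
qed

text \<open>Each \<open>image_word k\<close> is a loop at \<open>H\<close>, since its value lies in
  \<open>H\<close>; so the sum is additive over the letters.\<close>

lemma path_sum_subst:
  assumes "v \<in> lists ({1..n} \<times> UNIV)"
  shows "path_sum E (subst v) H
    = (\<Sum>l\<leftarrow>v. (if snd l then 1 else - 1) * path_sum E (image_word (fst l)) H)"
  using assms
proof (induction v rule: list.induct)
  case Nil
  then show ?case using path_sum_one by simp
next
  case (Cons l v)
  obtain k r where l: "l = (k, r)" by force
  have v: "v \<in> lists ({1..n} \<times> UNIV)" and k: "k \<in> {1..n}" using Cons.prems l by auto
  note w = image_word[OF k]
  have h: "val (image_word k) \<in> H" "inv\<^bsub>G\<^esub> val (image_word k) \<in> H"
    using w(2) x_closed[OF k] H.m_inv_closed by auto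
  have "path_sum E (letter_eval F image_word l) H = (if r then 1 else - 1) * path_sum E (image_word k) H"
    using w path_sum_inv[OF w(1) H.subset] H_act h by (simp add: l letter_eval_def)
  moreover have "H \<cdot> val (letter_eval F image_word l) = H"
    using w h H_act by (simp add: l letter_eval_def)
  moreover have "letter_eval F image_word l \<in> carrier F"
    using w by (simp add: l letter_eval_def)
  ultimately show ?case
    using Cons.IH[OF v] path_sum_mult[OF _ subst_closed[OF v] H.subset] by (simp add: l)
qed

lemma subst_relator: "subst relator \<in> NC"
proof -
  have R: "relator \<in> lists ({1..n} \<times> UNIV)"
    using nonorientable_relator_closed by (rule carrier_free_group_lists)
  have "val (subst relator) = \<one>\<^bsub>G\<^esub>"
    using val_subst[OF R] relator_eq_one phi.hom_one by metis
  then show ?thesis using word_eval_presented_eq_one_iff[OF subst_closed[OF R]] by blast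
qed

lemma path_sum_subst_relator:
  "path_sum E (subst relator) H = 2 * (\<Sum>k\<leftarrow>[1..<Suc n]. path_sum E (image_word k) H)"
proof -
  have "relator \<in> lists ({1..n} \<times> UNIV)"
    using nonorientable_relator_closed by (rule carrier_free_group_lists)
  moreover have "(\<Sum>l\<leftarrow>squares ks. (if snd l then 1 else - 1) * f (fst l)) = 2 * (\<Sum>k\<leftarrow>ks. f k)"
    for ks and f :: "nat \<Rightarrow> int"
    by (induction ks) auto
  moreover have "relator = squares [1..<Suc n]"
    by (simp add: nonorientable_relator_def squares_def)
  ultimately show ?thesis by (simp add: path_sum_subst del: upt_Suc)
qed

text \<open>The coefficients modulo 2 of the cycle of \<open>path_sum_normal_closure\<close> are constant on the
  cosets, because the boundary of the cycle is even. This is Poincare duality: a class in the second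
  homology of the surface group is an invariant.\<close>

lemma even_boundary_imp_constant:
  fixes ds :: "(nat letter list set set \<times> int) list"
  assumes ds: "set ds \<subseteq> X \<times> UNIV"
    and even: "\<And>E. even (\<Sum>(t, c)\<leftarrow>ds. c * path_sum E relator t)"
  defines "m \<equiv> \<lambda>a. \<Sum>(t, c)\<leftarrow>ds. c * (if t = a then 1 else 0)"
  assumes s: "s \<in> X"
  shows "even (m s) \<longleftrightarrow> even (m H)"
proof -
  \<comment> \<open>The elements preserving the parity of \<open>m\<close> form a subgroup. As
    \<open>G\<close> acts transitively on \<open>X\<close>, it is enough that all generators lie in
    it.\<close>
  define T where "T = {g \<in> carrier G. \<forall>b\<in>X. even (m (b \<cdot> g)) \<longleftrightarrow> even (m b)}"
  have T: "subgroup T G"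
  proof (rule P.subgroupI)
    have "\<one>\<^bsub>G\<^esub> \<in> T" using act_one[OF X_subset] by (auto simp: T_def)
    then show "T \<noteq> {}" by blast
    show "inv\<^bsub>G\<^esub> g \<in> T" if g: "g \<in> T" for g
    proof -
      have gc: "g \<in> carrier G" using g by (simp add: T_def)
      have "even (m (b \<cdot> inv\<^bsub>G\<^esub> g)) \<longleftrightarrow> even (m b)" if b: "b \<in> X" for b
      proof -
        have "even (m (b \<cdot> inv\<^bsub>G\<^esub> g \<cdot> g)) \<longleftrightarrow> even (m (b \<cdot> inv\<^bsub>G\<^esub> g))"
          using g act_X[OF b] gc by (auto simp: T_def)
        then show ?thesis using X_subset[OF b] gc by (simp add: act_act act_one)
      qed
      then show ?thesis using gc by (simp add: T_def)
    qed
    show "g \<otimes>\<^bsub>G\<^esub> h \<in> T" if gh: "g \<in> T" "h \<in> T" for g h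
    proof -
      have c: "g \<in> carrier G" "h \<in> carrier G" using gh by (auto simp: T_def)
      have "even (m (b \<cdot> (g \<otimes>\<^bsub>G\<^esub> h))) \<longleftrightarrow> even (m b)" if b: "b \<in> X" for b
      proof -
        have "even (m (b \<cdot> g \<cdot> h)) \<longleftrightarrow> even (m (b \<cdot> g))"
          using gh(2) act_X[OF b c(1)] by (auto simp: T_def)
        also have "\<dots> \<longleftrightarrow> even (m b)" using gh(1) b by (auto simp: T_def)
        finally show ?thesis using X_subset[OF b] c by (simp add: act_act)
      qed
      then show ?thesis using c by (simp add: T_def)
    qed
  qed (auto simp: T_def)
  have "x j \<in> T" if "j \<in> {1..n}" for j
    using that
  proof (induction j rule: less_induct)
    case (less j)
    have xj: "x j \<in> carrier G" using x_closed less.prems by simp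
    \<comment> \<open>\<open>y\<close> involves only generators before \<open>j\<close>, so it lies
      in \<open>T\<close> by induction and can be removed from the conjugate
      \<open>conj\<close>.\<close>
    define y where "y = val (squares [1..<j])"
    have yT: "y \<in> T"
      unfolding y_def
      by (rule P.word_eval_in_subgroup[OF T, of "{1..<j}"])
        (use less in \<open>auto intro!: squares_in_lists\<close>)
    then have y: "y \<in> carrier G" by (simp add: T_def)
    have conj: "y \<otimes>\<^bsub>G\<^esub> x j \<otimes>\<^bsub>G\<^esub> inv\<^bsub>G\<^esub> y \<in> T"
    proof -
      have "even (m (b \<cdot> (y \<otimes>\<^bsub>G\<^esub> x j \<otimes>\<^bsub>G\<^esub> inv\<^bsub>G\<^esub> y))) \<longleftrightarrow> even (m b)" if b: "b \<in> X" for b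
      proof -
        let ?b' = "b \<cdot> (y \<otimes>\<^bsub>G\<^esub> x j \<otimes>\<^bsub>G\<^esub> inv\<^bsub>G\<^esub> y)" and ?a = "b \<cdot> y \<cdot> x j"
        have eq: "t \<cdot> y = ?a \<longleftrightarrow> t = ?b'" "t \<cdot> y \<cdot> x j = ?a \<longleftrightarrow> t = b" if t: "t \<in> X" for t
        proof -
          have tb: "t \<subseteq> carrier G" "b \<subseteq> carrier G" using X_subset t b by auto
          have cancel: "t \<cdot> g = s \<cdot> g' \<longleftrightarrow> t = s \<cdot> (g' \<otimes>\<^bsub>G\<^esub> inv\<^bsub>G\<^esub> g)"
            if "s \<subseteq> carrier G" "g \<in> carrier G" "g' \<in> carrier G" for g g' s
          proof
            assume "t \<cdot> g = s \<cdot> g'"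
            then have "t \<cdot> g \<cdot> inv\<^bsub>G\<^esub> g = s \<cdot> g' \<cdot> inv\<^bsub>G\<^esub> g" by simp
            then show "t = s \<cdot> (g' \<otimes>\<^bsub>G\<^esub> inv\<^bsub>G\<^esub> g)" using that tb by (simp add: act_act act_one)
          next
            assume "t = s \<cdot> (g' \<otimes>\<^bsub>G\<^esub> inv\<^bsub>G\<^esub> g)"
            then show "t \<cdot> g = s \<cdot> g'" using that by (simp add: act_act P.m_assoc)
          qed
          show "t \<cdot> y = ?a \<longleftrightarrow> t = ?b'"
            using cancel[OF tb(2) y, of "y \<otimes>\<^bsub>G\<^esub> x j"] tb y xj by (simp add: act_act)
          show "t \<cdot> y \<cdot> x j = ?a \<longleftrightarrow> t = b"
            using cancel[OF tb(2), of "y \<otimes>\<^bsub>G\<^esub> x j" "y \<otimes>\<^bsub>G\<^esub> x j"] tb y xj by (simp add: act_act act_one)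
        qed
        \<comment> \<open>This edge is the second \<open>j\<close>-edge of the cell at
          \<open>b\<close> and the first of the cell at \<open>?b'\<close>. Evenness for its
          indicator compares the two coefficients.\<close>
        let ?E = "\<lambda>s k. if s = ?a \<and> k = j then 1 else 0 :: int"
        have "(\<Sum>(t, c)\<leftarrow>ds. c * path_sum ?E relator t) = m ?b' + m b"
          using ds
        proof (unfold m_def, induction ds)
          case (Cons d ds)
          obtain t c where d: "d = (t, c)" by force
          have t: "t \<in> X" using Cons.prems d by auto
          have "path_sum ?E relator t = (if t = ?b' then 1 else 0) + (if t = b then 1 else 0)"
            using path_sum_edge_relator[OF less.prems X_subset[OF t], of ?a] eq[OF t]
            by (simp add: y_def)
          then show ?case using Cons by (simp add: d algebra_simps)
        qed simp
        then show ?thesis using even[of ?E] by auto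
      qed
      then show ?thesis using y xj by (simp add: T_def)
    qed
    have "inv\<^bsub>G\<^esub> y \<otimes>\<^bsub>G\<^esub> (y \<otimes>\<^bsub>G\<^esub> x j \<otimes>\<^bsub>G\<^esub> inv\<^bsub>G\<^esub> y) \<otimes>\<^bsub>G\<^esub> y \<in> T"
      using T yT conj subgroup.m_closed subgroup.m_inv_closed by metis
    then show ?case using y xj by (simp add: P.m_assoc)
  qed
  then have T_all: "val w \<in> T" if "w \<in> lists ({1..n} \<times> UNIV)" for w
    using P.word_eval_in_subgroup[OF T _ that] by blast
  obtain g where g: "g \<in> carrier G" "s = H \<cdot> g" using X_cases[OF s] .
  obtain w where "w \<in> carrier F" "g = val w" using presented_word_cases[OF g(1)] .
  then have "g \<in> T" using T_all carrier_free_group_lists by blast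
  then show ?thesis using g(2) H_in_X by (auto simp: T_def)
qed

text \<open>Any values modulo 2 extend to \<open>G\<close>, because the relator is a product of
  squares; the single value 1 makes their sum odd.\<close>

definition chi :: "nat letter list set \<Rightarrow> int" where
  "chi = (SOME h. h \<in> hom G (integer_mod_group 2) \<and> (\<forall>k\<in>{1..n}. h (x k) = (if k = 1 then 1 else 0)))"

lemma chi: "chi \<in> hom G (integer_mod_group 2)"
  "\<And>k. k \<in> {1..n} \<Longrightarrow> chi (x k) = (if k = 1 then 1 else 0)"
proof -
  define c where "c k = (if k = 1 then 1 else 0 :: int)" for k :: nat
  have c: "c \<in> {1..n} \<rightarrow> carrier (integer_mod_group 2)"
    by (auto simp: c_def carrier_integer_mod_group)
  have "word_eval (integer_mod_group 2) c (squares l) = 0" for l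
    by (induction l) (auto simp: c_def letter_eval_def word_eval_def)
  then have "word_eval (integer_mod_group 2) c r = \<one>\<^bsub>integer_mod_group 2\<^esub>" if "r \<in> {relator}" for r
    using that by (simp add: nonorientable_relator_def squares_def)
  from presented_hom_exists[OF group_integer_mod_group c this]
  obtain h where "h \<in> hom G (integer_mod_group 2)" "\<And>k. k \<in> {1..n} \<Longrightarrow> h (x k) = c k" by metis
  then have "h \<in> hom G (integer_mod_group 2) \<and> (\<forall>k\<in>{1..n}. h (x k) = (if k = 1 then 1 else 0))"
    by (simp add: c_def)
  from someI[of "\<lambda>h. h \<in> hom G (integer_mod_group 2) \<and> (\<forall>k\<in>{1..n}. h (x k) = (if k = 1 then 1 else 0))", OF this]
  have *: "chi \<in> hom G (integer_mod_group 2) \<and> (\<forall>k\<in>{1..n}. chi (x k) = (if k = 1 then 1 else 0))"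
    unfolding chi_def .
  from * show "chi \<in> hom G (integer_mod_group 2)" by blast
  from * show "chi (x k) = (if k = 1 then 1 else 0)" if "k \<in> {1..n}" for k using that by blast
qed

text \<open>Suppose that \<open>phi\<close> is injective. The character \<open>chi\<close> transported to the image of \<open>phi\<close> does
  not lift to a character modulo 4, since the relator would have the value 2. If the image had infinite
  index, then its second homology would vanish and the lift would exist.\<close>

lemma finite_index_if_injective:
  assumes inj: "inj_on phi (carrier G)"
  shows "finite X"
proof (rule ccontr)
  assume inf: "infinite X"
  let ?Z = "integer_mod_group 2"
  interpret chi: group_hom G ?Z chi
    by (simp add: group_hom_def group_hom_axioms_def P.is_group chi)
  define psi where "psi h = chi (inv_into (carrier G) phi h)" for h
  have psi_phi: "psi (phi g) = chi g" if "g \<in> carrier G" for g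
    using inv_into_f_f[OF inj that] by (simp add: psi_def)
  have psi_range: "psi h \<in> {0, 1}" if h: "h \<in> H" for h
  proof -
    obtain g where "g \<in> carrier G" "h = phi g" using h by blast
    then have "0 \<le> psi h \<and> psi h < 2"
      using psi_phi chi.hom_closed[of g] by (simp add: carrier_integer_mod_group)
    then have "psi h = 0 \<or> psi h = 1" by arith
    then show ?thesis by simp
  qed
  have psi_mult: "psi (h \<otimes>\<^bsub>G\<^esub> h') = (psi h + psi h') mod 2" if h: "h \<in> H" "h' \<in> H" for h h'
  proof -
    obtain g g' where "g \<in> carrier G" "h = phi g" "g' \<in> carrier G" "h' = phi g'" using h by blast
    then show ?thesis
      using psi_phi[of "g \<otimes>\<^bsub>G\<^esub> g'"] psi_phi chi.hom_mult by simp
  qed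
  \<comment> \<open>A transversal normalised by \<open>r H = \<one>\<close>, so that
    \<open>cocycle H h = h\<close> for \<open>h\<close> in \<open>H\<close>.\<close>
  define r where "r s = (if s = H then \<one>\<^bsub>G\<^esub> else SOME g. g \<in> carrier G \<and> s = H \<cdot> g)" for s
  have r: "r s \<in> carrier G" "H \<cdot> r s = s" if s: "s \<in> X" for s
  proof -
    have "r s \<in> carrier G \<and> s = H \<cdot> r s"
    proof (cases "s = H")
      case True
      then show ?thesis using act_one[OF H.subset] by (simp add: r_def)
    next
      case False
      obtain g where "g \<in> carrier G \<and> s = H \<cdot> g" using X_cases[OF s] by metis
      from someI[of "\<lambda>g. g \<in> carrier G \<and> s = H \<cdot> g", OF this] show ?thesis
        using False by (simp add: r_def)
    qed
    then show "r s \<in> carrier G" "H \<cdot> r s = s" by auto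
  qed
  define cocycle where "cocycle s g = r s \<otimes>\<^bsub>G\<^esub> g \<otimes>\<^bsub>G\<^esub> inv\<^bsub>G\<^esub> r (s \<cdot> g)" for s g
  have cocycle_H: "cocycle s g \<in> H" if s: "s \<in> X" and g: "g \<in> carrier G" for s g
  proof -
    note c = r[OF s] r[OF act_X[OF s g]]
    have "H \<cdot> cocycle s g = H \<cdot> r s \<cdot> g \<cdot> inv\<^bsub>G\<^esub> r (s \<cdot> g)"
      using c(1,3) g H.subset by (simp add: cocycle_def act_act)
    also have "\<dots> = H \<cdot> r (s \<cdot> g) \<cdot> inv\<^bsub>G\<^esub> r (s \<cdot> g)"
      by (simp only: c(2,4))
    also have "\<dots> = H"
      using c(3) H.subset by (simp only: act_act P.inv_closed P.r_inv act_one)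
    finally have "H \<cdot> cocycle s g = H" .
    then show ?thesis
      using P.r_coset_eq_self_iff[OF H.subgroup_axioms, of "cocycle s g"] c g
      by (simp add: cocycle_def)
  qed
  have cocycle_mult: "cocycle s (g \<otimes>\<^bsub>G\<^esub> h) = cocycle s g \<otimes>\<^bsub>G\<^esub> cocycle (s \<cdot> g) h"
    if s: "s \<in> X" and g: "g \<in> carrier G" "h \<in> carrier G" for s g h
    using r[OF s] r[OF act_X[OF s g(1)]] r[OF act_X[OF act_X[OF s g(1)] g(2)]] g X_subset[OF s]
    by (simp add: cocycle_def P.m_assoc act_act)
  \<comment> \<open>The integers 0 and 1 lift the values of \<open>psi\<close>: modulo 2 the path
    sums compute \<open>psi\<close>, and modulo 4 they measure the obstruction to a lift.\<close>
  define E where "E s k = psi (cocycle s (x k))" for s k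
  have sub_mod: "(a - b) mod 2 = c mod 2" if "a mod 2 = (b + c) mod 2" for a b c :: int
    using that by presburger
  have psi_one: "psi \<one>\<^bsub>G\<^esub> = 0"
    using psi_phi[of "\<one>\<^bsub>G\<^esub>"] by simp
  have sum_mod: "path_sum E w s mod 2 = psi (cocycle s (val w))"
    if "w \<in> lists ({1..n} \<times> UNIV)" "s \<in> X" for w s
    using that
  proof (induction w arbitrary: s rule: list.induct)
    case Nil
    then show ?case
      using r[OF Nil(2)] X_subset[OF Nil(2)] psi_one by (simp add: cocycle_def act_one)
  next
    case (Cons l w)
    obtain k b where l: "l = (k, b)" by force
    have w: "w \<in> lists ({1..n} \<times> UNIV)" and k: "k \<in> {1..n}" using Cons.prems l by auto
    have xk: "x k \<in> carrier G" using x_closed[OF k] .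
    note vw = val_closed[OF w]
    show ?case
    proof (cases b)
      case True
      have "psi (cocycle s (x k \<otimes>\<^bsub>G\<^esub> val w)) = (E s k + psi (cocycle (s \<cdot> x k) (val w))) mod 2"
        unfolding cocycle_mult[OF Cons.prems(2) xk vw] E_def
        by (rule psi_mult) (simp_all add: cocycle_H Cons.prems(2) xk vw act_X)
      also have "psi (cocycle (s \<cdot> x k) (val w)) = path_sum E w (s \<cdot> x k) mod 2"
        using Cons.IH[OF w] act_X[OF Cons.prems(2) xk] by simp
      finally show ?thesis using True by (simp add: l letter_eval_def mod_simps)
    next
      case False
      let ?s = "s \<cdot> inv\<^bsub>G\<^esub> x k"
      have s': "?s \<in> X" using act_X[OF Cons.prems(2)] xk by simp
      have "s = ?s \<cdot> x k" using X_subset[OF Cons.prems(2)] xk by (simp add: act_act act_one)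
      have "psi (cocycle ?s (x k \<otimes>\<^bsub>G\<^esub> (inv\<^bsub>G\<^esub> x k \<otimes>\<^bsub>G\<^esub> val w)))
        = (E ?s k + psi (cocycle s (inv\<^bsub>G\<^esub> x k \<otimes>\<^bsub>G\<^esub> val w))) mod 2"
        unfolding cocycle_mult[OF s' xk P.m_closed[OF P.inv_closed[OF xk] vw]] E_def
          \<open>s = ?s \<cdot> x k\<close>[symmetric]
        by (rule psi_mult) (simp_all add: cocycle_H Cons.prems(2) xk vw s')
      then have "path_sum E w ?s mod 2 = (E ?s k + psi (cocycle s (inv\<^bsub>G\<^esub> x k \<otimes>\<^bsub>G\<^esub> val w))) mod 2"
        using Cons.IH[OF w s'] xk vw by simp
      then have "(path_sum E w ?s - E ?s k) mod 2 = psi (cocycle s (inv\<^bsub>G\<^esub> x k \<otimes>\<^bsub>G\<^esub> val w)) mod 2"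
        by (rule sub_mod)
      moreover have "psi (cocycle s (inv\<^bsub>G\<^esub> x k \<otimes>\<^bsub>G\<^esub> val w)) \<in> {0, 1}"
        by (rule psi_range) (simp add: cocycle_H Cons.prems(2) xk vw)
      ultimately show ?thesis using False by (auto simp: l letter_eval_def)
    qed
  qed
  have R: "relator \<in> lists ({1..n} \<times> UNIV)"
    using nonorientable_relator_closed by (rule carrier_free_group_lists)
  have rel_even: "even (path_sum E relator s)" if s: "s \<in> X" for s
    using sum_mod[OF R s] r[OF s] X_subset[OF s] psi_one
    by (simp add: relator_eq_one cocycle_def act_one even_iff_mod_2_eq_zero)
  have odd_iff: "odd (path_sum E (image_word k) H) \<longleftrightarrow> k = 1" if k: "k \<in> {1..n}" for k
  proof -
    note w = image_word[OF k]
    have "H \<cdot> phi (x k) = H" using H_act x_closed[OF k] by simp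
    then have "cocycle H (val (image_word k)) = phi (x k)"
      using w x_closed[OF k] by (simp add: cocycle_def r_def)
    then have "path_sum E (image_word k) H mod 2 = (if k = 1 then 1 else 0)"
      using sum_mod[OF carrier_free_group_lists[OF w(1)] H_in_X] psi_phi chi(2)[OF k] x_closed[OF k] by simp
    then show ?thesis by (simp add: odd_iff_mod_2_eq_one split: if_splits)
  qed
  have "[1..<Suc n] = 1 # [Suc 1..<Suc n]" using n3 by (simp add: upt_conv_Cons)
  moreover have "even (\<Sum>k\<leftarrow>[Suc 1..<Suc n]. path_sum E (image_word k) H)"
  proof -
    have "even (\<Sum>k\<leftarrow>l. path_sum E (image_word k) H)" if "set l \<subseteq> {1..n} - {1}" for l
      using that
    proof (induction l)
      case (Cons k l)
      then have "even (path_sum E (image_word k) H)" using odd_iff[of k] by simp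
      then show ?case using Cons by simp
    qed simp
    moreover have "set [Suc 1..<Suc n] \<subseteq> {1..n} - {1}" by (auto simp del: upt_Suc)
    ultimately show ?thesis by blast
  qed
  ultimately have "odd (\<Sum>k\<leftarrow>[1..<Suc n]. path_sum E (image_word k) H)"
    using odd_iff[of 1] n3 by simp
  then have not4: "\<not> 4 dvd path_sum E (subst relator) H"
    unfolding path_sum_subst_relator using dvd_mult_cancel_left[of "2::int" 2] by auto
  obtain ds where ds: "set ds \<subseteq> X \<times> UNIV"
    "\<And>E. path_sum E (subst relator) H = (\<Sum>(t, c)\<leftarrow>ds. c * path_sum E relator t)"
    using path_sum_normal_closure[OF subst_relator H_in_X] by blast
  define m where "m a = (\<Sum>(t, c)\<leftarrow>ds. c * (if t = a then 1 else 0))" for a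
  have const: "even (m s) \<longleftrightarrow> even (m H)" if "s \<in> X" for s
    unfolding m_def
    by (rule even_boundary_imp_constant[OF ds(1) _ that])
      (simp add: path_sum_subst_relator flip: ds(2))
  \<comment> \<open>Infinite index enters here: a coset that carries no cell has coefficient 0, and
    by constancy all coefficients are even.\<close>
  obtain s where s: "s \<in> X" "s \<notin> fst ` set ds"
    using inf finite_subset[of X "fst ` set ds"] by blast
  have "m s = 0"
  proof -
    have "(\<Sum>(t, c)\<leftarrow>ds. c * (if t = s then 1 else 0)) = (0::int)"
      using s(2)
    proof (induction ds)
      case (Cons d ds)
      then have "fst d \<noteq> s" by force
      then show ?case using Cons by (simp add: case_prod_beta)
    qed simp
    then show ?thesis by (simp add: m_def)
  qed
  then have m_even: "even (m a)" if "a \<in> X" for a using const[OF s(1)] const[OF that] by simp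
  have "(\<Sum>(t, c)\<leftarrow>ds. c * f t) = (\<Sum>a\<in>fst ` set ds. m a * f a)" for f :: "_ \<Rightarrow> int"
  proof -
    have "(\<Sum>(t, c)\<leftarrow>es. c * f t) = (\<Sum>a\<in>A. (\<Sum>(t, c)\<leftarrow>es. c * (if t = a then 1 else 0)) * f a)"
      if "finite A" "fst ` set es \<subseteq> A" for A es
      using that(2)
    proof (induction es)
      case (Cons e es)
      obtain t c where e: "e = (t, c)" by force
      have "t \<in> A" using Cons.prems e by auto
      then have "c * f t = (\<Sum>a\<in>A. c * (if t = a then 1 else 0) * f a)"
        using that(1) by (simp add: if_distrib if_distribR sum.delta cong: if_cong)
      then show ?case using Cons by (simp add: e distrib_right sum.distrib)
    qed simp
    then show ?thesis by (simp add: m_def)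
  qed
  then have "path_sum E (subst relator) H = (\<Sum>a\<in>fst ` set ds. m a * path_sum E relator a)"
    by (simp add: ds(2))
  moreover have "2 * 2 dvd m a * path_sum E relator a" if "a \<in> fst ` set ds" for a
  proof -
    have "a \<in> X" using that ds(1) by auto
    then show ?thesis using m_even rel_even by (intro mult_dvd_mono) auto
  qed
  ultimately have "4 dvd path_sum E (subst relator) H" by (auto intro: dvd_sum)
  then show False using not4 by contradiction
qed

text \<open>Right translation permutes \<open>X\<close>, so the two occurrences of each generator
  contribute equal sums. Thus one relator condition follows from the others, which gives one factor
  with exponent \<open>m - 1\<close> in the count below.\<close>

lemma even_sum_path_sum_squares:
  assumes fin: "finite X"
  shows "set l \<subseteq> {1..n} \<Longrightarrow> g \<in> carrier G \<Longrightarrow> even (\<Sum>s\<in>X. path_sum E (squares l) (s \<cdot> g))"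
proof (induction l arbitrary: g)
  case (Cons k l)
  have xk: "x k \<in> carrier G" using x_closed Cons.prems by simp
  have shift: "(\<Sum>s\<in>X. f (s \<cdot> h)) = (\<Sum>s\<in>X. f s)" if "h \<in> carrier G" for f :: "_ \<Rightarrow> int" and h
    by (rule sum.reindex_bij_witness[of _ "\<lambda>s. s \<cdot> inv\<^bsub>G\<^esub> h" "\<lambda>s. s \<cdot> h"])
      (use that act_X in \<open>auto simp: act_act act_one X_subset\<close>)
  have "(\<Sum>s\<in>X. path_sum E (squares (k # l)) (s \<cdot> g))
    = (\<Sum>s\<in>X. E (s \<cdot> g) k) + (\<Sum>s\<in>X. E (s \<cdot> (g \<otimes>\<^bsub>G\<^esub> x k)) k)
      + (\<Sum>s\<in>X. path_sum E (squares l) (s \<cdot> (g \<otimes>\<^bsub>G\<^esub> x k \<otimes>\<^bsub>G\<^esub> x k)))"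
    using xk Cons.prems by (simp add: sum.distrib act_act X_subset)
  then show ?case
    using shift[of g "\<lambda>s. E s k"] shift[of "g \<otimes>\<^bsub>G\<^esub> x k" "\<lambda>s. E s k"] xk Cons by simp
qed simp

text \<open>Up to an element of the normal closure, \<open>v\<close> is a product of the loops
  \<open>image_word k\<close> and their inverses.\<close>

lemma path_sum_even_on_image:
  assumes rel: "\<And>s. s \<in> X \<Longrightarrow> even (path_sum E relator s)"
    and gen: "\<And>k. k \<in> {1..n} \<Longrightarrow> even (path_sum E (image_word k) H)"
    and v: "v \<in> carrier F" "val v \<in> H"
  shows "even (path_sum E v H)"
proof -
  obtain g where g: "g \<in> carrier G" "val v = phi g" using v(2) by blast
  obtain u where u: "u \<in> carrier F" "g = val u" using presented_word_cases[OF g(1)] .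
  have ul: "u \<in> lists ({1..n} \<times> UNIV)" using u(1) by (rule carrier_free_group_lists)
  note su = subst_closed[OF ul]
  have val_su: "val (subst u) = val v" using val_subst[OF ul] g u by simp
  have "even (path_sum E (subst u) H)"
    unfolding path_sum_subst[OF ul] using ul
  proof (induction u rule: list.induct)
    case (Cons l u)
    then show ?case using gen[of "fst l"] by (cases l) auto
  qed simp
  moreover have "even (path_sum E (v \<otimes>\<^bsub>F\<^esub> inv\<^bsub>F\<^esub> subst u) H)"
  proof -
    have "v \<otimes>\<^bsub>F\<^esub> inv\<^bsub>F\<^esub> subst u \<in> NC"
      using word_eval_presented_eq_one_iff[of "v \<otimes>\<^bsub>F\<^esub> inv\<^bsub>F\<^esub> subst u"] v su val_su by simp
    then obtain ds where ds: "set ds \<subseteq> X \<times> UNIV"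
      "path_sum E (v \<otimes>\<^bsub>F\<^esub> inv\<^bsub>F\<^esub> subst u) H = (\<Sum>(t, c)\<leftarrow>ds. c * path_sum E relator t)"
      using path_sum_normal_closure[OF _ H_in_X] by blast
    have "even (\<Sum>(t, c)\<leftarrow>ds. c * path_sum E relator t)"
      using ds(1) by (induction ds) (auto simp: rel)
    then show ?thesis by (simp add: ds(2))
  qed
  moreover have "path_sum E (v \<otimes>\<^bsub>F\<^esub> inv\<^bsub>F\<^esub> subst u) H = path_sum E v H - path_sum E (subst u) H"
    using path_sum_mult[OF v(1) F.inv_closed[OF su] H.subset, of E]
      path_sum_inv[OF su H.subset, of E] H_act[OF v(2)] H_act[OF H.m_inv_closed[OF v(2)]] val_su
    by simp
  ultimately show ?thesis by simp
qed

text \<open>Modulo 2, the edge labellings of the coset graph of index \<open>m\<close> form a space of dimension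
  \<open>n m\<close>. Those that vanish on all translates of the relator satisfy at most \<open>m - 1\<close> conditions, and
  they are determined by a character of the image, which has \<open>n\<close> generators, and \<open>m - 1\<close> values of
  a potential. Hence \<open>n m \<le> 2 (m - 1) + n\<close>, which is the Euler characteristic comparison
  \<open>m (n - 2) \<le> n - 2\<close>.\<close>

lemma surjective_if_finite_index:
  assumes fin: "finite X"
  shows "H = carrier G"
proof -
  define m where "m = card X"
  have m: "m > 0" using fin H_in_X by (auto simp: m_def card_gt_0_iff)
  have card_XH: "card (X - {H}) = m - 1" using fin H_in_X by (simp add: m_def)
  \<comment> \<open>Paths from \<open>H\<close> to all cosets. The one to \<open>H\<close> is empty,
    so the potential vanishes there and only \<open>m - 1\<close> of its values are free.\<close>
  define word where "word s = (if s = H then [] else SOME w. w \<in> carrier F \<and> H \<cdot> val w = s)" for s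
  have word: "word s \<in> carrier F" "H \<cdot> val (word s) = s" if s: "s \<in> X" for s
  proof -
    have "word s \<in> carrier F \<and> H \<cdot> val (word s) = s"
    proof (cases "s = H")
      case True
      then show ?thesis using act_one[OF H.subset] by (simp add: word_def free_group_def)
    next
      case False
      obtain g where g: "g \<in> carrier G" "s = H \<cdot> g" using X_cases[OF s] .
      obtain w where "w \<in> carrier F" "g = val w" using presented_word_cases[OF g(1)] .
      then have "w \<in> carrier F \<and> H \<cdot> val w = s" using g by simp
      from someI[of "\<lambda>w. w \<in> carrier F \<and> H \<cdot> val w = s", OF this] show ?thesis
        using False by (simp add: word_def)
    qed
    then show "word s \<in> carrier F" "H \<cdot> val (word s) = s" by auto
  qed
  define L where "L e s k = (if (s, k) \<in> e then 1 else 0 :: int)"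
    for e :: "(nat letter list set set \<times> nat) set" and s k
  \<comment> \<open>Counting replaces linear algebra over the field with two elements: a labelling
    is a set of edges, and these three sets of parities determine it.\<close>
  define T where "T e = ({s \<in> X - {H}. odd (path_sum (L e) relator s)},
    {k \<in> {1..n}. odd (path_sum (L e) (image_word k) H)},
    {s \<in> X - {H}. odd (path_sum (L e) (word s) H)})" for e
  have "inj_on T (Pow (X \<times> {1..n}))"
  proof (rule inj_onI)
    fix e e' assume e: "e \<in> Pow (X \<times> {1..n})" "e' \<in> Pow (X \<times> {1..n})" "T e = T e'"
    define E where "E s k = L e s k - L e' s k" for s k
    have E_sum: "path_sum E w s = path_sum (L e) w s - path_sum (L e') w s" for w s
      unfolding E_def[abs_def] by (rule path_sum_diff)
    have eqs: "{s \<in> X - {H}. odd (path_sum (L e) relator s)} = {s \<in> X - {H}. odd (path_sum (L e') relator s)}"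
      "{k \<in> {1..n}. odd (path_sum (L e) (image_word k) H)} = {k \<in> {1..n}. odd (path_sum (L e') (image_word k) H)}"
      "{s \<in> X - {H}. odd (path_sum (L e) (word s) H)} = {s \<in> X - {H}. odd (path_sum (L e') (word s) H)}"
      using e(3) unfolding T_def by (simp_all only: prod.inject)
    have T1: "even (path_sum E relator s)" if "s \<in> X - {H}" for s
      using eqset_imp_iff[OF eqs(1), of s] that by (simp add: E_sum)
    have gen: "even (path_sum E (image_word k) H)" if "k \<in> {1..n}" for k
      using eqset_imp_iff[OF eqs(2), of k] that by (simp add: E_sum)
    have T3: "even (path_sum E (word s) H)" if "s \<in> X - {H}" for s
      using eqset_imp_iff[OF eqs(3), of s] that by (simp add: E_sum)
    have word_even: "even (path_sum E (word s) H)" if "s \<in> X" for s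
      using T3 that by (cases "s = H") (auto simp: word_def)
    have "even (\<Sum>s\<in>X. path_sum E relator (s \<cdot> \<one>\<^bsub>G\<^esub>))"
      unfolding nonorientable_relator_def squares_def[symmetric]
      by (rule even_sum_path_sum_squares[OF fin]) auto
    then have "even (\<Sum>s\<in>X. path_sum E relator s)" by (simp add: act_one X_subset)
    moreover have "even (\<Sum>s\<in>X - {H}. path_sum E relator s)" using T1 by (rule dvd_sum)
    ultimately have "even (path_sum E relator H)"
      using fin H_in_X by (simp add: sum.remove[of X H])
    then have rel: "even (path_sum E relator s)" if "s \<in> X" for s
      using T1 that by (cases "s = H") auto
    have E_even: "even (E s k)" if s: "s \<in> X" and k: "k \<in> {1..n}" for s k
    proof -
      have xk: "x k \<in> carrier G" using x_closed[OF k] .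
      note sk = act_X[OF s xk]
      have gk: "free_gen k \<in> carrier F" "val (free_gen k) = x k"
        using free_gen_closed[OF k] P.word_eval_gen[of x k] xk by auto
      let ?u = "word s \<otimes>\<^bsub>F\<^esub> free_gen k"
      have u: "?u \<in> carrier F" using word[OF s] gk by simp
      \<comment> \<open>The path to \<open>s\<close>, the edge \<open>k\<close> and the way back
        from \<open>s \<cdot> x k\<close> form a loop at \<open>H\<close>.\<close>
      let ?v = "?u \<otimes>\<^bsub>F\<^esub> inv\<^bsub>F\<^esub> word (s \<cdot> x k)"
      have Hu: "H \<cdot> val ?u = s \<cdot> x k"
        using word[OF s] gk xk H.subset by (simp flip: act_act)
      have back_H: "s \<cdot> x k \<cdot> inv\<^bsub>G\<^esub> val (word (s \<cdot> x k)) = H"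
      proof -
        have "H \<cdot> val (word (s \<cdot> x k)) \<cdot> inv\<^bsub>G\<^esub> val (word (s \<cdot> x k)) = H"
          using word(1)[OF sk] H.subset by (simp add: act_act act_one)
        then show ?thesis using word(2)[OF sk] by simp
      qed
      have v: "?v \<in> carrier F" using u word[OF sk] by simp
      have "H \<cdot> val ?v = H \<cdot> val ?u \<cdot> inv\<^bsub>G\<^esub> val (word (s \<cdot> x k))"
        using u word(1)[OF sk] H.subset by (simp add: act_act)
      then have "H \<cdot> val ?v = H" using Hu back_H by simp
      then have vH: "val ?v \<in> H"
        using P.r_coset_eq_self_iff[OF H.subgroup_axioms, of "val ?v"] v by simp
      have "even (path_sum E ?v H)"
        by (rule path_sum_even_on_image[OF rel gen v vH])
      moreover have "path_sum E ?v H = path_sum E ?u H - path_sum E (word (s \<cdot> x k)) H"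
        using path_sum_mult[OF u F.inv_closed[OF word(1)[OF sk]] H.subset, of E] Hu
          path_sum_inv[OF word(1)[OF sk] X_subset[OF sk], of E] back_H by simp
      moreover have "path_sum E ?u H = path_sum E (word s) H + E s k"
        using path_sum_mult[OF word(1)[OF s] gk(1) H.subset, of E] word(2)[OF s]
        by (simp add: free_gen_def)
      ultimately show ?thesis using word_even[OF s] word_even[OF sk] by simp
    qed
    have "(s, k) \<in> e \<longleftrightarrow> (s, k) \<in> e'" if "s \<in> X" "k \<in> {1..n}" for s k
      using E_even[OF that] by (auto simp: E_def L_def split: if_splits)
    then show "e = e'" using e(1,2) by blast
  qed
  moreover have "T ` Pow (X \<times> {1..n}) \<subseteq> Pow (X - {H}) \<times> Pow {1..n} \<times> Pow (X - {H})"
    by (auto simp: T_def)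
  ultimately have "card (Pow (X \<times> {1..n})) \<le> card (Pow (X - {H}) \<times> Pow {1..n} \<times> Pow (X - {H}))"
    using fin by (intro card_inj_on_le) auto
  then have "(2::nat) ^ (m * n) \<le> 2 ^ (m - 1) * (2 ^ n * 2 ^ (m - 1))"
    using fin by (simp add: card_Pow card_cartesian_product card_XH m_def[symmetric])
  then have "(2::nat) ^ (m * n) \<le> 2 ^ ((m - 1) + (n + (m - 1)))"
    by (simp add: power_add)
  then have le: "m * n \<le> (m - 1) + (n + (m - 1))"
    by simp
  \<comment> \<open>For \<open>m = j + 1\<close> the inequality reads
    \<open>j * n \<le> 2 * j\<close>, which fails for \<open>j > 0\<close> since
    \<open>n \<ge> 3\<close>.\<close>
  have "m = 1"
  proof (rule ccontr)
    assume "m \<noteq> 1"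
    then obtain j where j: "m = Suc j" "j > 0" using m by (cases m) auto
    have "j * 3 \<le> j * n" using n3 by simp
    moreover have "m * n = n + j * n" using j by simp
    ultimately show False using le j by linarith
  qed
  then obtain s where "X = {s}" unfolding m_def by (rule card_1_singletonE)
  then have "X = {H}" using H_in_X by simp
  have "g \<in> H" if g: "g \<in> carrier G" for g
  proof -
    have "H \<cdot> g = H" using act_X[OF H_in_X g] \<open>X = {H}\<close> by blast
    then show ?thesis using P.r_coset_eq_self_iff[OF H.subgroup_axioms g] by simp
  qed
  then show ?thesis using H.subset by blast
qed

theorem surjective_if_injective: "inj_on phi (carrier G) \<Longrightarrow> phi ` carrier G = carrier G"
  using finite_index_if_injective surjective_if_finite_index by blast

end

theorem proposition7p10:
  fixes n p :: nat and w :: "nat letter list" and i :: "nat \<Rightarrow> nat"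
  assumes "n \<ge> 3"
    and "prime p" and "p \<ge> 3"
    and "w \<in> carrier (free_group {1..n - 1})"
    and "topological_test_element
           (pro_p_completion p (free_group {1..n - 1}))
           (pro_p_topology p (free_group {1..n - 1}))
           (pro_p_map p (free_group {1..n - 1}) w)"
    and "i ` {1..n - 1} \<subseteq> {1..n}" and "inj_on i {1..n - 1}"
  shows "test_element (nonorientable_surface_group n)
           (word_eval (nonorientable_surface_group n) (\<lambda>j. surface_gen n (i j)) w)"
proof -
  interpret surface_group_subfamily n p i
    using assms by unfold_locales
  let ?t = "word_eval G (\<lambda>j. x (i j)) w"
  have "?t \<in> carrier G"
    by (rule P.word_eval_closed[OF _ carrier_free_group_lists[OF assms(4)]]) (use i_closed in auto)
  moreover have "phi \<in> iso G G" if phi: "phi \<in> hom G G" "phi ?t = ?t" for phi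
  proof -
    interpret phi: surface_group_endomorphism n phi
      by unfold_locales (rule phi(1))
    have "g = \<one>\<^bsub>G\<^esub>" if "g \<in> carrier G" "phi g = \<one>\<^bsub>G\<^esub>" for g
      by (rule injective_if_test_element[OF assms(4,5) phi that])
    then have inj: "inj_on phi (carrier G)"
      using phi.phi.inj_on_one_iff by blast
    show ?thesis
      using phi(1) inj phi.surjective_if_injective[OF inj] unfolding iso_def bij_betw_def by blast
  qed
  ultimately show ?thesis by (simp add: test_element_def)
qed

end
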